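(* Let $F$ be a field and let $\varphi:\mathcal{R}(3)\to \mathsf{PG}(2,F)$ be an embedding of the Ree unital $\mathcal{R}(3)$ into the projective plane over $F$. Then: (i) $\mathbb{F}_8$ is a subfield of $F$, and the image of $\varphi$ is contained in a subplane of $\mathsf{PG}(2,F)$ of order $8$; (ii) the embedding is unique up to the action of $\operatorname{Aut}(\mathcal{R}(3))$ and of $\mathsf{PGL}(3,F)$; (iii) the embedding is admissible.
   Context: For $q=3^{2m+1}$ ($m\ge 0$), let $\mathsf{Ree}(q)={}^2G_2(q)$ be the Ree group, of order $(q^3+1)q^3(q-1)$; $\mathsf{Ree}(3)\cong \mathsf{P\Gamma L}(2,8)$. $\mathsf{Ree}(q)$ acts 2-transitively by conjugation on its $q^3+1$ Sylow $3$-subgroups; every involution fixes exactly $q+1$ of them. The Ree unital $\mathcal{R}(q)$ is the $2$-$(q^3+1,q+1,1)$ design whose points are the Sylow $3$-subgroups of $\mathsf{Ree}(q)$ and whose blocks are the fixed-point sets of the involutions of $\mathsf{Ree}(q)$. An embedding of a design $\mathcal{D}=(\mathcal{P},\mathcal{B},I)$ into a projective plane $\Pi$ is an injective map $\varrho$ sending points to points and blocks to lines such that for all points $P$ and blocks $B$, $P\,I\,B$ iff $\varrho(P)$ is incident with $\varrho(B)$. The embedding is admissible if for every automorphism $\alpha$ of $\mathcal{D}$ there is a collineation $\beta$ of $\Pi$ with $\varrho(P^\alpha)=\varrho(P)^\beta$ for all points $P$.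
   Formalization: Part (iii) fails for some F (e.g. function field over F_8 of an elliptic curve with j in F_8 but not F_2). Proved instead: φ is admissible into each order-8 subplane containing its image, and into PG(2,F) if some automorphism of F acts nontrivially on F_8 (also necessary). *)

theory Defs
  imports "HOL-Computational_Algebra.Primes" "HOL-Analysis.Cartesian_Space" "HOL-Algebra.Multiplicative_Group"
begin

subsection \<open>Incidence structures, embeddings and projective planes\<close>

record ('p, 'b) incidence_structure =
  pts :: "'p set"
  blks :: "'b set"
  inc :: "'p \<Rightarrow> 'b \<Rightarrow> bool"

text \<open>
  A map acting on points and blocks of an incidence structure is a pair of functions, one on points
  and one on blocks; the values outside the point set and the block set are irrelevant.
\<close>

definition embedding ::
  "('p, 'b) incidence_structure \<Rightarrow> ('q, 'l) incidence_structure \<Rightarrow> ('p \<Rightarrow> 'q) \<Rightarrow> ('b \<Rightarrow> 'l) \<Rightarrow> bool"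
  where
  "embedding D E f g \<longleftrightarrow>
     f ` pts D \<subseteq> pts E \<and> g ` blks D \<subseteq> blks E \<and>
     inj_on f (pts D) \<and> inj_on g (blks D) \<and>
     (\<forall>P\<in>pts D. \<forall>B\<in>blks D. inc D P B \<longleftrightarrow> inc E (f P) (g B))"

text \<open>For a projective plane, the automorphisms in this sense are the collineations.\<close>

definition automorphism ::
  "('p, 'b) incidence_structure \<Rightarrow> ('p \<Rightarrow> 'p) \<Rightarrow> ('b \<Rightarrow> 'b) \<Rightarrow> bool" where
  "automorphism D a b \<longleftrightarrow>
     bij_betw a (pts D) (pts D) \<and> bij_betw b (blks D) (blks D) \<and>
     (\<forall>P\<in>pts D. \<forall>B\<in>blks D. inc D P B \<longleftrightarrow> inc D (a P) (b B))"

definition admissible ::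
  "('p, 'b) incidence_structure \<Rightarrow> ('q, 'l) incidence_structure \<Rightarrow> ('p \<Rightarrow> 'q) \<Rightarrow> bool" where
  "admissible D E f \<longleftrightarrow>
     (\<forall>a b. automorphism D a b \<longrightarrow>
        (\<exists>c d. automorphism E c d \<and> (\<forall>P\<in>pts D. f (a P) = c (f P))))"

definition projective_plane :: "('p, 'b) incidence_structure \<Rightarrow> bool" where
  "projective_plane E \<longleftrightarrow>
     (\<forall>P\<in>pts E. \<forall>Q\<in>pts E. P \<noteq> Q \<longrightarrow> (\<exists>!l. l \<in> blks E \<and> inc E P l \<and> inc E Q l)) \<and>
     (\<forall>l\<in>blks E. \<forall>m\<in>blks E. l \<noteq> m \<longrightarrow> (\<exists>!P. P \<in> pts E \<and> inc E P l \<and> inc E P m)) \<and>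
     (\<exists>S. S \<subseteq> pts E \<and> card S = 4 \<and>
          (\<forall>l\<in>blks E. card {P \<in> S. inc E P l} \<le> 2))"

definition has_order :: "('p, 'b) incidence_structure \<Rightarrow> nat \<Rightarrow> bool" where
  "has_order E n \<longleftrightarrow>
     (\<forall>l\<in>blks E. card {P \<in> pts E. inc E P l} = n + 1)"

definition subplane ::
  "('p, 'b) incidence_structure \<Rightarrow> ('p, 'b) incidence_structure \<Rightarrow> bool" where
  "subplane E0 E \<longleftrightarrow>
     projective_plane E0 \<and> pts E0 \<subseteq> pts E \<and> blks E0 \<subseteq> blks E \<and>
     (\<forall>P\<in>pts E0. \<forall>l\<in>blks E0. inc E0 P l \<longleftrightarrow> inc E P l)"

definition PG2 :: "(('f::field ^ 3) set, ('f ^ 3) set) incidence_structure" where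
  "PG2 = \<lparr> pts = {V. vec.subspace V \<and> vec.dim V = 1},
           blks = {V. vec.subspace V \<and> vec.dim V = 2},
           inc = (\<subseteq>) \<rparr>"

subsection \<open>Fields and semilinear groups\<close>

definition is_subfield :: "'f::field set \<Rightarrow> bool" where
  "is_subfield K \<longleftrightarrow>
     0 \<in> K \<and> 1 \<in> K \<and> (\<forall>x\<in>K. \<forall>y\<in>K. x + y \<in> K \<and> x * y \<in> K) \<and>
     (\<forall>x\<in>K. - x \<in> K \<and> inverse x \<in> K)"

definition field_automorphism :: "('f::field \<Rightarrow> 'f) \<Rightarrow> bool" where
  "field_automorphism s \<longleftrightarrow>
     bij s \<and> (\<forall>x y. s (x + y) = s x + s y) \<and> (\<forall>x y. s (x * y) = s x * s y)"

definition GammaL :: "('k::field ^ 'n \<Rightarrow> 'k ^ 'n) monoid" where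
  "GammaL =
     \<lparr> carrier = {f. bij f \<and> (\<forall>u v. f (u + v) = f u + f v) \<and>
                      (\<exists>s. field_automorphism s \<and> (\<forall>c v. f (c *s v) = s c *s f v))},
       mult = (\<circ>), one = id \<rparr>"

definition scalar_maps :: "('k::field ^ 'n \<Rightarrow> 'k ^ 'n) set" where
  "scalar_maps = {(\<lambda>v. c *s v) | c. c \<noteq> 0}"

definition PGammaL :: "('k::field ^ 'n \<Rightarrow> 'k ^ 'n) set monoid" where
  "PGammaL = GammaL Mod scalar_maps"

subsection \<open>Ree unitals\<close>

definition sylow_subgroups :: "nat \<Rightarrow> ('g, 'm) monoid_scheme \<Rightarrow> 'g set set" where
  "sylow_subgroups p G = {H. subgroup H G \<and> card H = p ^ multiplicity p (order G)}"

definition involutions :: "('g, 'm) monoid_scheme \<Rightarrow> 'g set" where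
  "involutions G = {t \<in> carrier G. group.ord G t = 2}"

definition fixed_sylows :: "nat \<Rightarrow> ('g, 'm) monoid_scheme \<Rightarrow> 'g \<Rightarrow> 'g set set" where
  "fixed_sylows p G t =
     {H \<in> sylow_subgroups p G. t <#\<^bsub>G\<^esub> H #>\<^bsub>G\<^esub> inv\<^bsub>G\<^esub> t = H}"

text \<open>The Ree unital of a group \<open>G\<close>, to be applied to a Ree group \<open>G\<close>.\<close>

definition ree_unital ::
  "('g, 'm) monoid_scheme \<Rightarrow> ('g set, 'g set set) incidence_structure" where
  "ree_unital G =
     \<lparr> pts = sylow_subgroups 3 G, blks = fixed_sylows 3 G ` involutions G, inc = (\<in>) \<rparr>"

end

theory Submission
  imports Defs "HOL-Analysis.Determinants" "HOL-Algebra.Group_Action" "HOL-Algebra.Sylow"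
begin

text \<open>
  The group acts on the 28 anisotropic binary quadratic forms a x^2 + x y + c y^2 over GF(8). Each
  Sylow 3-subgroup fixes exactly one of them, and the involutions are the transvections u + \<omega>(v, u) v,
  where \<omega> is the determinant form; such an involution fixes a form q iff q(v) = 1. Hence the Ree
  unital consists of the points (a, c) of the affine plane over GF(8) for which ac has trace 1, and
  of the lines a s^2 + c t^2 = 1 + s t.

  In an embedding, send four points to the standard frame and a fifth one to (1, t, 0). Intersecting
  lines forces the coordinates of all other points, and superfluous incidences force 2 = 0 and
  t^3 + t + 1 = 0. So an embedding is determined, up to a projectivity, by a root of x^3 + x + 1,
  and the three roots are permuted by the Frobenius automorphism, which also acts on the unital.
  Every point of the plane over the subfield generated by t is the intersection of two of the
  embedded blocks, so this plane is the only subplane of order 8 containing the image.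
\<close>

subsection \<open>The field with eight elements and the affine form of the unital\<close>

text \<open>Ten lines of the plane over GF(8) carry no block: the line at infinity and the nine
  lines [l1, l2, l3] with l3^2 = l1 l2. They are a dual conic with its nucleus, that is, a dual
  hyperoval. A point therefore lies on none or on two of them, the 28 points on none are those of
  the unital, and every other point still lies on seven blocks. This is why blocks suffice to
  recover the whole plane. The characteristic of F is unknown at the outset, so the first forced
  coordinates must be carried along with signs and a free parameter. As soon as 2 = 0 and the cubic
  equation are known, every further computation can be moved into \<open>gf8\<close> and evaluated.
  The automorphism group of the unital is never determined. An embedding preceded by any
  automorphism is again an embedding, so it has a normal form too, and two normal forms differ by a
  change of frame and a change of root. Inside the subplane the change of root is a power of
  Frobenius; in PG(2, F) it must come from an automorphism of F, which explains the shape of the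
  last assertion of the theorem.\<close>

datatype gf8 = GF8 bool bool bool

lemma gf8_exhaust8:
  \<comment> \<open>Splitting into the eight constants lets the simplifier settle statements in one
    or two variables by evaluation. Identities in three variables are reduced to propositional
    formulas in the coefficients instead.\<close>
  "\<lbrakk>(x = GF8 False False False \<Longrightarrow> P);
    (x = GF8 True False False \<Longrightarrow> P);
    (x = GF8 False True False \<Longrightarrow> P);
    (x = GF8 True True False \<Longrightarrow> P);
    (x = GF8 False False True \<Longrightarrow> P);
    (x = GF8 True False True \<Longrightarrow> P);
    (x = GF8 False True True \<Longrightarrow> P);
    (x = GF8 True True True \<Longrightarrow> P)\<rbrakk> \<Longrightarrow> P"
  by (cases x) (metis (full_types))

instantiation gf8 :: field
begin

definition zero_gf8 :: gf8 where "0 = GF8 False False False"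
definition one_gf8 :: gf8 where "1 = GF8 True False False"

fun plus_gf8 :: "gf8 \<Rightarrow> gf8 \<Rightarrow> gf8" where
  "GF8 a b c + GF8 a' b' c' = GF8 (a \<noteq> a') (b \<noteq> b') (c \<noteq> c')"

definition uminus_gf8 :: "gf8 \<Rightarrow> gf8" where "- x = (x::gf8)"
definition minus_gf8 :: "gf8 \<Rightarrow> gf8 \<Rightarrow> gf8" where "x - y = x + (y::gf8)"

text \<open>The elements are the residues a + b z + c z^2 of polynomials over GF(2) modulo z^3 + z + 1.\<close>

fun times_gf8 :: "gf8 \<Rightarrow> gf8 \<Rightarrow> gf8" where
  "GF8 a b c * GF8 a' b' c' =
     GF8 ((a \<and> a') \<noteq> ((b \<and> c') \<noteq> (c \<and> b')))
         (((a \<and> b') \<noteq> (b \<and> a')) \<noteq> (((b \<and> c') \<noteq> (c \<and> b')) \<noteq> (c \<and> c')))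
         (((a \<and> c') \<noteq> (c \<and> a')) \<noteq> ((b \<and> b') \<noteq> (c \<and> c')))"

text \<open>The sixth power is the inverse because nonzero elements satisfy x^7 = 1, and it sends 0
  to 0 as the field class demands.\<close>

definition inverse_gf8 :: "gf8 \<Rightarrow> gf8" where "inverse x = (x::gf8) * x * (x * x) * (x * x)"
definition divide_gf8 :: "gf8 \<Rightarrow> gf8 \<Rightarrow> gf8" where "x div y = x * inverse (y::gf8)"

instance
proof
  fix x y w :: gf8
  show "x * y * w = x * (y * w)"
    apply (cases x; cases y; cases w; simp only: times_gf8.simps gf8.inject)
    apply (rename_tac a b c d e f g h i)
    by (case_tac a; case_tac b; case_tac c; case_tac d; case_tac e; case_tac f; simp; argo?)
  show "x * y = y * x"
    by (cases x rule: gf8_exhaust8; cases y rule: gf8_exhaust8; simp)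
  show "1 * x = x"
    by (cases x) (simp add: one_gf8_def)
  show "x + y + w = x + (y + w)"
    by (cases x; cases y; cases w) (simp, argo)
  show "x + y = y + x"
    by (cases x rule: gf8_exhaust8; cases y rule: gf8_exhaust8; simp)
  show "0 + x = x"
    by (cases x) (simp add: zero_gf8_def)
  show "- x + x = 0"
    by (cases x) (simp add: zero_gf8_def uminus_gf8_def)
  show "x - y = x + - y"
    by (simp add: minus_gf8_def uminus_gf8_def)
  show "(x + y) * w = x * w + y * w"
    apply (cases x; cases y; cases w; simp only: times_gf8.simps plus_gf8.simps gf8.inject)
    apply (rename_tac a b c d e f g h i)
    by (case_tac g; case_tac h; case_tac i; simp; argo?)
  show "(0::gf8) \<noteq> 1"
    by (simp add: zero_gf8_def one_gf8_def)
  show "x \<noteq> 0 \<Longrightarrow> inverse x * x = 1"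
    by (cases x rule: gf8_exhaust8; simp add: zero_gf8_def one_gf8_def inverse_gf8_def)
  show "x div y = x * inverse y"
    by (simp add: divide_gf8_def)
  show "inverse (0::gf8) = 0"
    by (simp add: zero_gf8_def inverse_gf8_def)
qed

end

lemma gf8_UNIV: "(UNIV :: gf8 set) = (\<lambda>(a, b, c). GF8 a b c) ` UNIV"
proof -
  have "x \<in> (\<lambda>(a, b, c). GF8 a b c) ` UNIV" for x
    by (cases x) (simp add: image_iff split_paired_Ex)
  then show ?thesis by auto
qed

instance gf8 :: finite
  by standard (simp add: gf8_UNIV)

lemma card_gf8: "CARD(gf8) = 8"
proof -
  have "inj (\<lambda>(a, b, c). GF8 a b c)"
    by (auto simp: inj_def)
  then show ?thesis
    by (simp add: gf8_UNIV card_image card_UNIV_bool)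
qed

lemma gf8_add_self [simp]: "x + x = (0::gf8)"
  by (cases x) (simp add: zero_gf8_def)

lemma gf8_uminus [simp]: "- x = (x::gf8)"
  by (simp add: uminus_gf8_def)

lemma gf8_diff [simp]: "x - y = x + (y::gf8)"
  by (simp add: minus_gf8_def)

lemma gf8_square_add: "(x + y)\<^sup>2 = x\<^sup>2 + (y::gf8)\<^sup>2"
  by (cases x rule: gf8_exhaust8; cases y rule: gf8_exhaust8; simp add: power2_eq_square)

lemma gf8_power8: "((x\<^sup>2)\<^sup>2)\<^sup>2 = (x::gf8)"
  by (cases x rule: gf8_exhaust8; simp add: power2_eq_square)

section \<open>The absolute trace and the affine model of the unital\<close>

definition trace1 :: "gf8 \<Rightarrow> bool" where "trace1 x \<longleftrightarrow> x + x\<^sup>2 + (x\<^sup>2)\<^sup>2 = 1"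

text \<open>The conjugates of z add up to 0 and so do those of z^2, whereas 1 has trace 1, so only
  the constant coefficient counts.\<close>

lemma trace1_GF8: "trace1 (GF8 a b c) \<longleftrightarrow> a"
  by (cases a; cases b; cases c; simp add: trace1_def power2_eq_square one_gf8_def zero_gf8_def)

text \<open>Additive Hilbert 90 over GF(8): the elements u^2 + u are exactly those of trace
  0.\<close>

lemma trace1_iff: "trace1 x \<longleftrightarrow> (\<forall>u. u\<^sup>2 + u \<noteq> x)"
proof (cases x)
  case (GF8 a b c)
  have "(\<exists>u. u\<^sup>2 + u = GF8 a b c) \<longleftrightarrow> \<not> a"
  proof
    assume "\<exists>u. u\<^sup>2 + u = GF8 a b c"
    then obtain u where "u\<^sup>2 + u = GF8 a b c" by blast
    then show "\<not> a" by (cases u rule: gf8_exhaust8) (auto simp: power2_eq_square zero_gf8_def)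
  next
    assume "\<not> a"
    \<comment> \<open>For u = c z + (b + c) z^2 the relation z^4 = z^2 + z gives u^2 + u = b z + c
      z^2.\<close>
    then have "(GF8 False c (b \<noteq> c))\<^sup>2 + GF8 False c (b \<noteq> c) = GF8 a b c"
      by (cases b; cases c; simp add: power2_eq_square zero_gf8_def)
    then show "\<exists>u. u\<^sup>2 + u = GF8 a b c" by blast
  qed
  then show ?thesis by (auto simp: GF8 trace1_GF8)
qed

text \<open>The pair (a, c) stands for the anisotropic binary quadratic form a x^2 + x y + c y^2 over
  GF(8), and it is incident with (s, t) iff this form takes the value 1 at (s, t).\<close>

definition Om :: "(gf8 \<times> gf8) set" where "Om = {P. trace1 (fst P * snd P)}"

definition incd :: "gf8 \<times> gf8 \<Rightarrow> gf8 \<times> gf8 \<Rightarrow> bool" where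
  "incd P v \<longleftrightarrow> fst P * (fst v)\<^sup>2 + fst v * snd v + snd P * (snd v)\<^sup>2 = 1"

lemma incd_GF8:
  "incd (GF8 a b c, GF8 a' b' c') v \<longleftrightarrow>
     GF8 a b c * (fst v * fst v) + fst v * snd v + GF8 a' b' c' * (snd v * snd v) = GF8 True False False"
  by (simp add: incd_def power2_eq_square one_gf8_def)

section \<open>Homomorphisms from GF(8) given by a root of x^3 + x + 1\<close>

definition phom :: "'f::field \<Rightarrow> gf8 \<Rightarrow> 'f" where
  "phom \<zeta> x = (case x of GF8 a b c \<Rightarrow> of_bool a + of_bool b * \<zeta> + of_bool c * \<zeta>\<^sup>2)"

locale gf8_root =
  fixes \<zeta> :: "'f::field"
  assumes char2: "(2::'f) = 0" and root: "\<zeta> ^ 3 + \<zeta> + 1 = 0"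
begin

lemma add_self [simp]: "x + x = (0::'f)"
  using char2 by (metis mult_2 mult_zero_left)

lemma add_self_left [simp]: "x + (x + y) = (y::'f)"
  by (metis add_self add.assoc add_0)

lemma uminus_self [simp]: "- x = (x::'f)"
  by (metis add_self add_eq_0_iff)

lemma diff_eq_add [simp]: "x - y = x + (y::'f)"
  by (metis uminus_self diff_conv_add_uminus)

lemma cube: "\<zeta> ^ 3 = \<zeta> + 1"
  using root by (metis add_eq_0_iff uminus_self add.assoc)

abbreviation \<sigma> :: "gf8 \<Rightarrow> 'f" where "\<sigma> \<equiv> phom \<zeta>"

lemma hom_add: "\<sigma> (x + y) = \<sigma> x + \<sigma> y"
proof (cases x; cases y)
  fix a b c a' b' c'
  assume xy: "x = GF8 a b c" "y = GF8 a' b' c'"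
  show ?thesis
    unfolding xy phom_def plus_gf8.simps gf8.case
    by (cases a; cases b; cases c; cases a'; cases b'; cases c';
        simp add: add.commute add.left_commute char2)
qed

lemma pow4: "\<zeta> ^ 4 = \<zeta>\<^sup>2 + \<zeta>"
proof -
  have "\<zeta> ^ 4 = \<zeta> * \<zeta> ^ 3" by (simp add: eval_nat_numeral)
  then show ?thesis by (simp add: cube algebra_simps power2_eq_square)
qed

lemma hom_mult: "\<sigma> (x * y) = \<sigma> x * \<sigma> y"
proof (cases x; cases y)
  fix a b c a' b' c'
  assume xy: "x = GF8 a b c" "y = GF8 a' b' c'"
  have 1: "\<zeta> * \<zeta>\<^sup>2 = \<zeta> + 1" "\<zeta>\<^sup>2 * \<zeta> = \<zeta> + 1"
    using cube by (simp_all add: eval_nat_numeral mult.assoc)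
  have 2: "\<zeta>\<^sup>2 * \<zeta>\<^sup>2 = \<zeta>\<^sup>2 + \<zeta>"
    using pow4 by (simp add: eval_nat_numeral algebra_simps)
  have 3: "\<zeta> * \<zeta> = \<zeta>\<^sup>2" by (simp add: power2_eq_square)
  show ?thesis
    unfolding xy phom_def times_gf8.simps gf8.case
    by (cases a; cases b; cases c; cases a'; cases b'; cases c';
        simp add: distrib_left distrib_right 1 2 3 char2 pow4 ac_simps)
qed

lemma hom_0 [simp]: "\<sigma> 0 = 0" and hom_1 [simp]: "\<sigma> 1 = 1"
  by (simp_all add: phom_def zero_gf8_def one_gf8_def)

lemma hom_power: "\<sigma> (x ^ n) = \<sigma> x ^ n"
  by (induction n) (simp_all add: hom_mult)

lemma hom_inverse: "\<sigma> (inverse x) = inverse (\<sigma> x)"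
proof (cases "x = 0")
  case False
  then have "\<sigma> (inverse x) * \<sigma> x = 1"
    by (metis hom_mult hom_1 left_inverse)
  then show ?thesis by (metis inverse_unique mult.commute)
qed simp

lemma hom_eq_0_iff: "\<sigma> x = 0 \<longleftrightarrow> x = 0"
  by (metis hom_0 hom_1 hom_mult left_inverse mult_zero_right zero_neq_one)

lemma hom_inj: "inj \<sigma>"
proof (rule injI)
  fix x y assume "\<sigma> x = \<sigma> y"
  then have "\<sigma> (x + y) = 0" by (simp add: hom_add)
  then have "x + y = 0" by (simp add: hom_eq_0_iff)
  then show "x = y" by (metis add.assoc add.right_neutral gf8_add_self add_0)
qed

lemma hom_eq_iff: "\<sigma> x = \<sigma> y \<longleftrightarrow> x = y"
  using hom_inj by (auto dest: injD)

lemma square_add: "(x + y)\<^sup>2 = x\<^sup>2 + (y::'f)\<^sup>2"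
  by (simp add: power2_sum char2)

lemma hom_root_square: "phom (\<zeta>\<^sup>2) x = \<sigma> (x\<^sup>2)"
  unfolding hom_power
  by (cases x) (simp add: phom_def square_add power_mult_distrib of_bool_def)

lemma gf8_root_square: "gf8_root (\<zeta>\<^sup>2)"
proof
  have "(\<zeta>\<^sup>2) ^ 3 + \<zeta>\<^sup>2 + 1 = (\<zeta> ^ 3 + \<zeta> + 1)\<^sup>2"
    unfolding square_add by (simp flip: power_mult)
  then show "(\<zeta>\<^sup>2) ^ 3 + \<zeta>\<^sup>2 + 1 = 0"
    using root by simp
qed (rule char2)

text \<open>The elementary symmetric functions of \<zeta>, \<zeta>^2, \<zeta>^4 are 0, 1, 1, so the
  product of the three differences \<xi> - \<zeta>^(2^i) is the value of x^3 + x + 1 at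
  \<xi>.\<close>

lemma roots:
  assumes "gf8_root (\<xi>::'f)"
  shows "\<xi> = \<zeta> \<or> \<xi> = \<zeta>\<^sup>2 \<or> \<xi> = (\<zeta>\<^sup>2)\<^sup>2"
proof -
  interpret x: gf8_root \<xi> by fact
  have pow5: "\<zeta> ^ 5 = \<zeta>\<^sup>2 + \<zeta> + 1"
  proof -
    have "\<zeta> ^ 5 = \<zeta> ^ 4 * \<zeta>" by (simp add: eval_nat_numeral)
    also have "\<dots> = \<zeta> ^ 3 + \<zeta>\<^sup>2" by (simp only: pow4) (simp add: eval_nat_numeral algebra_simps)
    finally show ?thesis by (simp add: cube ac_simps)
  qed
  have pow6: "\<zeta> ^ 6 = \<zeta>\<^sup>2 + 1"
  proof -
    have "\<zeta> ^ 6 = (\<zeta> ^ 3)\<^sup>2" by (simp flip: power_mult)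
    then show ?thesis by (simp add: cube square_add)
  qed
  have pow7: "\<zeta> ^ 7 = 1"
  proof -
    have "\<zeta> ^ 7 = \<zeta> ^ 6 * \<zeta>" by (simp add: eval_nat_numeral)
    also have "\<dots> = \<zeta> ^ 3 + \<zeta>" by (simp only: pow6) (simp add: eval_nat_numeral algebra_simps)
    finally show ?thesis by (simp add: cube ac_simps)
  qed
  have "(\<xi> + \<zeta>) * (\<xi> + \<zeta>\<^sup>2) * (\<xi> + (\<zeta>\<^sup>2)\<^sup>2)
     = \<xi> ^ 3 + \<xi>\<^sup>2 * (\<zeta> + \<zeta>\<^sup>2 + \<zeta> ^ 4) + \<xi> * (\<zeta> ^ 3 + \<zeta> ^ 5 + \<zeta> ^ 6) + \<zeta> ^ 7"
    by (simp add: algebra_simps eval_nat_numeral)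
  also have "\<zeta> + \<zeta>\<^sup>2 + \<zeta> ^ 4 = 0"
    by (simp add: pow4 ac_simps)
  also have "\<zeta> ^ 3 + \<zeta> ^ 5 + \<zeta> ^ 6 = 1"
    by (simp add: cube pow5 pow6 ac_simps)
  finally have "(\<xi> + \<zeta>) * (\<xi> + \<zeta>\<^sup>2) * (\<xi> + (\<zeta>\<^sup>2)\<^sup>2) = 0"
    by (simp add: x.cube pow7 ac_simps)
  then show ?thesis by (metis mult_eq_0_iff add_eq_0_iff uminus_self)
qed

end

text \<open>Modulo 2 the polynomial y^7 - 1 is (y + 1)(y^3 + y + 1)(y^3 + y^2 + 1). The last factor
  is the reciprocal of the second, whence the alternative with the inverse.\<close>

lemma char2_seventh_root:
  fixes y :: "'f::field"
  assumes two: "(2::'f) = 0" and y: "y ^ 7 = 1" "y \<noteq> 1"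
  shows "gf8_root y \<or> gf8_root (inverse y)"
proof -
  have s: "x + x = (0::'f)" for x using two by (metis mult_2 mult_zero_left)
  have y0: "y \<noteq> 0" using y(1) by auto
  have "(y + 1) * (y ^ 3 + y + 1) * (y ^ 3 + y\<^sup>2 + 1)
      = y ^ 7 + 1 + (2 * (y ^ 6 + y ^ 5 + 2 * y ^ 4 + 2 * y ^ 3 + y\<^sup>2 * 2 + y - y\<^sup>2))"
    by (simp add: algebra_simps eval_nat_numeral)
  also have "\<dots> = 0" unfolding y(1) s two by simp
  finally have "y + 1 = 0 \<or> y ^ 3 + y + 1 = 0 \<or> y ^ 3 + y\<^sup>2 + 1 = 0" by simp
  moreover have "y + 1 \<noteq> 0" using y(2) s[of 1] by (metis add_right_cancel)
  moreover have "inverse y ^ 3 + inverse y + 1 = inverse y ^ 3 * (y ^ 3 + y\<^sup>2 + 1)"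
    using y0 by (simp add: field_simps eval_nat_numeral)
  ultimately show ?thesis
    using two by (auto simp: gf8_root_def)
qed

subsection \<open>Points and lines as subspaces\<close>

definition dot3 :: "'f::field ^ 3 \<Rightarrow> 'f ^ 3 \<Rightarrow> 'f" where
  "dot3 l u = l $ 1 * u $ 1 + l $ 2 * u $ 2 + l $ 3 * u $ 3"

text \<open>Lines are handled through coordinate vectors as well, so the same cross product gives
  the line joining two points and the point common to two lines.\<close>

definition crs :: "'f::field ^ 3 \<Rightarrow> 'f ^ 3 \<Rightarrow> 'f ^ 3" where
  "crs u v = vector [u $ 2 * v $ 3 - u $ 3 * v $ 2,
                     u $ 3 * v $ 1 - u $ 1 * v $ 3,
                     u $ 1 * v $ 2 - u $ 2 * v $ 1]"

definition proportional :: "'f::field ^ 3 \<Rightarrow> 'f ^ 3 \<Rightarrow> bool" where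
  "proportional u v \<longleftrightarrow> (\<exists>c. c \<noteq> 0 \<and> u = c *s v)"

definition lperp :: "'f::field ^ 3 \<Rightarrow> ('f ^ 3) set" where
  "lperp l = {u. dot3 l u = 0}"

lemma vec3_eq_iff: "(u :: 'f ^ 3) = v \<longleftrightarrow> u $ 1 = v $ 1 \<and> u $ 2 = v $ 2 \<and> u $ 3 = v $ 3"
  by (simp add: vec_eq_iff forall_3)

lemma crs_nth [simp]:
  "crs u v $ 1 = u $ 2 * v $ 3 - u $ 3 * v $ 2"
  "crs u v $ 2 = u $ 3 * v $ 1 - u $ 1 * v $ 3"
  "crs u v $ 3 = u $ 1 * v $ 2 - u $ 2 * v $ 1"
  by (simp_all add: crs_def)

lemma dot3_scale: "dot3 (c *s l) u = c * dot3 l u" "dot3 l (c *s u) = c * dot3 l u"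
  and dot3_add: "dot3 l (u + v) = dot3 l u + dot3 l v"
  and dot3_zero: "dot3 l 0 = 0" "dot3 0 u = 0"
  and dot3_crs: "dot3 u (crs u v) = 0" "dot3 v (crs u v) = 0"
    "dot3 (crs u v) u = 0" "dot3 (crs u v) v = 0"
  and dot3_commute: "dot3 l u = dot3 u l"
  by (simp_all add: dot3_def algebra_simps)

lemma proportional_refl: "proportional u u"
  unfolding proportional_def by (rule exI[of _ 1]) simp

lemma proportional_sym: "proportional u v \<Longrightarrow> proportional v u"
proof -
  assume "proportional u v"
  then obtain c where "c \<noteq> 0" "u = c *s v" unfolding proportional_def by blast
  then have "inverse c \<noteq> 0" "v = inverse c *s u" by (simp_all add: vector_smult_assoc)
  then show ?thesis unfolding proportional_def by blast
qed

lemma proportional_trans: "proportional u v \<Longrightarrow> proportional v w \<Longrightarrow> proportional u w"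
  unfolding proportional_def by (metis mult_eq_0_iff vector_smult_assoc)

lemma proportional_scale: "c \<noteq> 0 \<Longrightarrow> proportional (c *s u) u"
  unfolding proportional_def by blast

lemma crs_eq_0_imp_proportional:
  assumes "crs u v = 0" "u \<noteq> 0" "v \<noteq> 0"
  shows "proportional u v"
proof -
  have e: "u $ 2 * v $ 3 = u $ 3 * v $ 2" "u $ 3 * v $ 1 = u $ 1 * v $ 3" "u $ 1 * v $ 2 = u $ 2 * v $ 1"
    using assms(1) by (simp_all add: vec3_eq_iff)
  have "\<exists>c. u = c *s v"
  proof -
    from assms(3) consider "v $ 1 \<noteq> 0" | "v $ 2 \<noteq> 0" | "v $ 3 \<noteq> 0"
      by (auto simp: vec3_eq_iff)
    then show ?thesis
    proof cases
      case 1 then show ?thesis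
        using e by (intro exI[of _ "u $ 1 / v $ 1"]) (simp add: vec3_eq_iff field_simps)
    next
      case 2 then show ?thesis
        using e by (intro exI[of _ "u $ 2 / v $ 2"]) (simp add: vec3_eq_iff field_simps)
    next
      case 3 then show ?thesis
        using e by (intro exI[of _ "u $ 3 / v $ 3"]) (simp add: vec3_eq_iff field_simps)
    qed
  qed
  then show ?thesis
    using assms(2) unfolding proportional_def by (metis vector_smult_lzero)
qed

lemma proportional_imp_crs_eq_0: "proportional u v \<Longrightarrow> crs u v = 0"
  unfolding proportional_def by (auto simp: vec3_eq_iff)

lemma crs_crs: "crs (crs a b) x = dot3 a x *s b - dot3 b x *s a"
  by (simp add: vec3_eq_iff dot3_def algebra_simps)

text \<open>By the triple product identity the cross product of \<open>crs a b\<close> with x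
  vanishes. This is the source of uniqueness for joining lines and for intersection points
  alike.\<close>

lemma orthogonal_proportional:
  assumes "dot3 a x = 0" "dot3 b x = 0" "crs a b \<noteq> 0" "x \<noteq> 0"
  shows "proportional x (crs a b)"
  using assms crs_eq_0_imp_proportional[of "crs a b" x] crs_crs[of a b x]
  by (auto intro: proportional_sym)

lemma proportional_lperp: "proportional a b \<Longrightarrow> lperp a = lperp b"
  unfolding proportional_def lperp_def by (auto simp: dot3_scale)

text \<open>Every \<open>crs a e\<close> lies on the line a, hence on b. For the three unit vectors
  e the resulting equations say, up to sign, that the coordinates of \<open>crs a b\<close> are
  0.\<close>

lemma lperp_subset_imp_proportional:
  assumes "lperp a \<subseteq> lperp b" "a \<noteq> 0" "b \<noteq> 0"
  shows "proportional a b"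
proof -
  have *: "dot3 b (crs a e) = 0" for e
    using assms(1) dot3_crs(1)[of a e] by (auto simp: lperp_def)
  have "crs a b = 0"
    using *[of "vector [1, 0, 0]"] *[of "vector [0, 1, 0]"] *[of "vector [0, 0, 1]"]
    by (simp add: vec3_eq_iff dot3_def algebra_simps)
  then show ?thesis using assms crs_eq_0_imp_proportional by blast
qed

lemma lperp_eq_iff: "a \<noteq> 0 \<Longrightarrow> b \<noteq> 0 \<Longrightarrow> lperp a = lperp b \<longleftrightarrow> proportional a b"
  using lperp_subset_imp_proportional[of a b] proportional_lperp[of a b] by blast

lemma subspace_lperp: "vec.subspace (lperp l)"
  unfolding vec.subspace_def lperp_def by (simp add: dot3_add dot3_scale dot3_zero)

lemma span_subset_lperp_iff: "vec.span {v} \<subseteq> lperp l \<longleftrightarrow> dot3 l v = 0"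
proof
  assume "vec.span {v} \<subseteq> lperp l"
  then have "v \<in> lperp l" using vec.span_base by blast
  then show "dot3 l v = 0" by (simp add: lperp_def)
next
  assume "dot3 l v = 0"
  then show "vec.span {v} \<subseteq> lperp l"
    by (intro vec.span_minimal subspace_lperp) (simp add: lperp_def)
qed

lemma span_subset_iff:
  assumes "u \<noteq> 0" shows "vec.span {u} \<subseteq> vec.span {v} \<longleftrightarrow> proportional u v"
proof
  assume "vec.span {u} \<subseteq> vec.span {v}"
  then have "u \<in> vec.span {v}" using vec.span_base by blast
  then show "proportional u v"
    using assms by (auto simp: vec.span_singleton proportional_def)
next
  assume "proportional u v"
  then show "vec.span {u} \<subseteq> vec.span {v}"
    by (auto simp: vec.span_singleton proportional_def vector_smult_assoc)
qed

lemma span_eq_iff: "u \<noteq> 0 \<Longrightarrow> v \<noteq> 0 \<Longrightarrow> vec.span {u} = vec.span {v} \<longleftrightarrow> proportional u v"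
  by (metis span_subset_iff proportional_sym subset_antisym subset_refl)

lemma crs_crs_crs: "crs (crs l a) (crs l b) = dot3 l (crs a b) *s l"
  by (simp add: vec3_eq_iff dot3_def algebra_simps)

text \<open>The cross product of \<open>crs l a\<close> and \<open>crs l b\<close> is the
  determinant of l, a, b times l, so two unit vectors complementary to a nonzero coordinate of l do.
  Restricting a and b to 0 and 1 keeps the basis of the line in every subfield that contains the
  coordinates of l.\<close>

lemma exists_basis_of_lperp:
  fixes l :: "'f::field ^ 3"
  assumes "l \<noteq> 0"
  obtains a b :: "'f ^ 3" where "crs (crs l a) (crs l b) \<noteq> 0"
    "\<forall>i. a $ i \<in> {0, 1}" "\<forall>i. b $ i \<in> {0, 1}"
proof -
  let ?e1 = "vector [1, 0, 0] :: 'f ^ 3"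
  let ?e2 = "vector [0, 1, 0] :: 'f ^ 3"
  let ?e3 = "vector [0, 0, 1] :: 'f ^ 3"
  have e: "\<forall>i. ?e1 $ i \<in> {0, 1}" "\<forall>i. ?e2 $ i \<in> {0, 1}" "\<forall>i. ?e3 $ i \<in> {0, 1}"
    by (simp_all add: forall_3)
  from assms consider "l $ 1 \<noteq> 0" | "l $ 2 \<noteq> 0" | "l $ 3 \<noteq> 0"
    by (auto simp: vec3_eq_iff)
  then show thesis
  proof cases
    case 1
    with assms have "crs (crs l ?e2) (crs l ?e3) \<noteq> 0"
      by (simp add: crs_crs_crs dot3_def)
    then show thesis using that e by blast
  next
    case 2
    with assms have "crs (crs l ?e3) (crs l ?e1) \<noteq> 0"
      by (simp add: crs_crs_crs dot3_def)
    then show thesis using that e by blast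
  next
    case 3
    with assms have "crs (crs l ?e1) (crs l ?e2) \<noteq> 0"
      by (simp add: crs_crs_crs dot3_def)
    then show thesis using that e by blast
  qed
qed

lemma crs_0 [simp]: "crs u 0 = 0" "crs 0 u = 0" "crs u u = 0" "crs (c *s u) u = 0"  "crs u (c *s u) = 0"
  by (simp_all add: vec3_eq_iff)

lemma independent_crs: "crs u v \<noteq> 0 \<Longrightarrow> vec.independent {u, v}"
  by (auto simp: vec.independent_insert vec.span_singleton)

lemma dim_lperp:
  assumes "l \<noteq> 0" shows "vec.dim (lperp l) = 2"
proof -
  have "lperp l \<noteq> UNIV"
  proof
    assume *: "lperp l = UNIV"
    have "dot3 l e = 0" for e using * by (auto simp: lperp_def)
    from this[of "vector [1, 0, 0]"] this[of "vector [0, 1, 0]"] this[of "vector [0, 0, 1]"]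
    show False using assms by (simp add: vec3_eq_iff dot3_def)
  qed
  then have "vec.span (lperp l) \<subset> vec.span UNIV"
    using subspace_lperp by (metis vec.span_UNIV vec.span_eq_iff psubsetI top_greatest)
  then have "vec.dim (lperp l) < vec.dim (UNIV :: ('a^3) set)"
    by (rule vec.dim_psubset)
  then have 1: "vec.dim (lperp l) < 3" by (simp add: card_cart_basis vec_dim_card)
  obtain u v where uv: "dot3 l u = 0" "dot3 l v = 0" "crs u v \<noteq> 0"
    using exists_basis_of_lperp[OF assms] dot3_crs(1) by metis
  have "card {u, v} \<le> vec.dim (lperp l)"
    using uv by (intro vec.independent_card_le_dim independent_crs) (auto simp: lperp_def)
  moreover have "card {u, v} = 2"
    using uv(3) by (cases "u = v") auto
  ultimately show ?thesis using 1 by simp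
qed

lemma pts_PG2: "pts (PG2 :: (('f::field ^ 3) set, _) incidence_structure) = {vec.span {v} | v. v \<noteq> 0}"
proof -
  have "\<exists>v. V = vec.span {v} \<and> v \<noteq> 0" if V: "vec.subspace V" "vec.dim V = 1" for V :: "('f ^ 3) set"
  proof -
    obtain B where B: "B \<subseteq> V" "vec.independent B" "V \<subseteq> vec.span B" "card B = vec.dim V"
      using vec.basis_exists by blast
    then obtain v where v: "B = {v}" using V card_1_singletonE by metis
    then have "V = vec.span {v}"
      using B V by (metis subset_antisym vec.span_minimal)
    moreover have "v \<noteq> 0" using B v vec.dependent_zero by blast
    ultimately show ?thesis by blast
  qed
  then show ?thesis
    by (auto simp: PG2_def)
qed

lemma blks_PG2: "blks (PG2 :: (('f::field ^ 3) set, _) incidence_structure) = {lperp l | l. l \<noteq> 0}"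
proof -
  have "\<exists>l. V = lperp l \<and> l \<noteq> 0" if V: "vec.subspace V" "vec.dim V = 2" for V :: "('f ^ 3) set"
  proof -
    obtain B where B: "B \<subseteq> V" "vec.independent B" "V \<subseteq> vec.span B" "card B = vec.dim V"
      using vec.basis_exists by blast
    then obtain u v where uv: "B = {u, v}" "u \<noteq> v" using V card_2_iff by metis
    have VB: "V = vec.span B"
      using B V by (metis subset_antisym vec.span_minimal)
    have nz: "u \<noteq> 0" "v \<noteq> 0" using B uv vec.dependent_zero by blast+
    have l: "crs u v \<noteq> 0"
    proof
      assume "crs u v = 0"
      then have "u \<in> vec.span {v}"
        using crs_eq_0_imp_proportional[OF _ nz] unfolding proportional_def vec.span_singleton by blast
      then show False using B uv by (simp add: vec.independent_insert)
    qed
    have "V \<subseteq> lperp (crs u v)"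
      unfolding VB uv(1) by (intro vec.span_minimal subspace_lperp) (simp add: lperp_def dot3_crs)
    then have "V = lperp (crs u v)"
      by (intro vec.subspace_dim_equal V subspace_lperp) (simp_all add: dim_lperp l V)
    then show ?thesis using l by blast
  qed
  then show ?thesis
    by (auto simp: PG2_def subspace_lperp dim_lperp)
qed

lemma inc_PG2 [simp]: "inc PG2 = (\<subseteq>)"
  by (simp add: PG2_def)

section \<open>Invertible matrices acting on points and lines\<close>

lemma matrix_inv_inverse:
  assumes "invertible (A :: 'f::field^3^3)"
  shows "A ** matrix_inv A = mat 1" "matrix_inv A ** A = mat 1"
  using someI_ex[OF assms[unfolded invertible_def]] unfolding matrix_inv_def by simp_all

lemma matrix_inv_cancel:
  assumes "invertible (A :: 'f::field^3^3)"
  shows "A *v (matrix_inv A *v x) = x" "matrix_inv A *v (A *v x) = x"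
  using assms by (simp_all add: matrix_vector_mul_assoc matrix_inv_inverse)

lemma matrix_eq_0_iff: "invertible (A :: 'f::field^3^3) \<Longrightarrow> A *v x = 0 \<longleftrightarrow> x = 0"
  using matrix_inv_cancel(2)[of A x] by auto

lemma inj_matrix: "invertible (A :: 'f::field^3^3) \<Longrightarrow> inj ((*v) A)"
  by (rule inj_on_inverseI[of _ "(*v) (matrix_inv A)"]) (rule matrix_inv_cancel)

lemma matrix_image_span: "(*v) A ` vec.span {v} = vec.span {A *v (v :: 'f::field ^ 3)}"
  by (auto simp: vec.span_singleton image_image vector_scalar_commute)

lemma dot3_matrix: "dot3 l (A *v u) = dot3 (l v* A) u"
  by (simp add: dot3_def matrix_vector_mult_def vector_matrix_mult_def sum_3 algebra_simps)

lemma matrix_image_lperp: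
  assumes "invertible (A :: 'f::field^3^3)"
  shows "(*v) A ` lperp l = lperp (l v* matrix_inv A)"
proof -
  have "x \<in> (*v) A ` lperp l" if "dot3 l (matrix_inv A *v x) = 0" for x
    using that assms matrix_inv_cancel[of A] by (intro image_eqI[of _ _ "matrix_inv A *v x"]) (auto simp: lperp_def)
  then show ?thesis
    using assms by (auto simp: lperp_def matrix_inv_cancel simp flip: dot3_matrix)
qed

lemma vector_matrix_eq_0:
  assumes "invertible (A :: 'f::field^3^3)" "l v* A = 0"
  shows "l = 0"
proof -
  have "l = (l v* A) v* matrix_inv A"
    using assms(1) by (simp add: vector_matrix_mul_assoc matrix_inv_inverse)
  then show ?thesis using assms(2) by simp
qed

lemma invertible_matrix_inv: "invertible (A :: 'f::field^3^3) \<Longrightarrow> invertible (matrix_inv A)"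
  using matrix_inv_inverse[of A] by (auto simp: invertible_def)

subsection \<open>Projective planes over subfields\<close>

definition vecs :: "'f set \<Rightarrow> ('f::field ^ 3) set" where
  "vecs K = {v. v \<noteq> 0 \<and> (\<forall>i. v $ i \<in> K)}"

text \<open>Spans and kernels are formed over F, not over K: the points and lines of the subplane
  have to be points and lines of \<open>PG2\<close>, namely those with a coordinate vector over K in
  the frame A.\<close>

definition plane :: "'f::field set \<Rightarrow> 'f ^ 3 ^ 3 \<Rightarrow> (('f ^ 3) set, ('f ^ 3) set) incidence_structure" where
  "plane K A = \<lparr> pts = (\<lambda>v. (*v) A ` vec.span {v}) ` vecs K,
                blks = (\<lambda>l. (*v) A ` lperp l) ` vecs K, inc = (\<subseteq>) \<rparr>"

lemma plane_simps [simp]: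
  "pts (plane K A) = (\<lambda>v. (*v) A ` vec.span {v}) ` vecs K"
  "blks (plane K A) = (\<lambda>l. (*v) A ` lperp l) ` vecs K"
  "inc (plane K A) = (\<subseteq>)"
  by (simp_all add: plane_def)

text \<open>Puts \<open>PG2\<close> itself into the family, in any frame, so that joins, meets and
  collineations of \<open>plane K A\<close> also serve for the whole plane.\<close>

lemma plane_UNIV:
  fixes A :: "'f::field ^ 3 ^ 3"
  assumes "invertible A"
  shows "plane UNIV A = PG2"
proof -
  have "pts (plane UNIV A) = pts PG2"
  proof -
    have "\<exists>u. u \<noteq> 0 \<and> vec.span {v} = vec.span {A *v u}" if "v \<noteq> 0" for v
      using that assms matrix_inv_cancel(1)[OF assms, of v]
      by (intro exI[of _ "matrix_inv A *v v"]) (auto simp: matrix_eq_0_iff invertible_matrix_inv)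
    then show ?thesis
      using assms by (fastforce simp: pts_PG2 vecs_def matrix_image_span matrix_eq_0_iff)
  qed
  moreover have "blks (plane UNIV A) = blks PG2"
  proof -
    have "\<exists>m. m \<noteq> 0 \<and> lperp l = lperp (m v* matrix_inv A)" if "l \<noteq> 0" for l
    proof (intro exI conjI)
      have "l v* A v* matrix_inv A = l"
        using assms by (simp add: vector_matrix_mul_assoc matrix_inv_inverse)
      then show "lperp l = lperp (l v* A v* matrix_inv A)" by simp
      show "l v* A \<noteq> 0" using that assms vector_matrix_eq_0 by blast
    qed
    moreover have "l v* matrix_inv A \<noteq> 0" if "l \<noteq> 0" for l
      using that assms vector_matrix_eq_0 invertible_matrix_inv by blast
    ultimately show ?thesis
      using assms by (fastforce simp: blks_PG2 vecs_def matrix_image_lperp)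
  qed
  ultimately show ?thesis
    by (simp add: plane_def PG2_def)
qed

lemma vecs_mono: "vecs K \<subseteq> vecs UNIV"
  by (auto simp: vecs_def)

context
  fixes K :: "'f::field set" and A :: "'f ^ 3 ^ 3"
  assumes K: "is_subfield K" and A: "invertible A"
begin

lemma K_closed:
  "0 \<in> K" "1 \<in> K" "x \<in> K \<Longrightarrow> y \<in> K \<Longrightarrow> x + y \<in> K" "x \<in> K \<Longrightarrow> y \<in> K \<Longrightarrow> x * y \<in> K"
  "x \<in> K \<Longrightarrow> - x \<in> K" "x \<in> K \<Longrightarrow> inverse x \<in> K"
  using K by (auto simp: is_subfield_def)

lemma K_diff: "x \<in> K \<Longrightarrow> y \<in> K \<Longrightarrow> x - y \<in> K"
  using K_closed(3)[of x "- y"] K_closed(5)[of y] by simp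

lemma crs_in_K: "\<forall>i. u $ i \<in> K \<Longrightarrow> \<forall>i. v $ i \<in> K \<Longrightarrow> \<forall>i. crs u v $ i \<in> K"
  by (simp add: forall_3 K_diff K_closed)

lemma point_inc_line: "(*v) A ` vec.span {v} \<subseteq> (*v) A ` lperp l \<longleftrightarrow> dot3 l v = 0"
  using inj_matrix[OF A] by (simp add: inj_image_subset_iff span_subset_lperp_iff)

lemma point_eq_iff: "u \<noteq> 0 \<Longrightarrow> v \<noteq> 0 \<Longrightarrow>
  (*v) A ` vec.span {u} = (*v) A ` vec.span {v} \<longleftrightarrow> proportional u v"
  using inj_matrix[OF A] by (simp add: inj_image_eq_iff span_eq_iff)

lemma line_eq_iff: "l \<noteq> 0 \<Longrightarrow> m \<noteq> 0 \<Longrightarrow>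
  (*v) A ` lperp l = (*v) A ` lperp m \<longleftrightarrow> proportional l m"
  using inj_matrix[OF A] by (simp add: inj_image_eq_iff lperp_eq_iff)

lemma plane_join:
  assumes "P \<in> pts (plane K A)" "Q \<in> pts (plane K A)" "P \<noteq> Q"
  shows "\<exists>!l. l \<in> blks (plane K A) \<and> P \<subseteq> l \<and> Q \<subseteq> l"
proof -
  obtain u v where P: "P = (*v) A ` vec.span {u}" "u \<in> vecs K" and Q: "Q = (*v) A ` vec.span {v}" "v \<in> vecs K"
    using assms by auto
  have nz: "u \<noteq> 0" "v \<noteq> 0" using P Q by (auto simp: vecs_def)
  have uv: "crs u v \<noteq> 0"
    using crs_eq_0_imp_proportional[OF _ nz] assms(3) P Q nz by (auto simp: point_eq_iff)
  then have "crs u v \<in> vecs K" using P Q crs_in_K by (auto simp: vecs_def)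
  show ?thesis
  proof (rule ex1I[of _ "(*v) A ` lperp (crs u v)"])
    show "(*v) A ` lperp (crs u v) \<in> blks (plane K A) \<and> P \<subseteq> (*v) A ` lperp (crs u v) \<and> Q \<subseteq> (*v) A ` lperp (crs u v)"
      using \<open>crs u v \<in> vecs K\<close> P Q by (simp add: point_inc_line dot3_crs)
    fix l assume l: "l \<in> blks (plane K A) \<and> P \<subseteq> l \<and> Q \<subseteq> l"
    then obtain m where m: "l = (*v) A ` lperp m" "m \<in> vecs K" by auto
    have "dot3 u m = 0" "dot3 v m = 0"
      using l m P Q by (simp_all add: point_inc_line dot3_commute)
    then have "proportional m (crs u v)"
      using orthogonal_proportional[OF _ _ uv] m by (auto simp: vecs_def)
    then show "l = (*v) A ` lperp (crs u v)"
      using m proportional_lperp by blast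
  qed
qed

lemma plane_meet:
  assumes "l \<in> blks (plane K A)" "m \<in> blks (plane K A)" "l \<noteq> m"
  shows "\<exists>!P. P \<in> pts (plane K A) \<and> P \<subseteq> l \<and> P \<subseteq> m"
proof -
  obtain a b where l: "l = (*v) A ` lperp a" "a \<in> vecs K" and m: "m = (*v) A ` lperp b" "b \<in> vecs K"
    using assms by auto
  have nz: "a \<noteq> 0" "b \<noteq> 0" using l m by (auto simp: vecs_def)
  have ab: "crs a b \<noteq> 0"
    using crs_eq_0_imp_proportional[OF _ nz] assms(3) l m nz by (auto simp: line_eq_iff)
  then have "crs a b \<in> vecs K" using l m crs_in_K by (auto simp: vecs_def)
  show ?thesis
  proof (rule ex1I[of _ "(*v) A ` vec.span {crs a b}"])
    show "(*v) A ` vec.span {crs a b} \<in> pts (plane K A) \<and> (*v) A ` vec.span {crs a b} \<subseteq> l \<and> (*v) A ` vec.span {crs a b} \<subseteq> m"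
      using \<open>crs a b \<in> vecs K\<close> l m by (simp add: point_inc_line dot3_crs)
    fix P assume P: "P \<in> pts (plane K A) \<and> P \<subseteq> l \<and> P \<subseteq> m"
    then obtain u where u: "P = (*v) A ` vec.span {u}" "u \<in> vecs K" by auto
    have "dot3 a u = 0" "dot3 b u = 0"
      using l m P u by (simp_all add: point_inc_line)
    then have "proportional u (crs a b)"
      using orthogonal_proportional[OF _ _ ab] u by (auto simp: vecs_def)
    then show "P = (*v) A ` vec.span {crs a b}"
      using u ab by (simp add: point_eq_iff vecs_def)
  qed
qed

lemma projective_plane_plane: "projective_plane (plane K A)"
proof -
  define e :: "('f ^ 3) set" where
    "e = {vector [1, 0, 0], vector [0, 1, 0], vector [0, 0, 1], vector [1, 1, 1]}"
  define p where "p v = (*v) A ` vec.span {v}" for v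
  have eK: "e \<subseteq> vecs K"
    using K_closed by (auto simp: e_def vecs_def forall_3 vec3_eq_iff)
  have "inj_on p e"
  proof (rule inj_onI)
    fix u v assume uv: "u \<in> e" "v \<in> e" "p u = p v"
    then have "u \<noteq> 0" "v \<noteq> 0" using eK by (auto simp: vecs_def)
    then have "crs u v = 0"
      using uv(3) proportional_imp_crs_eq_0 by (simp add: p_def point_eq_iff)
    then show "u = v" using uv(1,2) by (auto simp: e_def vec3_eq_iff)
  qed
  moreover have "card e = 4" by (simp add: e_def vec3_eq_iff)
  ultimately have "card (p ` e) = 4" by (simp add: card_image)
  \<comment> \<open>A unit vector is on m iff the corresponding coordinate of m is 0, and (1, 1, 1)
    is on m iff the coordinates add up to 0. With two nonzero coordinates only one unit vector is
    left; with exactly one, the sum is nonzero and (1, 1, 1) is excluded.\<close>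
  have le2: "card {P \<in> p ` e. P \<subseteq> l} \<le> 2" if "l \<in> blks (plane K A)" for l
  proof -
    from that obtain m where m: "l = (*v) A ` lperp m" "m \<noteq> 0" by (auto simp: vecs_def)
    have pl: "p v \<subseteq> l \<longleftrightarrow> dot3 m v = 0" for v
      unfolding p_def m(1) by (rule point_inc_line)
    have Pe: "{P \<in> p ` e. P \<subseteq> l} = p ` {v \<in> e. dot3 m v = 0}"
      using pl by blast
    have "\<exists>u v. {v \<in> e. dot3 m v = 0} \<subseteq> {u, v}"
    proof -
      have E: "v \<in> {v \<in> e. dot3 m v = 0} \<longleftrightarrow>
         v = vector [1, 0, 0] \<and> m $ 1 = 0 \<or> v = vector [0, 1, 0] \<and> m $ 2 = 0 \<or>
         v = vector [0, 0, 1] \<and> m $ 3 = 0 \<or> v = vector [1, 1, 1] \<and> m $ 1 + m $ 2 + m $ 3 = 0" for v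
        by (auto simp: e_def dot3_def)
      have "m $ 1 \<noteq> 0 \<or> m $ 2 \<noteq> 0 \<or> m $ 3 \<noteq> 0" using m(2) by (auto simp: vec3_eq_iff)
      then consider "m $ 1 \<noteq> 0" "m $ 2 \<noteq> 0" | "m $ 1 \<noteq> 0" "m $ 3 \<noteq> 0" | "m $ 2 \<noteq> 0" "m $ 3 \<noteq> 0"
        | "m $ 1 \<noteq> 0" "m $ 2 = 0" "m $ 3 = 0" | "m $ 1 = 0" "m $ 2 \<noteq> 0" "m $ 3 = 0" | "m $ 1 = 0" "m $ 2 = 0" "m $ 3 \<noteq> 0"
        by blast
      then show ?thesis
      proof cases
        case 1
        then have "{v \<in> e. dot3 m v = 0} \<subseteq> {vector [0, 0, 1], vector [1, 1, 1]}" using E by auto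
        then show ?thesis by blast
      next
        case 2
        then have "{v \<in> e. dot3 m v = 0} \<subseteq> {vector [0, 1, 0], vector [1, 1, 1]}" using E by auto
        then show ?thesis by blast
      next
        case 3
        then have "{v \<in> e. dot3 m v = 0} \<subseteq> {vector [1, 0, 0], vector [1, 1, 1]}" using E by auto
        then show ?thesis by blast
      next
        case 4
        then have "{v \<in> e. dot3 m v = 0} \<subseteq> {vector [0, 1, 0], vector [0, 0, 1]}" using E by auto
        then show ?thesis by blast
      next
        case 5
        then have "{v \<in> e. dot3 m v = 0} \<subseteq> {vector [1, 0, 0], vector [0, 0, 1]}" using E by auto
        then show ?thesis by blast
      next
        case 6
        then have "{v \<in> e. dot3 m v = 0} \<subseteq> {vector [1, 0, 0], vector [0, 1, 0]}" using E by auto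
        then show ?thesis by blast
      qed
    qed
    then obtain u v where uv: "{v \<in> e. dot3 m v = 0} \<subseteq> {u, v}" by (elim exE)
    have "{P \<in> p ` e. P \<subseteq> l} \<subseteq> p ` {u, v}"
      unfolding Pe by (rule image_mono[OF uv])
    then have "card {P \<in> p ` e. P \<subseteq> l} \<le> card (p ` {u, v})" by (intro card_mono) simp_all
    also have "\<dots> \<le> card {u, v}" by (rule card_image_le) simp
    also have "\<dots> \<le> 2" by (simp add: card_insert_if)
    finally show ?thesis .
  qed
  show ?thesis
    unfolding projective_plane_def
  proof (intro conjI ballI impI exI[of _ "p ` e"])
    show "p ` e \<subseteq> pts (plane K A)" using eK by (auto simp: p_def)
    show "card (p ` e) = 4" by fact
    show "card {P \<in> p ` e. inc (plane K A) P l} \<le> 2" if "l \<in> blks (plane K A)" for l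
      using le2[OF that] by simp
  qed (unfold plane_simps(3), (erule (2) plane_join | erule (2) plane_meet)+)
qed

lemma subplane_plane: "subplane (plane K A) PG2"
  unfolding subplane_def plane_UNIV[OF A, symmetric]
  using projective_plane_plane
  by (simp only: plane_simps image_mono[OF vecs_mono] simp_thms ball_triv)

text \<open>For a basis u, v of the line with coordinates in K, its points in the subplane are u and
  v + c u with c in K. The work is to show that a point with coordinates in K has parameters in
  K.\<close>

lemma has_order_plane:
  assumes "finite K"
  shows "has_order (plane K A) (card K)"
  unfolding has_order_def
proof
  fix l assume "l \<in> blks (plane K A)"
  then obtain m where m: "l = (*v) A ` lperp m" "m \<in> vecs K" by auto
  then have "m \<noteq> 0" by (simp add: vecs_def)
  then obtain a b where ab: "crs (crs m a) (crs m b) \<noteq> 0" "\<forall>i. a $ i \<in> {0, 1}" "\<forall>i. b $ i \<in> {0, 1}"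
    by (rule exists_basis_of_lperp)
  define u where "u = crs m a"
  define v where "v = crs m b"
  have uvK: "\<forall>i. u $ i \<in> K" "\<forall>i. v $ i \<in> K"
  proof -
    have mK: "\<forall>i. m $ i \<in> K" using m(2) by (simp add: vecs_def)
    have *: "\<forall>i. x $ i \<in> K" if x: "\<forall>i. x $ i \<in> {0, 1}" for x :: "'f ^ 3"
    proof
      fix i
      have "x $ i = 0 \<or> x $ i = 1" using x by simp
      then show "x $ i \<in> K" using K_closed(1,2) by (elim disjE) simp_all
    qed
    show "\<forall>i. u $ i \<in> K" unfolding u_def by (rule crs_in_K[OF mK *[OF ab(2)]])
    show "\<forall>i. v $ i \<in> K" unfolding v_def by (rule crs_in_K[OF mK *[OF ab(3)]])
  qed
  have cuv: "crs u v \<noteq> 0" using ab by (simp add: u_def v_def)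
  have muv: "dot3 m u = 0" "dot3 m v = 0" by (simp_all add: u_def v_def dot3_crs)
  have nz: "u \<noteq> 0" "v + c *s u \<noteq> 0" for c
  proof -
    show "u \<noteq> 0" using cuv by auto
    have "crs u (v + c *s u) = crs u v" by (simp add: vec3_eq_iff algebra_simps)
    then show "v + c *s u \<noteq> 0" using cuv by auto
  qed
  define p where "p v = (*v) A ` vec.span {v}" for v
  have pl: "p v \<subseteq> l \<longleftrightarrow> dot3 m v = 0" for v
    unfolding p_def m(1) by (rule point_inc_line)
  have pK: "pts (plane K A) = p ` vecs K" by (simp add: p_def image_def)
  have "{P \<in> pts (plane K A). inc (plane K A) P l} = insert (p u) ((\<lambda>c. p (v + c *s u)) ` K)" (is "?L = ?R")
  proof
    show "?R \<subseteq> ?L"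
    proof -
      have "u \<in> vecs K" using uvK nz by (simp add: vecs_def)
      moreover have "v + c *s u \<in> vecs K" if "c \<in> K" for c
        using uvK nz that by (simp add: vecs_def K_closed(3,4))
      moreover have "p (v + c *s u) \<subseteq> l" for c
        unfolding pl using muv by (simp add: dot3_add dot3_scale)
      moreover have "p u \<subseteq> l" using muv by (simp add: pl)
      ultimately show ?thesis unfolding pK plane_simps(3) by blast
    qed
    show "?L \<subseteq> ?R"
    proof
      fix P assume "P \<in> ?L"
      then obtain w where w: "P = p w" "w \<in> vecs K" "dot3 m w = 0"
        unfolding pK plane_simps(3) using pl by blast
      have "w \<noteq> 0" and wK: "\<forall>i. w $ i \<in> K" using w by (simp_all add: vecs_def)
      have "proportional m (crs u v)"
        using orthogonal_proportional[of u m v] muv cuv \<open>m \<noteq> 0\<close> by (simp add: dot3_commute)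
      then have d: "dot3 (crs u v) w = 0"
        using w(3) by (auto simp: proportional_def dot3_scale)
      \<comment> \<open>This cross product is the determinant of u, v, w times u, and the
        determinant is 0 by \<open>d\<close>.\<close>
      have "crs (crs u v) (crs u w) = 0"
        by (simp add: crs_crs_crs) (use d in \<open>simp add: dot3_def algebra_simps\<close>)
      show "P \<in> ?R"
      proof (cases "crs u w = 0")
        case True
        then have "proportional w u"
          using crs_eq_0_imp_proportional[OF True nz(1) \<open>w \<noteq> 0\<close>] proportional_sym by blast
        then have "P = p u" using w \<open>w \<noteq> 0\<close> nz by (simp add: p_def point_eq_iff)
        then show ?thesis by simp
      next
        case False
        then have "proportional (crs u w) (crs u v)"
          using crs_eq_0_imp_proportional[of "crs u v" "crs u w"] cuv \<open>crs (crs u v) (crs u w) = 0\<close> proportional_sym by blast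
        then obtain k where k: "k \<noteq> 0" "crs u w = k *s crs u v" by (auto simp: proportional_def)
        \<comment> \<open>Subtracting the right multiple of v from w leaves a vector with zero cross
          product with u, hence a multiple of u.\<close>
        have "crs u (w - k *s v) = crs u w - k *s crs u v"
          by (simp add: vec3_eq_iff algebra_simps)
        then have z: "crs u (w - k *s v) = 0" using k by simp
        have "\<exists>c. w - k *s v = c *s u"
        proof (cases "w - k *s v = 0")
          case True then show ?thesis by (intro exI[of _ 0]) simp
        next
          case False
          then show ?thesis
            using crs_eq_0_imp_proportional[OF z nz(1) False] proportional_sym unfolding proportional_def by blast
        qed
        then obtain c where c: "w - k *s v = c *s u" by blast
        then have w': "w = k *s (v + (c / k) *s u)"
          using k by (simp add: vec3_eq_iff field_simps)
        \<comment> \<open>Both k and, further on, c are quotients of coordinates that are known to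
          lie in K.\<close>
        have "k \<in> K"
        proof -
          obtain i where i: "crs u v $ i \<noteq> 0" using cuv by (auto simp: vec_eq_iff)
          then have "k = crs u w $ i * inverse (crs u v $ i)" using k by simp
          moreover have "crs u w $ i \<in> K" "crs u v $ i \<in> K"
            using crs_in_K[OF uvK] crs_in_K[OF uvK(1), of w] wK by (simp_all del: crs_nth)
          ultimately show ?thesis by (simp only: K_closed(4,6))
        qed
        have "c \<in> K"
        proof -
          obtain i where i: "u $ i \<noteq> 0" using nz(1) by (auto simp: vec_eq_iff)
          then have "c = (w $ i - k * v $ i) * inverse (u $ i)"
            using arg_cong[OF c, of "\<lambda>x. x $ i"] by simp
          moreover have "w $ i \<in> K" "u $ i \<in> K" "v $ i \<in> K" using wK uvK by simp_all
          ultimately show ?thesis using \<open>k \<in> K\<close> by (simp only: K_closed(4,6) K_diff)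
        qed
        have "proportional w (v + (c / k) *s u)"
          using w' k(1) unfolding proportional_def by blast
        then have "P = p (v + (c / k) *s u)"
          using w \<open>w \<noteq> 0\<close> nz by (simp add: p_def point_eq_iff)
        moreover have "c / k \<in> K"
          using \<open>k \<in> K\<close> \<open>c \<in> K\<close> K_closed by (simp add: divide_inverse)
        ultimately show ?thesis by blast
      qed
    qed
  qed
  moreover have "card ?R = card K + 1"
  proof -
    have "crs u (v + c *s u) = crs u v" for c by (simp add: vec3_eq_iff algebra_simps)
    then have "p u \<noteq> p (v + c *s u)" for c
      using nz cuv proportional_imp_crs_eq_0[of u "v + c *s u"] by (auto simp: p_def point_eq_iff)
    moreover have "inj_on (\<lambda>c. p (v + c *s u)) K"
    proof (rule inj_onI)
      fix c d assume "p (v + c *s u) = p (v + d *s u)"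
      then have "crs (v + c *s u) (v + d *s u) = 0"
        using nz proportional_imp_crs_eq_0 by (simp add: p_def point_eq_iff)
      moreover have "crs (v + c *s u) (v + d *s u) = (c - d) *s crs u v"
        by (simp add: vec3_eq_iff algebra_simps)
      ultimately show "c = d" using cuv by simp
    qed
    ultimately show ?thesis
      using assms by (simp add: card_insert_if card_image image_iff)
  qed
  ultimately show "card {P \<in> pts (plane K A). inc (plane K A) P l} = card K + 1" by simp
qed

end

section \<open>Uniqueness of a subplane of given finite order containing a coordinate
  subplane\<close>

lemma two_le_card_obtain:
  assumes "2 \<le> card S"
  obtains x y where "x \<in> S" "y \<in> S" "x \<noteq> y"
proof -
  have "finite S" using assms by (intro card_ge_0_finite) simp
  then have "\<not> (\<forall>x\<in>S. \<forall>y\<in>S. x = y)"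
    using assms by (simp flip: card_le_Suc0_iff_eq)
  then show thesis using that by blast
qed

lemma is_subfield_UNIV: "is_subfield UNIV"
  by (simp add: is_subfield_def)

lemma two_le_card_subfield:
  fixes K :: "'f::field set"
  assumes "is_subfield K" "finite K" shows "2 \<le> card K"
proof -
  have "card {0, 1 :: 'f} \<le> card K"
    using assms by (intro card_mono) (auto simp: is_subfield_def)
  then show ?thesis by simp
qed

lemma PG2_line_unique:
  assumes "P \<in> pts PG2" "Q \<in> pts PG2" "P \<noteq> Q" "l \<in> blks PG2" "m \<in> blks PG2"
    "P \<subseteq> l" "Q \<subseteq> l" "P \<subseteq> m" "Q \<subseteq> m"
  shows "l = m"
proof -
  have i: "invertible (mat 1 :: 'a^3^3)"
    by (auto simp: invertible_def)
  have "\<exists>!l. l \<in> blks PG2 \<and> P \<subseteq> l \<and> Q \<subseteq> l"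
    using plane_join[OF is_subfield_UNIV i, unfolded plane_UNIV[OF i], OF assms(1-3)] .
  then show ?thesis using assms(4-9) by (elim ex1E) metis
qed

text \<open>On a line of the coordinate plane its own points already number
  \<open>card K + 1\<close>, so E has no others there. Through a hypothetical further point P of E
  take the line to a coordinate point Q and cut it with a coordinate line m off Q. The intersection
  is a coordinate point, so the line PQ is a coordinate line, and then P lies in the coordinate
  plane after all.\<close>

lemma subplane_unique:
  fixes K :: "'f::field set" and A :: "'f ^ 3 ^ 3"
  assumes K: "is_subfield K" and A: "invertible A" and fin: "finite K"
    and E: "subplane E PG2" and ord: "has_order E (card K)"
    and sub: "pts (plane K A) \<subseteq> pts E"
  shows "pts E = pts (plane K A)" "blks E = blks (plane K A)"
proof -
  let ?E0 = "plane K A"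
  have E0: "subplane ?E0 PG2" by (rule subplane_plane[OF K A])
  have ord0: "has_order ?E0 (card K)" by (rule has_order_plane[OF K A fin])
  have inc0: "inc ?E0 = (\<subseteq>)" by simp
  have incE: "inc E P l \<longleftrightarrow> P \<subseteq> l" if "P \<in> pts E" "l \<in> blks E" for P l
    using E that by (auto simp: subplane_def)
  have PGE: "pts E \<subseteq> pts PG2" "blks E \<subseteq> blks PG2" and PG0: "pts ?E0 \<subseteq> pts PG2" "blks ?E0 \<subseteq> blks PG2"
    and ppE: "projective_plane E" and pp0: "projective_plane ?E0"
    using E E0 unfolding subplane_def by blast+
  have q: "2 \<le> card K" by (rule two_le_card_subfield[OF K fin])
  note [simp del] = plane_simps(1,2)
  have two0: "\<exists>P Q. P \<in> pts ?E0 \<and> Q \<in> pts ?E0 \<and> P \<noteq> Q \<and> P \<subseteq> l \<and> Q \<subseteq> l" if "l \<in> blks ?E0" for l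
  proof -
    have "2 \<le> card {P \<in> pts ?E0. P \<subseteq> l}"
      using ord0 that q unfolding has_order_def inc0 by simp
    then show ?thesis by (rule two_le_card_obtain) blast
  qed
  have twoE: "\<exists>P Q. P \<in> pts E \<and> Q \<in> pts E \<and> P \<noteq> Q \<and> P \<subseteq> l \<and> Q \<subseteq> l" if "l \<in> blks E" for l
  proof -
    have "2 \<le> card {P \<in> pts E. inc E P l}"
      using ord that q unfolding has_order_def by simp
    then obtain P Q where "P \<in> {P \<in> pts E. inc E P l}" "Q \<in> {P \<in> pts E. inc E P l}" "P \<noteq> Q"
      by (rule two_le_card_obtain)
    then show ?thesis using incE that by blast
  qed
  have joinE: "\<exists>l. l \<in> blks E \<and> P \<subseteq> l \<and> Q \<subseteq> l" if h: "P \<in> pts E" "Q \<in> pts E" "P \<noteq> Q" for P Q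
  proof -
    obtain l where "l \<in> blks E" "inc E P l" "inc E Q l"
      using ex1_implies_ex[OF ppE[unfolded projective_plane_def, THEN conjunct1, rule_format, OF h]]
      by blast
    then show ?thesis using incE that by blast
  qed
  have join0: "\<exists>l. l \<in> blks ?E0 \<and> P \<subseteq> l \<and> Q \<subseteq> l" if "P \<in> pts ?E0" "Q \<in> pts ?E0" "P \<noteq> Q" for P Q
    using ex1_implies_ex[OF plane_join[OF K A that]] .
  have meetE: "\<exists>P. P \<in> pts E \<and> P \<subseteq> l \<and> P \<subseteq> m" if h: "l \<in> blks E" "m \<in> blks E" "l \<noteq> m" for l m
  proof -
    obtain P where "P \<in> pts E" "inc E P l" "inc E P m"
      using ex1_implies_ex[OF ppE[unfolded projective_plane_def, THEN conjunct2, THEN conjunct1, rule_format, OF h]]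
      by blast
    then show ?thesis using incE that by blast
  qed
  have blks0: "blks ?E0 \<subseteq> blks E"
  proof
    fix l assume l: "l \<in> blks ?E0"
    then obtain P Q where PQ: "P \<in> pts ?E0" "Q \<in> pts ?E0" "P \<noteq> Q" "P \<subseteq> l" "Q \<subseteq> l"
      using two0 by blast
    then obtain m where m: "m \<in> blks E" "P \<subseteq> m" "Q \<subseteq> m" using joinE sub by blast
    have "l = m"
      by (rule PG2_line_unique[OF subsetD[OF PG0(1) PQ(1)] subsetD[OF PG0(1) PQ(2)] PQ(3)
            subsetD[OF PG0(2) l] subsetD[OF PGE(2) m(1)] PQ(4,5) m(2,3)])
    then show "l \<in> blks E" using m by simp
  qed
  have onl: "P \<in> pts ?E0" if "P \<in> pts E" "P \<subseteq> l" "l \<in> blks ?E0" for P l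
  proof -
    have lE: "l \<in> blks E" using that blks0 by blast
    have c: "card {P \<in> pts E. inc E P l} = card K + 1"
      using ord lE unfolding has_order_def by blast
    then have "finite {P \<in> pts E. inc E P l}"
      by (intro card_ge_0_finite) simp
    moreover have "{P \<in> pts ?E0. P \<subseteq> l} \<subseteq> {P \<in> pts E. inc E P l}"
      using sub incE lE by blast
    moreover have "card {P \<in> pts ?E0. P \<subseteq> l} = card K + 1"
      using ord0 that(3) unfolding has_order_def inc0 by blast
    ultimately have "{P \<in> pts ?E0. P \<subseteq> l} = {P \<in> pts E. inc E P l}"
      using c by (intro card_subset_eq) simp_all
    then show ?thesis using that lE incE by blast
  qed
  have "pts E \<subseteq> pts ?E0"
  proof
    fix P assume P: "P \<in> pts E"
    obtain S where S: "S \<subseteq> pts ?E0" "card S = 4" "\<forall>l\<in>blks ?E0. card {P \<in> S. P \<subseteq> l} \<le> 2"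
      using pp0[unfolded projective_plane_def inc0, THEN conjunct2, THEN conjunct2] by blast
    have "finite S" using S(2) by (intro card_ge_0_finite) simp
    show "P \<in> pts ?E0"
    proof (rule ccontr)
      assume nP: "P \<notin> pts ?E0"
      obtain Q where Q: "Q \<in> S" using S(2) by fastforce
      \<comment> \<open>Of the four points of a quadrangle, the line joining two others misses Q,
        since no line contains three of them.\<close>
      obtain m where m: "m \<in> blks ?E0" "\<not> Q \<subseteq> m"
      proof -
        have "2 \<le> card (S - {Q})" using S(2) Q \<open>finite S\<close> by simp
        then obtain R R' where R: "R \<in> S - {Q}" "R' \<in> S - {Q}" "R \<noteq> R'" by (rule two_le_card_obtain)
        then obtain m where m: "m \<in> blks ?E0" "R \<subseteq> m" "R' \<subseteq> m" using join0 S(1) by blast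
        have "\<not> Q \<subseteq> m"
        proof
          assume "Q \<subseteq> m"
          then have "{Q, R, R'} \<subseteq> {P \<in> S. P \<subseteq> m}" using m R Q by blast
          then have "card {Q, R, R'} \<le> card {P \<in> S. P \<subseteq> m}"
            using \<open>finite S\<close> by (intro card_mono) simp_all
          moreover have "card {Q, R, R'} = 3"
          proof -
            have "R \<noteq> Q" "R' \<noteq> Q" using R(1,2) by simp_all
            then show ?thesis using R(3) by (simp add: card_insert_if not_sym)
          qed
          moreover have "card {P \<in> S. P \<subseteq> m} \<le> 2" using S(3) m(1) by blast
          ultimately show False by simp
        qed
        then show thesis using that m by blast
      qed
      have Q0: "Q \<in> pts ?E0" using Q S(1) by blast
      then have "Q \<in> pts E" "P \<noteq> Q" using sub nP by blast+
      then obtain n where n: "n \<in> blks E" "P \<subseteq> n" "Q \<subseteq> n" using joinE P by blast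
      have "n \<noteq> m" using n m by blast
      then obtain R where R: "R \<in> pts E" "R \<subseteq> n" "R \<subseteq> m"
        using meetE n(1) m(1) blks0 by blast
      have R0: "R \<in> pts ?E0" using onl R m by blast
      have "R \<noteq> Q" using R m by blast
      then obtain n' where n': "n' \<in> blks ?E0" "R \<subseteq> n'" "Q \<subseteq> n'" using join0 R0 Q0 by blast
      have "n = n'"
        by (rule PG2_line_unique[OF subsetD[OF PG0(1) R0] subsetD[OF PG0(1) Q0] \<open>R \<noteq> Q\<close>
              subsetD[OF PGE(2) n(1)] subsetD[OF PG0(2) n'(1)] R(2) n(3) n'(2,3)])
      then have "P \<in> pts ?E0" using onl[OF P n(2)] n'(1) by simp
      then show False using nP by simp
    qed
  qed
  then show p: "pts E = pts ?E0" using sub by blast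
  have "blks E \<subseteq> blks ?E0"
  proof
    fix l assume l: "l \<in> blks E"
    obtain P Q where PQ: "P \<in> pts ?E0" "Q \<in> pts ?E0" "P \<noteq> Q" "P \<subseteq> l" "Q \<subseteq> l"
      using twoE[OF l] unfolding p by blast
    obtain m where m: "m \<in> blks ?E0" "P \<subseteq> m" "Q \<subseteq> m" using join0[OF PQ(1-3)] by blast
    have "l = m"
      by (rule PG2_line_unique[OF subsetD[OF PG0(1) PQ(1)] subsetD[OF PG0(1) PQ(2)] PQ(3)
            subsetD[OF PGE(2) l] subsetD[OF PG0(2) m(1)] PQ(4,5) m(2,3)])
    then show "l \<in> blks ?E0" using m by simp
  qed
  then show "blks E = blks ?E0" using blks0 by blast
qed

text \<open>The incidence relation of a subplane is prescribed only on its own points and blocks, so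
  two subplanes with the same points and blocks may differ as records. Automorphisms do not see the
  difference.\<close>

lemma automorphism_cong:
  assumes "pts E = pts E'" "blks E = blks E'"
    "\<And>P l. P \<in> pts E \<Longrightarrow> l \<in> blks E \<Longrightarrow> inc E P l \<longleftrightarrow> inc E' P l"
  shows "automorphism E c d \<longleftrightarrow> automorphism E' c d"
proof -
  have "inc E (c P) (d l) \<longleftrightarrow> inc E' (c P) (d l)"
    if "bij_betw c (pts E) (pts E)" "bij_betw d (blks E) (blks E)" "P \<in> pts E" "l \<in> blks E" for P l
    using that assms(3) bij_betwE by metis
  then show ?thesis
    unfolding automorphism_def assms(1,2)[symmetric] using assms(3) by auto
qed

section \<open>Collineations induced by field automorphisms and a change of frame\<close>

lemma field_automorphism_simps:
  assumes "field_automorphism s"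
  shows "s (x + y) = s x + s y" "s (x * y) = s x * s y" "s 0 = 0" "s 1 = 1" "s (- x) = - s x"
    "s (x - y) = s x - s y" "s (x ^ n) = s x ^ n" "bij s" "s x = 0 \<longleftrightarrow> x = 0"
proof -
  show a: "s (x + y) = s x + s y" for x y using assms by (simp add: field_automorphism_def)
  show m: "s (x * y) = s x * s y" for x y using assms by (simp add: field_automorphism_def)
  show b: "bij s" using assms by (simp add: field_automorphism_def)
  have "s 0 + s 0 = s 0 + 0" using a[of 0 0] by simp
  then show z: "s 0 = 0" by (simp only: add_left_cancel)
  obtain e where "s e = 1" using b by (metis bij_pointE)
  then show o: "s 1 = 1" using m[of e 1] by simp
  have "s (- x) + s x = 0" for x using a[of "- x" x] z by simp
  then show u: "s (- x) = - s x" for x by (simp add: eq_neg_iff_add_eq_0)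
  show "s (x - y) = s x - s y" using a[of x "- y"] u by simp
  show "s (x ^ n) = s x ^ n" by (induction n) (simp_all add: m o)
  show "s x = 0 \<longleftrightarrow> x = 0" using b z by (metis bij_pointE)
qed

lemma field_automorphism_id: "field_automorphism id"
  by (simp add: field_automorphism_def)

definition vmap :: "('f \<Rightarrow> 'f) \<Rightarrow> 'f ^ 3 \<Rightarrow> 'f ^ 3" where
  "vmap s v = (\<chi> i. s (v $ i))"

lemma vmap_nth [simp]: "vmap s v $ i = s (v $ i)"
  by (simp add: vmap_def)

context
  fixes K :: "'f::field set" and s :: "'f \<Rightarrow> 'f"
  assumes K: "is_subfield K" and bij: "bij_betw s K K"
    and add: "\<And>x y. x \<in> K \<Longrightarrow> y \<in> K \<Longrightarrow> s (x + y) = s x + s y"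
    and mult: "\<And>x y. x \<in> K \<Longrightarrow> y \<in> K \<Longrightarrow> s (x * y) = s x * s y"
begin

lemma s_in: "x \<in> K \<Longrightarrow> s x \<in> K"
  using bij by (rule bij_betw_apply)

lemma s_0: "s 0 = 0"
proof -
  have "s 0 + s 0 = s 0 + 0" using add[of 0 0] K by (simp add: is_subfield_def)
  then show ?thesis by (simp only: add_left_cancel)
qed

lemma s_eq_0: "x \<in> K \<Longrightarrow> s x = 0 \<longleftrightarrow> x = 0"
proof -
  assume x: "x \<in> K"
  have "0 \<in> K" using K by (simp add: is_subfield_def)
  then have "s x = s 0 \<longleftrightarrow> x = 0" using x bij by (auto simp: bij_betw_def dest: inj_onD)
  then show ?thesis by (simp add: s_0)
qed

lemma vmap_bij: "bij_betw (vmap s) (vecs K) (vecs K)"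
proof (rule bij_betw_imageI)
  show "inj_on (vmap s) (vecs K)"
  proof (rule inj_onI)
    fix u v assume uv: "u \<in> vecs K" "v \<in> vecs K" "vmap s u = vmap s v"
    have "s (u $ i) = s (v $ i)" for i using uv(3) by (metis vmap_nth)
    then have "u $ i = v $ i" for i
      using uv(1,2) bij by (auto simp: vecs_def bij_betw_def dest: inj_onD)
    then show "u = v" by (simp add: vec_eq_iff)
  qed
  show "vmap s ` vecs K = vecs K"
  proof
    show "vmap s ` vecs K \<subseteq> vecs K"
    proof
      fix w assume "w \<in> vmap s ` vecs K"
      then obtain v where v: "v \<in> vecs K" "w = vmap s v" by blast
      then obtain i where "v $ i \<noteq> 0" by (auto simp: vecs_def vec_eq_iff)
      then have "w $ i \<noteq> 0" using v s_eq_0 by (simp add: vecs_def)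
      then have "w \<noteq> 0" by (metis zero_index)
      then show "w \<in> vecs K" using v s_in by (simp add: vecs_def)
    qed
    show "vecs K \<subseteq> vmap s ` vecs K"
    proof
      fix w assume w: "w \<in> vecs K"
      define v where "v = vmap (inv_into K s) w"
      have ws: "w $ i \<in> s ` K" for i using w bij by (simp add: vecs_def bij_betw_def)
      have "vmap s v = w"
        unfolding v_def using ws by (simp add: vec_eq_iff f_inv_into_f)
      moreover have "v \<in> vecs K"
      proof -
        have "v $ i \<in> K" for i unfolding v_def using ws by (simp add: inv_into_into)
        moreover have "v \<noteq> 0"
        proof
          assume "v = 0"
          then have "w = 0" using \<open>vmap s v = w\<close> by (simp add: vec_eq_iff s_0)
          then show False using w by (simp add: vecs_def)
        qed
        ultimately show ?thesis by (simp add: vecs_def)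
      qed
      ultimately show "w \<in> vmap s ` vecs K" by blast
    qed
  qed
qed

lemma dot3_vmap:
  assumes "u \<in> vecs K" "v \<in> vecs K" shows "dot3 (vmap s u) (vmap s v) = s (dot3 u v)" "dot3 u v \<in> K"
proof -
  have m: "u $ i * v $ i \<in> K" for i using assms K by (simp add: vecs_def is_subfield_def)
  then have "u $ 1 * v $ 1 + u $ 2 * v $ 2 \<in> K" using K by (simp add: is_subfield_def)
  then show "dot3 (vmap s u) (vmap s v) = s (dot3 u v)"
    using m add mult assms by (simp add: dot3_def vecs_def)
  show "dot3 u v \<in> K" unfolding dot3_def using m K by (simp add: is_subfield_def)
qed

lemma crs_vmap:
  assumes "u \<in> vecs K" "v \<in> vecs K"
  shows "crs (vmap s u) (vmap s v) = 0 \<longleftrightarrow> crs u v = 0"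
proof -
  have m: "u $ i * v $ j \<in> K" for i j using assms K by (simp add: vecs_def is_subfield_def)
  have e: "s (u $ i) * s (v $ j) = s (u $ i * v $ j)" for i j
    using assms mult by (simp add: vecs_def)
  have "s x = s y \<longleftrightarrow> x = y" if "x \<in> K" "y \<in> K" for x y
    using bij that by (auto simp: bij_betw_def dest: inj_onD)
  then show ?thesis using m by (simp add: vec3_eq_iff e)
qed

text \<open>The argument goes through the cross product because the factor in
  \<open>proportional\<close> is an arbitrary element of F, whereas s is additive and multiplicative
  only on K.\<close>

lemma proportional_vmap:
  assumes "u \<in> vecs K" "v \<in> vecs K"
  shows "proportional (vmap s u) (vmap s v) \<longleftrightarrow> proportional u v"
proof -
  have "vmap s u \<in> vecs K" "vmap s v \<in> vecs K" 
    using bij_betw_apply[OF vmap_bij] assms by simp_all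
  then have "vmap s u \<noteq> 0" "vmap s v \<noteq> 0" "u \<noteq> 0" "v \<noteq> 0" using assms by (simp_all add: vecs_def)
  then show ?thesis
    using crs_vmap[OF assms] crs_eq_0_imp_proportional[of u v] proportional_imp_crs_eq_0[of u v]
      crs_eq_0_imp_proportional[of "vmap s u" "vmap s v"] proportional_imp_crs_eq_0[of "vmap s u" "vmap s v"]
    by argo
qed

text \<open>The coordinate map respects proportionality and so descends to classes. The functions p
  and p' stand for points or for lines in two frames, which lets one statement provide both halves
  of a collineation.\<close>

lemma vmap_induces_bij:
  assumes p: "\<And>u v. u \<in> vecs K \<Longrightarrow> v \<in> vecs K \<Longrightarrow> p u = p v \<longleftrightarrow> proportional u v"
    and p': "\<And>u v. u \<in> vecs K \<Longrightarrow> v \<in> vecs K \<Longrightarrow> p' u = p' v \<longleftrightarrow> proportional u v"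
  obtains c where "bij_betw c (p ` vecs K) (p' ` vecs K)" "\<And>v. v \<in> vecs K \<Longrightarrow> c (p v) = p' (vmap s v)"
proof -
  define c where "c P = p' (vmap s (SOME v. v \<in> vecs K \<and> P = p v))" for P
  have S: "vmap s v \<in> vecs K" if "v \<in> vecs K" for v using bij_betw_apply[OF vmap_bij that] .
  have c: "c (p v) = p' (vmap s v)" if v: "v \<in> vecs K" for v
  proof -
    define w where "w = (SOME w. w \<in> vecs K \<and> p v = p w)"
    have w: "w \<in> vecs K \<and> p v = p w" unfolding w_def by (rule someI[of _ v]) (simp add: v)
    then have "proportional v w" using p[OF v, of w] by simp
    then have "proportional (vmap s w) (vmap s v)"
      using proportional_vmap[of w v] w v proportional_sym[of v w] by simp
    then show ?thesis unfolding c_def w_def[symmetric] using p'[OF S S, of w v] w v by simp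
  qed
  have "bij_betw c (p ` vecs K) (p' ` vecs K)"
  proof (rule bij_betw_imageI)
    show "inj_on c (p ` vecs K)"
    proof (rule inj_onI, clarify)
      fix u v assume "c (p u) = c (p v)" "u \<in> vecs K" "v \<in> vecs K"
      then show "p u = p v" by (simp add: c p p' S proportional_vmap)
    qed
    have "c ` p ` vecs K = p' ` vmap s ` vecs K" by (simp add: image_image c)
    then show "c ` p ` vecs K = p' ` vecs K" using vmap_bij unfolding bij_betw_def by simp
  qed
  then show thesis using that c by blast
qed

text \<open>Here s is an automorphism of K only, so the lemma covers the subplane, whose field
  automorphism may fail to extend to F, as well as \<open>PG2\<close> with K equal to F. Equality of
  the two planes makes the map between frames an automorphism.\<close>

lemma plane_semilinear_map:
  assumes A: "invertible A" and A': "invertible A'" and eq: "plane K A' = plane K A"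
  shows "\<exists>c d. automorphism (plane K A) c d \<and>
    (\<forall>v\<in>vecs K. c ((*v) A ` vec.span {v}) = (*v) A' ` vec.span {vmap s v})"
proof -
  define p where "p B v = (*v) B ` vec.span {v}" for B :: "'f ^ 3 ^ 3" and v
  define g where "g B v = (*v) B ` lperp v" for B :: "'f ^ 3 ^ 3" and v
  have nz: "v \<noteq> 0" if "v \<in> vecs K" for v using that by (simp add: vecs_def)
  have p_eq: "p B u = p B v \<longleftrightarrow> proportional u v"
    and g_eq: "g B u = g B v \<longleftrightarrow> proportional u v"
    if "invertible B" "u \<in> vecs K" "v \<in> vecs K" for B u v
    unfolding p_def g_def
    by (rule point_eq_iff[OF K that(1) nz[OF that(2)] nz[OF that(3)]],
        rule line_eq_iff[OF K that(1) nz[OF that(2)] nz[OF that(3)]])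
  obtain c where c: "bij_betw c (p A ` vecs K) (p A' ` vecs K)"
      "\<And>v. v \<in> vecs K \<Longrightarrow> c (p A v) = p A' (vmap s v)"
    by (rule vmap_induces_bij[of "p A" "p A'"])
      (erule (1) p_eq[OF A] | erule (1) p_eq[OF A'] | rule that; assumption)+
  obtain d where d: "bij_betw d (g A ` vecs K) (g A' ` vecs K)"
      "\<And>v. v \<in> vecs K \<Longrightarrow> d (g A v) = g A' (vmap s v)"
    by (rule vmap_induces_bij[of "g A" "g A'"])
      (erule (1) g_eq[OF A] | erule (1) g_eq[OF A'] | rule that; assumption)+
  have P: "pts (plane K B) = p B ` vecs K" and L: "blks (plane K B) = g B ` vecs K" for B
    by (simp_all add: p_def g_def image_def)
  have inc: "p B v \<subseteq> g B l \<longleftrightarrow> dot3 l v = 0" if "invertible B" for B v l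
    unfolding p_def g_def by (rule point_inc_line[OF K that])
  have "\<forall>P\<in>pts (plane K A). \<forall>l\<in>blks (plane K A). P \<subseteq> l \<longleftrightarrow> c P \<subseteq> d l"
    unfolding P L
  proof (intro ballI, elim imageE, hypsubst)
    fix v l assume "v \<in> vecs K" "l \<in> vecs K"
    then show "p A v \<subseteq> g A l \<longleftrightarrow> c (p A v) \<subseteq> d (g A l)"
      using dot3_vmap[of l v] s_eq_0 by (simp add: c d inc A A')
  qed
  then have "automorphism (plane K A) c d"
    using c(1) d(1) unfolding automorphism_def plane_simps(3) P[symmetric] L[symmetric] eq by blast
  then show ?thesis using c(2)[unfolded p_def] by (intro exI[of _ c] exI[of _ d]) simp
qed

end

subsection \<open>Coordinates forced by the incidences\<close>

text \<open>\<open>el n\<close> has the binary digits of \<open>n\<close> as its coefficients of 1, z and z^2.\<close>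

fun el :: "nat \<Rightarrow> gf8" where "el n = GF8 (odd n) (odd (n div 2)) (odd (n div 4))"

definition ptv :: "'f::field \<Rightarrow> gf8 \<times> gf8 \<Rightarrow> 'f ^ 3" where
  "ptv \<zeta> P = vector [phom \<zeta> (fst P), phom \<zeta> (snd P), 1]"

definition lnv :: "'f::field \<Rightarrow> gf8 \<times> gf8 \<Rightarrow> 'f ^ 3" where
  "lnv \<zeta> v = vector [phom \<zeta> ((fst v)\<^sup>2), phom \<zeta> ((snd v)\<^sup>2), phom \<zeta> (1 + fst v * snd v)]"

lemma gf8_add_eq_0_iff: "x + y = 0 \<longleftrightarrow> x = (y::gf8)"
  by (metis add_eq_0_iff gf8_uminus)

context gf8_root
begin

lemma dot3_lnv_ptv: "dot3 (lnv \<zeta> v) (ptv \<zeta> P) = 0 \<longleftrightarrow> incd P v"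
proof -
  have "dot3 (lnv \<zeta> v) (ptv \<zeta> P) =
      \<sigma> ((fst P * (fst v)\<^sup>2 + fst v * snd v + snd P * (snd v)\<^sup>2) + 1)"
    unfolding dot3_def lnv_def ptv_def by (simp add: hom_add hom_mult ac_simps)
  then show ?thesis
    by (simp add: hom_eq_0_iff gf8_add_eq_0_iff incd_def)
qed

lemma lnv_nonzero: "v \<noteq> (0, 0) \<Longrightarrow> lnv \<zeta> v \<noteq> 0"
  by (cases v) (auto simp: lnv_def vec3_eq_iff hom_eq_0_iff)

lemma ptv_nonzero: "ptv \<zeta> P \<noteq> 0"
  by (simp add: ptv_def vec3_eq_iff)

text \<open>Either the cross product of the two points vanishes, or it is a multiple of
  \<open>lnv \<zeta> v\<close>, which is orthogonal to X.\<close>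

lemma collinear_ptv:
  assumes "v \<noteq> (0, 0)" "incd P v" "incd Q v" "incd X v"
  shows "dot3 (crs (ptv \<zeta> P) (ptv \<zeta> Q)) (ptv \<zeta> X) = 0"
proof (cases "crs (ptv \<zeta> P) (ptv \<zeta> Q) = 0")
  case False
  have "proportional (lnv \<zeta> v) (crs (ptv \<zeta> P) (ptv \<zeta> Q))"
    using assms by (intro orthogonal_proportional False lnv_nonzero)
      (simp_all add: dot3_lnv_ptv dot3_commute[of "ptv \<zeta> _"])
  moreover have "dot3 (lnv \<zeta> v) (ptv \<zeta> X) = 0" using assms by (simp add: dot3_lnv_ptv)
  ultimately show ?thesis by (auto simp: proportional_def dot3_scale)
qed (simp add: dot3_zero)

end

lemma trace1_add: "trace1 (x + (y\<^sup>2 + y)) \<longleftrightarrow> trace1 x"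
  by (cases x rule: gf8_exhaust8; cases y rule: gf8_exhaust8;
      simp add: power2_eq_square trace1_GF8 zero_gf8_def)

text \<open>For t nonzero put a = x t^2 and solve the block equation for c. Then a c = x + (x s t)^2
  + x s t, and y^2 + y has trace 0, so each x of trace 1 yields a point. For t = 0 the equation
  forces a = 1 / s^2, and c = x s^2 is taken. The elements \<open>el 1\<close> and
  \<open>el 3\<close> have trace 1.\<close>

lemma two_points_on_block:
  assumes "v \<noteq> (0, 0)"
  obtains P Q where "P \<in> Om" "Q \<in> Om" "P \<noteq> Q" "incd P v" "incd Q v"
proof -
  obtain s t where v: "v = (s, t)" by (cases v)
  define p where "p x = (if t = 0 then (inverse (s\<^sup>2), x * s\<^sup>2)
    else (x * t\<^sup>2, x * s\<^sup>2 + s * inverse t + inverse (t\<^sup>2)))" for x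
  have in_Om: "p x \<in> Om" if "trace1 x" for x
  proof (cases "t = 0")
    case True
    then have "s\<^sup>2 \<noteq> 0" using assms v by simp
    then show ?thesis using True that by (simp add: p_def Om_def field_simps)
  next
    case False
    have "x * t\<^sup>2 * (x * s\<^sup>2 + s * inverse t + inverse (t\<^sup>2)) = x + ((x * s * t)\<^sup>2 + x * s * t)"
      using False by (simp add: field_simps power2_eq_square)
    then show ?thesis using False that by (simp add: p_def Om_def trace1_add)
  qed
  have inc: "incd (p x) v" for x
  proof (cases "t = 0")
    case True
    then have "s\<^sup>2 \<noteq> 0" using assms v by simp
    then show ?thesis using True v by (simp add: p_def incd_def)
  next
    case False
    have "x * t\<^sup>2 * s\<^sup>2 + s * t + (x * s\<^sup>2 + s * inverse t + inverse (t\<^sup>2)) * t\<^sup>2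
        = (x * t\<^sup>2 * s\<^sup>2 + x * t\<^sup>2 * s\<^sup>2) + (s * t + s * t) + 1"
      using False by (simp add: field_simps power2_eq_square)
    then show ?thesis using False v by (simp add: p_def incd_def)
  qed
  have "p (el 1) \<noteq> p (el 3)"
    using assms v by (auto simp: p_def)
  then show thesis
    using that[of "p (el 1)" "p (el 3)"] in_Om inc by (simp add: trace1_GF8)
qed

text \<open>An embedding in homogeneous coordinates: w chooses a vector for each point and m a line
  vector for each block.\<close>

locale unital_rep =
  fixes w m :: "gf8 \<times> gf8 \<Rightarrow> 'f::field ^ 3"
  assumes w_nonzero: "P \<in> Om \<Longrightarrow> w P \<noteq> 0"
    and m_nonzero: "v \<noteq> (0, 0) \<Longrightarrow> m v \<noteq> 0"
    and w_distinct: "P \<in> Om \<Longrightarrow> Q \<in> Om \<Longrightarrow> P \<noteq> Q \<Longrightarrow> \<not> proportional (w P) (w Q)"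
    and inc_iff: "P \<in> Om \<Longrightarrow> v \<noteq> (0, 0) \<Longrightarrow> incd P v \<longleftrightarrow> dot3 (m v) (w P) = 0"
begin

text \<open>The vector p gives the coordinates, up to a factor, of the image of P in the frame
  formed by the columns of B. In the same frame a block v has the line vector
  \<open>m v v* B\<close>.\<close>

definition located :: "'f ^ 3 ^ 3 \<Rightarrow> gf8 \<times> gf8 \<Rightarrow> 'f ^ 3 \<Rightarrow> bool" where
  "located B P p \<longleftrightarrow> P \<in> Om \<and> proportional (w P) (B *v p)"

lemma located_dot3:
  assumes "located B P p" "v \<noteq> (0, 0)"
  shows "dot3 (m v v* B) p = 0 \<longleftrightarrow> incd P v"
proof -
  obtain c where c: "c \<noteq> 0" "w P = c *s (B *v p)" "P \<in> Om"
    using assms(1) by (auto simp: located_def proportional_def)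
  then show ?thesis
    using inc_iff[OF c(3) assms(2)] by (simp add: dot3_scale dot3_matrix)
qed

lemma located_crs:
  assumes "located B P p" "located B Q q" "P \<noteq> Q"
  shows "crs p q \<noteq> 0"
proof
  assume z: "crs p q = 0"
  have Om: "P \<in> Om" "Q \<in> Om" and pr: "proportional (w P) (B *v p)" "proportional (w Q) (B *v q)"
    using assms by (auto simp: located_def)
  have "p \<noteq> 0" "q \<noteq> 0"
    using pr w_nonzero[OF Om(1)] w_nonzero[OF Om(2)] by (auto simp: proportional_def)
  then obtain c where c: "c \<noteq> 0" "p = c *s q"
    using crs_eq_0_imp_proportional[OF z] by (auto simp: proportional_def)
  then have "proportional (B *v p) (B *v q)"
    unfolding proportional_def by (auto simp: vector_scalar_commute)
  then have "proportional (w P) (w Q)"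
    using pr proportional_trans proportional_sym by blast
  then show False using w_distinct Om assms(3) by blast
qed

lemma block_line:
  assumes "invertible B" "v \<noteq> (0, 0)" "located B P p" "located B Q q" "P \<noteq> Q" "incd P v" "incd Q v"
  shows "proportional (m v v* B) (crs p q)"
proof (rule orthogonal_proportional)
  show "dot3 p (m v v* B) = 0" "dot3 q (m v v* B) = 0"
    using assms located_dot3 dot3_commute by metis+
  show "crs p q \<noteq> 0" using assms located_crs by blast
  show "m v v* B \<noteq> 0" using assms vector_matrix_eq_0 m_nonzero by blast
qed

lemma collinear:
  assumes "invertible B" "v \<noteq> (0, 0)" "located B P p" "located B Q q" "P \<noteq> Q" "incd P v" "incd Q v"
  shows "dot3 (crs p q) x = 0 \<longleftrightarrow> dot3 (m v v* B) x = 0"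
  using block_line[OF assms] by (auto simp: proportional_def dot3_scale)

text \<open>The conditions concern the unital alone and are decided by evaluation in
  \<open>gf8\<close>: X is common to the block u through P, Q and the block v through R, S. The last
  conjunct makes the two blocks different.\<close>

definition meets where "meets u v X P Q R S \<longleftrightarrow> u \<noteq> (0, 0) \<and> v \<noteq> (0, 0) \<and> X \<in> Om \<and> P \<noteq> Q \<and> R \<noteq> S \<and>
    incd P u \<and> incd Q u \<and> incd X u \<and> incd R v \<and> incd S v \<and> incd X v \<and> \<not> incd P v"

text \<open>Both \<open>w X\<close> and \<open>B *v y\<close> are orthogonal to the line vectors of
  u and v, and these are independent because the image of P lies on one line only. Since y is
  proposed and merely tested, it can be given in any convenient multiple.\<close>

lemma meet:
  assumes B: "invertible B" and meets: "meets u v X P Q R S"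
    and P: "located B P p" and Q: "located B Q q" and R: "located B R r" and S: "located B S s"
    and y: "y \<noteq> 0" "dot3 (crs p q) y = 0" "dot3 (crs r s) y = 0"
  shows "located B X y"
proof -
  have c: "u \<noteq> (0, 0)" "v \<noteq> (0, 0)" "X \<in> Om" "P \<noteq> Q" "R \<noteq> S"
      "incd P u" "incd Q u" "incd X u" "incd R v" "incd S v" "incd X v" "\<not> incd P v"
    using meets by (simp_all add: meets_def)
  have y0: "dot3 (m u) (B *v y) = 0" "dot3 (m v) (B *v y) = 0"
    using collinear[OF B c(1) P Q c(4,6,7)] collinear[OF B c(2) R S c(5,9,10)] y
    by (simp_all add: dot3_matrix)
  have X0: "dot3 (m u) (w X) = 0" "dot3 (m v) (w X) = 0"
    using inc_iff c by blast+
  have uv: "crs (m u) (m v) \<noteq> 0"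
  proof
    assume "crs (m u) (m v) = 0"
    then obtain k where "k \<noteq> 0" "m u = k *s m v"
      using crs_eq_0_imp_proportional m_nonzero c(1,2) by (metis proportional_def)
    moreover have "P \<in> Om" using P by (simp add: located_def)
    ultimately show False
      using inc_iff[of P u] inc_iff[of P v] c by (simp add: dot3_scale)
  qed
  have "B *v y \<noteq> 0" using y(1) B by (simp add: matrix_eq_0_iff)
  then have "proportional (w X) (B *v y)"
    using orthogonal_proportional[OF X0 uv w_nonzero[OF c(3)]] orthogonal_proportional[OF y0 uv]
      proportional_trans proportional_sym by blast
  then show ?thesis using c(3) by (simp add: located_def)
qed

lemmas unital_simps = meets_def Om_def incd_GF8 trace1_GF8

text \<open>The three blocks are the sides of the triangle of the first three points. The fourth
  point is on none of them, and the fifth is on the third side.\<close>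

lemma exists_frame:
  obtains B t where "invertible B" "t \<noteq> 0"
    "located B (el 2, el 4) (vector [1, 0, 0])"
    "located B (el 1, el 1) (vector [0, 1, 0])"
    "located B (el 2, el 6) (vector [0, 0, 1])"
    "located B (el 3, el 6) (vector [1, 1, 1])"
    "located B (el 6, el 3) (vector [1, t, 0])"
proof -
  let ?P1 = "(el 2, el 4)" and ?P2 = "(el 1, el 1)" and ?P3 = "(el 2, el 6)" and ?P4 = "(el 3, el 6)" and ?P5 = "(el 6, el 3)"
  let ?l1 = "(el 4, el 2)" and ?l2 = "(el 3, el 0)" and ?l3 = "(el 4, el 6)"
  have Om: "?P1 \<in> Om" "?P2 \<in> Om" "?P3 \<in> Om" "?P4 \<in> Om" "?P5 \<in> Om"
    by (simp_all add: unital_simps)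
  have ne: "?l1 \<noteq> (0, 0)" "?l2 \<noteq> (0, 0)" "?l3 \<noteq> (0, 0)"
    by (simp_all add: zero_gf8_def)
  have in1: "\<not> incd ?P1 ?l1" "incd ?P2 ?l1" "incd ?P3 ?l1" "\<not> incd ?P4 ?l1"
    by (simp_all add: unital_simps)
  have in2: "incd ?P1 ?l2" "\<not> incd ?P2 ?l2" "incd ?P3 ?l2" "\<not> incd ?P4 ?l2"
    by (simp_all add: unital_simps)
  have in3: "incd ?P1 ?l3" "incd ?P2 ?l3" "\<not> incd ?P3 ?l3" "\<not> incd ?P4 ?l3" "incd ?P5 ?l3"
    by (simp_all add: unital_simps)
  define u1 u2 u3 u4 u5 where u: "u1 = w ?P1" "u2 = w ?P2" "u3 = w ?P3" "u4 = w ?P4" "u5 = w ?P5"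
  define n1 n2 n3 where n: "n1 = m ?l1" "n2 = m ?l2" "n3 = m ?l3"
  have d1: "dot3 n1 u1 \<noteq> 0" "dot3 n1 u2 = 0" "dot3 n1 u3 = 0" "dot3 n1 u4 \<noteq> 0"
    unfolding u n using in1 inc_iff[OF Om(1) ne(1)] inc_iff[OF Om(2) ne(1)] inc_iff[OF Om(3) ne(1)]
      inc_iff[OF Om(4) ne(1)] by blast+
  have d2: "dot3 n2 u1 = 0" "dot3 n2 u2 \<noteq> 0" "dot3 n2 u3 = 0" "dot3 n2 u4 \<noteq> 0"
    unfolding u n using in2 inc_iff[OF Om(1) ne(2)] inc_iff[OF Om(2) ne(2)] inc_iff[OF Om(3) ne(2)]
      inc_iff[OF Om(4) ne(2)] by blast+
  have d3: "dot3 n3 u1 = 0" "dot3 n3 u2 = 0" "dot3 n3 u3 \<noteq> 0" "dot3 n3 u4 \<noteq> 0" "dot3 n3 u5 = 0"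
    unfolding u n using in3 inc_iff[OF Om(1) ne(3)] inc_iff[OF Om(2) ne(3)] inc_iff[OF Om(3) ne(3)]
      inc_iff[OF Om(4) ne(3)] inc_iff[OF Om(5) ne(3)] by blast+
  \<comment> \<open>The columns are multiples of u1, u2, u3. Each side vanishes at two of the
    columns, so applying it to a vector reads off one coordinate; this yields invertibility and the
    nonzero coordinates below.\<close>
  define C where "C a b c = (\<chi> i. vector [a * u1 $ i, b * u2 $ i, c * u3 $ i] :: 'f ^ 3 ^ 3)" for a b c
  have C: "C a b c *v x = (a * x $ 1) *s u1 + (b * x $ 2) *s u2 + (c * x $ 3) *s u3" for a b c x
    by (simp add: C_def vec3_eq_iff matrix_vector_mult_def sum_3 algebra_simps)
  have Cd: "dot3 n1 (C a b c *v x) = a * x $ 1 * dot3 n1 u1"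
       "dot3 n2 (C a b c *v x) = b * x $ 2 * dot3 n2 u2"
       "dot3 n3 (C a b c *v x) = c * x $ 3 * dot3 n3 u3" for a b c x
    unfolding C by (simp_all add: dot3_add dot3_scale d1 d2 d3)
  have Cinv: "invertible (C a b c)" if "a \<noteq> 0" "b \<noteq> 0" "c \<noteq> 0" for a b c
  proof -
    have "x = 0" if "C a b c *v x = 0" for x
      using Cd[of a b c x] \<open>a \<noteq> 0\<close> \<open>b \<noteq> 0\<close> \<open>c \<noteq> 0\<close> d1 d2 d3 unfolding that
      by (simp add: dot3_zero vec3_eq_iff)
    then show ?thesis
      unfolding invertible_left_inverse matrix_left_invertible_ker by blast
  qed
  \<comment> \<open>The coordinates of u4 in the basis u1, u2, u3. Taken as scale factors of the
    columns, they send (1, 1, 1) to u4.\<close>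
  define y where "y = matrix_inv (C 1 1 1) *v u4"
  have y: "C 1 1 1 *v y = u4" unfolding y_def by (rule matrix_inv_cancel(1)) (simp add: Cinv)
  then have ynz: "y $ 1 \<noteq> 0" "y $ 2 \<noteq> 0" "y $ 3 \<noteq> 0"
    using Cd[of 1 1 1 y] d1 d2 d3 by auto
  define B where "B = C (y $ 1) (y $ 2) (y $ 3)"
  have B: "invertible B" unfolding B_def by (rule Cinv[OF ynz])
  define x where "x = matrix_inv B *v u5"
  have x: "B *v x = u5" unfolding x_def by (rule matrix_inv_cancel(1)[OF B])
  have x3: "x $ 3 = 0"
    using Cd(3)[of "y $ 1" "y $ 2" "y $ 3" x] x ynz d3 unfolding B_def by auto
  have Bx: "B *v z = (y $ 1 * z $ 1) *s u1 + (y $ 2 * z $ 2) *s u2 + (y $ 3 * z $ 3) *s u3" for z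
    unfolding B_def by (rule C)
  have p5: "\<not> proportional u5 u1" "\<not> proportional u5 u2"
    unfolding u by (rule w_distinct[OF Om(5) Om(1)], simp, rule w_distinct[OF Om(5) Om(2)], simp)
  have u5: "u5 \<noteq> 0" unfolding u by (rule w_nonzero[OF Om(5)])
  have x1: "x $ 1 \<noteq> 0"
  proof
    assume "x $ 1 = 0"
    then have "u5 = (y $ 2 * x $ 2) *s u2" using Bx[of x] x x3 by simp
    then show False using p5(2) u5 unfolding proportional_def by (metis vector_smult_lzero)
  qed
  have x2: "x $ 2 \<noteq> 0"
  proof
    assume "x $ 2 = 0"
    then have "u5 = (y $ 1 * x $ 1) *s u1" using Bx[of x] x x3 by simp
    then show False using p5(1) u5 unfolding proportional_def by (metis vector_smult_lzero)
  qed
  show thesis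
  proof (rule that[OF B, of "x $ 2 / x $ 1"])
    show "x $ 2 / x $ 1 \<noteq> 0" using x1 x2 by simp
    have "B *v vector [1, 0, 0] = y $ 1 *s u1" "B *v vector [0, 1, 0] = y $ 2 *s u2" "B *v vector [0, 0, 1] = y $ 3 *s u3"
      by (simp_all add: Bx)
    then show "located B ?P1 (vector [1, 0, 0])" "located B ?P2 (vector [0, 1, 0])" "located B ?P3 (vector [0, 0, 1])"
      unfolding located_def u[symmetric] using Om proportional_sym[OF proportional_scale] ynz by metis+
    have "B *v vector [1, 1, 1] = u4"
      using y by (simp add: Bx C)
    then show "located B ?P4 (vector [1, 1, 1])"
      unfolding located_def u[symmetric] using Om(4) proportional_refl by metis
    have "x = x $ 1 *s vector [1, x $ 2 / x $ 1, 0]"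
      using x1 x3 by (simp add: vec3_eq_iff)
    then have "u5 = x $ 1 *s (B *v vector [1, x $ 2 / x $ 1, 0])"
      using x vector_scalar_commute by metis
    then show "located B ?P5 (vector [1, x $ 2 / x $ 1, 0])"
      unfolding located_def u[symmetric] using Om(5) proportional_scale[OF x1] by metis
  qed
qed

text \<open>Eight further points are forced, each as the intersection of two lines through known points.
  Two incidences that were not used for this then give t^3 - t + 1 = 0 and 2 t = 0.\<close>

lemma root_of_frame:
  assumes B: "invertible B" and t: "t \<noteq> 0"
    and p4: "located B (el 2, el 4) (vector [1, 0, 0])"
    and p0: "located B (el 1, el 1) (vector [0, 1, 0])"
    and p6: "located B (el 2, el 6) (vector [0, 0, 1])"
    and p11: "located B (el 3, el 6) (vector [1, 1, 1])"
    and p21: "located B (el 6, el 3) (vector [1, t, 0])"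
  shows "gf8_root t"
proof -
  \<comment> \<open>The number in a name such as \<open>p13\<close> is the position of the point,
    counted from 0, in the list of \<open>Om_cases\<close>; the facts \<open>g0\<close> to
    \<open>g27\<close> of \<open>standard_form\<close> follow the same rule.\<close>
  have p13: "located B (el 4, el 3) (vector [0, 1, 1])"
    by (rule meet[OF B _ p0 p6 p4 p11, of "(el 4, el 2)" "(el 4, el 7)"])
      (simp_all add: unital_simps zero_gf8_def vec3_eq_iff dot3_def algebra_simps power2_eq_square)
  have p19: "located B (el 5, el 6) (vector [1, 1, 0])"
    by (rule meet[OF B _ p6 p11 p4 p0, of "(el 0, el 7)" "(el 4, el 6)"])
      (simp_all add: unital_simps zero_gf8_def vec3_eq_iff dot3_def algebra_simps power2_eq_square)
  have p7: "located B (el 2, el 7) (vector [1 - t, 0, - t])"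
    by (rule meet[OF B _ p11 p21 p4 p6, of "(el 5, el 5)" "(el 3, el 0)"])
      (simp_all add: unital_simps zero_gf8_def vec3_eq_iff dot3_def algebra_simps power2_eq_square)
  have p12: "located B (el 4, el 2) (vector [t, 1, t])"
    by (rule meet[OF B _ p19 p7 p0 p11, of "(el 5, el 7)" "(el 6, el 4)"])
      (simp_all add: unital_simps zero_gf8_def vec3_eq_iff dot3_def algebra_simps power2_eq_square)
  have p3: "located B (el 1, el 7) (vector [1, t, t\<^sup>2])"
    by (rule meet[OF B _ p4 p12 p6 p21, of "(el 2, el 2)" "(el 5, el 6)"])
      (simp_all add: unital_simps zero_gf8_def vec3_eq_iff dot3_def algebra_simps power2_eq_square)
  have p26: "located B (el 7, el 4) (vector [0, 1, 1 + t])"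
    by (rule meet[OF B _ p0 p6 p11 p3, of "(el 4, el 2)" "(el 3, el 1)"])
      (simp_all add: unital_simps zero_gf8_def vec3_eq_iff dot3_def algebra_simps power2_eq_square)
  have p5: "located B (el 2, el 5) (vector [t, 0, - 1])"
    by (rule meet[OF B _ p4 p6 p12 p26, of "(el 3, el 0)" "(el 7, el 2)"])
      (simp_all add: unital_simps zero_gf8_def vec3_eq_iff dot3_def algebra_simps power2_eq_square)
  have p14: "located B (el 4, el 6) (vector [- t, t, 1])"
    by (rule meet[OF B _ p13 p12 p0 p5, of "(el 5, el 0)" "(el 6, el 2)"])
      (simp_all add: unital_simps zero_gf8_def vec3_eq_iff dot3_def algebra_simps power2_eq_square)
  have r1: "t ^ 3 + 1 = t"
  proof -
    let ?v = "(el 3, el 6)"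
    have v: "?v \<noteq> (0, 0)" by (simp add: zero_gf8_def)
    have i: "incd (el 5, el 6) ?v" "incd (el 1, el 7) ?v" "incd (el 2, el 5) ?v" "(el 5, el 6) \<noteq> (el 1, el 7)"
      by (simp_all add: unital_simps)
    have "dot3 (crs (vector [1, 1, 0] :: 'f ^ 3) (vector [1, t, t\<^sup>2])) (vector [t, 0, - 1]) = 0"
      by (rule iffD2[OF collinear[OF B v p19 p3 i(4) i(1,2)] iffD2[OF located_dot3[OF p5 v] i(3)]])
    then show ?thesis
      by (simp add: dot3_def algebra_simps power2_eq_square power3_eq_cube)
  qed
  have r2: "t + t = 0"
  proof -
    let ?v = "(el 0, el 7)"
    have v: "?v \<noteq> (0, 0)" by (simp add: zero_gf8_def)
    have i: "incd (el 2, el 6) ?v" "incd (el 3, el 6) ?v" "incd (el 4, el 6) ?v" "(el 2, el 6) \<noteq> (el 3, el 6)"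
      by (simp_all add: unital_simps)
    have "dot3 (crs (vector [0, 0, 1] :: 'f ^ 3) (vector [1, 1, 1])) (vector [- t, t, 1]) = 0"
      by (rule iffD2[OF collinear[OF B v p6 p11 i(4) i(1,2)] iffD2[OF located_dot3[OF p14 v] i(3)]])
    then show ?thesis
      by (simp add: dot3_def algebra_simps power2_eq_square power3_eq_cube)
  qed
  have "2 * t = 0" using r2 unfolding mult_2 .
  then have two: "(2::'f) = 0" using t by simp
  have "t ^ 3 + t + 1 = (t ^ 3 + 1) + t" by (simp add: algebra_simps)
  also have "\<dots> = 0" by (simp only: r1 r2)
  finally show ?thesis using two by unfold_locales
qed

end

lemma Om_cases:
  assumes "P \<in> Om"
  shows "P \<in> {(el 1, el 1), (el 1, el 3), (el 1, el 5), (el 1, el 7), (el 2, el 4), (el 2, el 5), (el 2, el 6), (el 2, el 7), (el 3, el 1), (el 3, el 3), (el 3, el 4), (el 3, el 6), (el 4, el 2), (el 4, el 3), (el 4, el 6), (el 4, el 7), (el 5, el 1), (el 5, el 2), (el 5, el 5), (el 5, el 6), (el 6, el 2), (el 6, el 3), (el 6, el 4), (el 6, el 5), (el 7, el 1), (el 7, el 2), (el 7, el 4), (el 7, el 7)}"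
proof -
  obtain a c where P: "P = (a, c)" by (cases P)
  have "trace1 (a * c)" using assms by (simp add: P Om_def)
  then show ?thesis
    unfolding P
    by (cases a rule: gf8_exhaust8; cases c rule: gf8_exhaust8; simp add: trace1_GF8)
qed

lemma (in unital_rep) standard_form:
  obtains A \<zeta> where "invertible A" "gf8_root \<zeta>" "\<And>P. P \<in> Om \<Longrightarrow> proportional (w P) (A *v ptv \<zeta> P)"
    "\<And>v. v \<noteq> (0, 0) \<Longrightarrow> proportional (m v v* A) (lnv \<zeta> v)"
proof -
  obtain B t where B: "invertible B" and t: "t \<noteq> 0" and F:
    "located B (el 2, el 4) (vector [1, 0, 0])"
    "located B (el 1, el 1) (vector [0, 1, 0])"
    "located B (el 2, el 6) (vector [0, 0, 1])"
    "located B (el 3, el 6) (vector [1, 1, 1])"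
    "located B (el 6, el 3) (vector [1, t, 0])"
    by (rule exists_frame)
  interpret gf8_root t by (rule root_of_frame[OF B t F])
  \<comment> \<open>\<open>T\<close> takes the affine coordinates of the five points to multiples of their frame coordinates.\<close>
  define T :: "'f ^ 3 ^ 3" where "T = vector [vector [\<sigma> (el 1), \<sigma> (el 7), \<sigma> (el 6)],
    vector [\<sigma> (el 1), \<sigma> (el 0), \<sigma> (el 2)], vector [\<sigma> (el 3), \<sigma> (el 1), \<sigma> (el 2)]]"
  have Tv: "T *v ptv t P = vector [\<sigma> (el 1 * fst P + el 7 * snd P + el 6),
      \<sigma> (el 1 * fst P + el 0 * snd P + el 2), \<sigma> (el 3 * fst P + el 1 * snd P + el 2)]" for P
    by (simp add: T_def ptv_def vec3_eq_iff matrix_vector_mult_def sum_3 hom_add hom_mult del: el.simps)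
  \<comment> \<open>All entries are images under \<sigma>, so the determinant is the image of one in
    \<open>gf8\<close> and can be evaluated there.\<close>
  have "det T = \<sigma> (el 1 * el 0 * el 2 + el 7 * el 2 * el 3 + el 6 * el 1 * el 1
      + el 1 * el 2 * el 1 + el 7 * el 1 * el 2 + el 6 * el 0 * el 3)"
    by (simp add: T_def det_3 hom_add hom_mult del: el.simps)
  also have "\<dots> \<noteq> 0" unfolding hom_eq_0_iff by (simp add: zero_gf8_def)
  finally have T: "invertible T" by (simp add: invertible_det_nz)
  define A where "A = B ** T"
  have A: "invertible A" unfolding A_def using B T by (rule invertible_mult)
  define good where "good P \<longleftrightarrow> located A P (ptv t P)" for P
  have transfer: "good P" if "located B P y" "T *v ptv t P = c *s y" "c \<noteq> 0" for P y c
  proof -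
    have "A *v ptv t P = c *s (B *v y)"
      unfolding A_def by (simp add: that vector_scalar_commute flip: matrix_vector_mul_assoc)
    then have "proportional (B *v y) (A *v ptv t P)"
      using that(3) by (simp add: proportional_sym[OF proportional_scale])
    then show ?thesis
      using that(1) proportional_trans unfolding good_def located_def by blast
  qed
  \<comment> \<open>No coordinates have to be found any more: the vector of X given by
    \<open>ptv\<close> is on both lines by \<open>collinear_ptv\<close>, so membership of X follows
    from the combinatorics of the blocks.\<close>
  have step: "good X" if "meets u v X P Q R S" "good P" "good Q" "good R" "good S" for u v X P Q R S
    unfolding good_def
    by (rule meet[OF A that(1) that(2-5)[unfolded good_def] ptv_nonzero])
      (use that(1) in \<open>auto simp: meets_def intro: collinear_ptv\<close>)
  have g4: "good (el 2, el 4)"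
    by (rule transfer[OF F(1), of "\<sigma> (el 5)"]) (simp_all only: Tv hom_eq_0_iff,
      simp_all add: vec3_eq_iff phom_def zero_gf8_def power2_eq_square)
  have g0: "good (el 1, el 1)"
    by (rule transfer[OF F(2), of "\<sigma> (el 3)"]) (simp_all only: Tv hom_eq_0_iff,
      simp_all add: vec3_eq_iff phom_def zero_gf8_def power2_eq_square)
  have g6: "good (el 2, el 6)"
    by (rule transfer[OF F(3), of "\<sigma> (el 2)"]) (simp_all only: Tv hom_eq_0_iff,
      simp_all add: vec3_eq_iff phom_def zero_gf8_def power2_eq_square)
  have g11: "good (el 3, el 6)"
    by (rule transfer[OF F(4), of "\<sigma> (el 1)"]) (simp_all only: Tv hom_eq_0_iff,
      simp_all add: vec3_eq_iff phom_def zero_gf8_def power2_eq_square)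
  have g21: "good (el 6, el 3)"
    by (rule transfer[OF F(5), of "\<sigma> (el 2)"]) (simp_all only: Tv hom_eq_0_iff,
      simp_all add: vec3_eq_iff phom_def zero_gf8_def power2_eq_square)
  \<comment> \<open>The five known points generate the other 23, each as the intersection of two
    blocks through points reached before it.\<close>
  have g7: "good (el 2, el 7)"
    by (rule step[OF _ g11 g21 g4 g6, of "(el 5, el 5)" "(el 3, el 0)"]) (simp add: unital_simps zero_gf8_def)
  have g13: "good (el 4, el 3)"
    by (rule step[OF _ g0 g6 g4 g11, of "(el 4, el 2)" "(el 4, el 7)"]) (simp add: unital_simps zero_gf8_def)
  have g17: "good (el 5, el 2)"
    by (rule step[OF _ g0 g7 g6 g21, of "(el 2, el 6)" "(el 5, el 6)"]) (simp add: unital_simps zero_gf8_def)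
  have g1: "good (el 1, el 3)"
    by (rule step[OF _ g11 g17 g21 g13, of "(el 5, el 1)" "(el 0, el 4)"]) (simp add: unital_simps zero_gf8_def)
  have g2: "good (el 1, el 5)"
    by (rule step[OF _ g7 g13 g0 g1, of "(el 1, el 2)" "(el 1, el 0)"]) (simp add: unital_simps zero_gf8_def)
  have g3: "good (el 1, el 7)"
    by (rule step[OF _ g0 g1 g6 g21, of "(el 1, el 0)" "(el 5, el 6)"]) (simp add: unital_simps zero_gf8_def)
  have g5: "good (el 2, el 5)"
    by (rule step[OF _ g4 g6 g13 g17, of "(el 3, el 0)" "(el 7, el 7)"]) (simp add: unital_simps zero_gf8_def)
  have g8: "good (el 3, el 1)"
    by (rule step[OF _ g13 g3 g21 g5, of "(el 1, el 4)" "(el 1, el 5)"]) (simp add: unital_simps zero_gf8_def)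
  have g9: "good (el 3, el 3)"
    by (rule step[OF _ g11 g8 g21 g13, of "(el 4, el 0)" "(el 0, el 4)"]) (simp add: unital_simps zero_gf8_def)
  have g10: "good (el 3, el 4)"
    by (rule step[OF _ g11 g8 g13 g17, of "(el 4, el 0)" "(el 7, el 7)"]) (simp add: unital_simps zero_gf8_def)
  have g12: "good (el 4, el 2)"
    by (rule step[OF _ g7 g9 g4 g3, of "(el 5, el 7)" "(el 2, el 2)"]) (simp add: unital_simps zero_gf8_def)
  have g14: "good (el 4, el 6)"
    by (rule step[OF _ g13 g12 g0 g5, of "(el 5, el 0)" "(el 6, el 2)"]) (simp add: unital_simps zero_gf8_def)
  have g15: "good (el 4, el 7)"
    by (rule step[OF _ g0 g10 g6 g1, of "(el 2, el 4)" "(el 5, el 2)"]) (simp add: unital_simps zero_gf8_def)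
  have g16: "good (el 5, el 1)"
    by (rule step[OF _ g0 g8 g7 g1, of "(el 0, el 1)" "(el 1, el 6)"]) (simp add: unital_simps zero_gf8_def)
  have g18: "good (el 5, el 5)"
    by (rule step[OF _ g0 g9 g7 g10, of "(el 1, el 1)" "(el 3, el 7)"]) (simp add: unital_simps zero_gf8_def)
  have g19: "good (el 5, el 6)"
    by (rule step[OF _ g7 g9 g6 g11, of "(el 5, el 7)" "(el 0, el 7)"]) (simp add: unital_simps zero_gf8_def)
  have g20: "good (el 6, el 2)"
    by (rule step[OF _ g0 g10 g17 g12, of "(el 2, el 4)" "(el 0, el 3)"]) (simp add: unital_simps zero_gf8_def)
  have g22: "good (el 6, el 4)"
    by (rule step[OF _ g11 g2 g12 g16, of "(el 3, el 4)" "(el 2, el 3)"]) (simp add: unital_simps zero_gf8_def)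
  have g23: "good (el 6, el 5)"
    by (rule step[OF _ g13 g3 g6 g10, of "(el 1, el 4)" "(el 3, el 5)"]) (simp add: unital_simps zero_gf8_def)
  have g24: "good (el 7, el 1)"
    by (rule step[OF _ g0 g8 g4 g3, of "(el 0, el 1)" "(el 2, el 2)"]) (simp add: unital_simps zero_gf8_def)
  have g25: "good (el 7, el 2)"
    by (rule step[OF _ g6 g1 g0 g5, of "(el 5, el 2)" "(el 6, el 2)"]) (simp add: unital_simps zero_gf8_def)
  have g26: "good (el 7, el 4)"
    by (rule step[OF _ g0 g6 g4 g10, of "(el 4, el 2)" "(el 0, el 5)"]) (simp add: unital_simps zero_gf8_def)
  have g27: "good (el 7, el 7)"
    by (rule step[OF _ g6 g10 g4 g2, of "(el 3, el 5)" "(el 3, el 2)"]) (simp add: unital_simps zero_gf8_def)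
  have good: "good P" if "P \<in> Om" for P
    using Om_cases[OF that] g0 g1 g2 g3 g4 g5 g6 g7 g8 g9 g10 g11 g12 g13 g14 g15 g16 g17 g18 g19 g20 g21 g22 g23 g24 g25 g26 g27
    by (elim insertE emptyE) (simp_all only:)
  show thesis
  proof (rule that[OF A])
    show "gf8_root t" by unfold_locales
    show "proportional (w P) (A *v ptv t P)" if "P \<in> Om" for P
      using good[OF that] by (simp add: good_def located_def)
    show "proportional (m v v* A) (lnv t v)" if v: "v \<noteq> (0, 0)" for v
    proof -
      obtain P Q where PQ: "P \<in> Om" "Q \<in> Om" "P \<noteq> Q" "incd P v" "incd Q v"
        by (rule two_points_on_block[OF v])
      have g: "located A P (ptv t P)" "located A Q (ptv t Q)" using good PQ by (simp_all add: good_def)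
      have "proportional (lnv t v) (crs (ptv t P) (ptv t Q))"
        by (rule orthogonal_proportional)
          (simp_all add: dot3_lnv_ptv dot3_commute[of "ptv t _"] PQ lnv_nonzero v located_crs[OF g PQ(3)])
      then show ?thesis
        using block_line[OF A v g PQ(3-5)] proportional_trans proportional_sym by blast
    qed
  qed
qed

subsection \<open>Embeddings in standard form\<close>

definition blk :: "gf8 \<times> gf8 \<Rightarrow> (gf8 \<times> gf8) set" where
  "blk v = {P \<in> Om. incd P v}"

text \<open>An identification of D with the affine model. The results on embeddings use the Ree
  unital through this predicate only.\<close>

definition coordinates :: "(gf8 \<times> gf8 \<Rightarrow> 'p) \<Rightarrow> ('p, 'p set) incidence_structure \<Rightarrow> bool" where
  "coordinates p D \<longleftrightarrow> bij_betw p Om (pts D) \<and> blks D = {p ` blk v | v. v \<noteq> (0, 0)} \<and> inc D = (\<in>)"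

lemma proportional_map_lperp:
  assumes A: "invertible (A :: 'f::field ^ 3 ^ 3)" and "proportional (l v* A) n"
  shows "lperp l = (*v) A ` lperp n"
proof -
  have "(*v) A ` lperp n = (*v) A ` lperp (l v* A)"
    using proportional_lperp[OF assms(2)] by simp
  also have "\<dots> = lperp l"
    using A by (simp add: matrix_image_lperp vector_matrix_mul_assoc matrix_inv_inverse)
  finally show ?thesis ..
qed

lemma embedding_standard_form:
  fixes \<phi> :: "'p \<Rightarrow> ('f::field ^ 3) set"
  assumes co: "coordinates p D" and emb: "embedding D PG2 \<phi> \<psi>"
  obtains A \<zeta> where "invertible A" "gf8_root \<zeta>"
    "\<And>P. P \<in> Om \<Longrightarrow> \<phi> (p P) = (*v) A ` vec.span {ptv \<zeta> P}"
    "\<And>v. v \<noteq> (0, 0) \<Longrightarrow> \<psi> (p ` blk v) = (*v) A ` lperp (lnv \<zeta> v)"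
proof -
  have p: "bij_betw p Om (pts D)" and blks: "blks D = {p ` blk v | v. v \<noteq> (0, 0)}" and inc: "inc D = (\<in>)"
    using co by (simp_all add: coordinates_def)
  have pP: "p P \<in> pts D" if "P \<in> Om" for P using bij_betw_apply[OF p that] .
  have pinj: "inj_on p Om" using p by (rule bij_betw_imp_inj_on)
  have bB: "p ` blk v \<in> blks D" if "v \<noteq> (0, 0)" for v using that unfolding blks by blast
  have e1: "\<phi> ` pts D \<subseteq> pts PG2" and e2: "\<psi> ` blks D \<subseteq> blks PG2" and e3: "inj_on \<phi> (pts D)"
    and e4: "\<And>P B. P \<in> pts D \<Longrightarrow> B \<in> blks D \<Longrightarrow> P \<in> B \<longleftrightarrow> \<phi> P \<subseteq> \<psi> B"
    using emb unfolding embedding_def inc inc_PG2 by simp_all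
  have "\<exists>u. u \<noteq> 0 \<and> \<phi> (p P) = vec.span {u}" if "P \<in> Om" for P
  proof -
    have "\<phi> (p P) \<in> pts PG2" using e1 pP[OF that] by (simp add: image_subset_iff)
    then show ?thesis unfolding pts_PG2 by blast
  qed
  then obtain w where w: "\<And>P. P \<in> Om \<Longrightarrow> w P \<noteq> 0 \<and> \<phi> (p P) = vec.span {w P}" by metis
  have "\<exists>l. l \<noteq> 0 \<and> \<psi> (p ` blk v) = lperp l" if "v \<noteq> (0, 0)" for v
  proof -
    have "\<psi> (p ` blk v) \<in> blks PG2" using e2 bB[OF that] by (simp add: image_subset_iff)
    then show ?thesis unfolding blks_PG2 by blast
  qed
  then obtain m where m: "\<And>v. v \<noteq> (0, 0) \<Longrightarrow> m v \<noteq> 0 \<and> \<psi> (p ` blk v) = lperp (m v)" by metis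
  interpret unital_rep w m
  proof
    fix P Q v
    show "P \<in> Om \<Longrightarrow> w P \<noteq> 0" using w by simp
    show "v \<noteq> (0, 0) \<Longrightarrow> m v \<noteq> 0" using m by simp
    show "\<not> proportional (w P) (w Q)" if "P \<in> Om" "Q \<in> Om" "P \<noteq> Q"
    proof
      assume "proportional (w P) (w Q)"
      then have "\<phi> (p P) = \<phi> (p Q)" using w that span_eq_iff[of "w P" "w Q"] by simp
      then have "p P = p Q" using inj_onD[OF e3] pP that by simp
      then show False using inj_onD[OF pinj] that by simp
    qed
    show "incd P v \<longleftrightarrow> dot3 (m v) (w P) = 0" if "P \<in> Om" "v \<noteq> (0, 0)"
    proof -
      have "incd P v \<longleftrightarrow> P \<in> blk v" using that by (simp add: blk_def)
      also have "\<dots> \<longleftrightarrow> p P \<in> p ` blk v"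
        using inj_on_image_mem_iff[OF pinj, of P "blk v"] that by (auto simp: blk_def)
      also have "\<dots> \<longleftrightarrow> vec.span {w P} \<subseteq> lperp (m v)"
        using e4[OF pP bB] that w[of P] m[of v] by simp
      finally show ?thesis by (simp add: span_subset_lperp_iff)
    qed
  qed
  obtain A \<zeta> where A: "invertible A" "gf8_root \<zeta>" "\<And>P. P \<in> Om \<Longrightarrow> proportional (w P) (A *v ptv \<zeta> P)"
    "\<And>v. v \<noteq> (0, 0) \<Longrightarrow> proportional (m v v* A) (lnv \<zeta> v)" by (rule standard_form) (rule that)
  show thesis
  proof (rule that[OF A(1,2)])
    fix P assume P: "P \<in> Om"
    have "A *v ptv \<zeta> P \<noteq> 0"
      using gf8_root.ptv_nonzero[OF A(2)] A(1) by (simp add: matrix_eq_0_iff)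
    then show "\<phi> (p P) = (*v) A ` vec.span {ptv \<zeta> P}"
      using A(3)[OF P] w[OF P] by (simp add: matrix_image_span span_eq_iff)
  next
    fix v :: "gf8 \<times> gf8" assume v: "v \<noteq> (0, 0)"
    show "\<psi> (p ` blk v) = (*v) A ` lperp (lnv \<zeta> v)"
      using proportional_map_lperp[OF A(1) A(4)[OF v]] m[OF v] by simp
  qed
qed

context gf8_root
begin

lemma is_subfield_range: "is_subfield (range \<sigma>)"
  unfolding is_subfield_def
proof (intro conjI ballI)
  show "0 \<in> range \<sigma>" "1 \<in> range \<sigma>" by (metis hom_0 rangeI, metis hom_1 rangeI)
  fix x assume "x \<in> range \<sigma>"
  then obtain a where a: "x = \<sigma> a" by blast
  show "- x \<in> range \<sigma>" using a by simp
  show "inverse x \<in> range \<sigma>" using a hom_inverse[of a] by (metis rangeI)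
  fix y assume "y \<in> range \<sigma>"
  then obtain b where b: "y = \<sigma> b" by blast
  show "x + y \<in> range \<sigma>" using a b hom_add by (metis rangeI)
  show "x * y \<in> range \<sigma>" using a b hom_mult by (metis rangeI)
qed

lemma card_range: "card (range \<sigma>) = 8"
  using card_image[OF hom_inj] by (simp add: card_gf8)

lemma ptv_vecs: "ptv \<zeta> P \<in> vecs (range \<sigma>)"
  using is_subfield_range ptv_nonzero by (simp add: vecs_def forall_3 ptv_def is_subfield_def)

lemma lnv_vecs: "v \<noteq> (0, 0) \<Longrightarrow> lnv \<zeta> v \<in> vecs (range \<sigma>)"
  using lnv_nonzero by (simp add: vecs_def forall_3 lnv_def)

text \<open>The product of the first two coordinates is the square of s t, and square roots are
  unique in characteristic 2, so s t is multiplied by k as well. The third coordinate 1 + s t then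
  forces k = 1.\<close>

lemma proportional_lnv:
  assumes "proportional (lnv \<zeta> u) (lnv \<zeta> v)"
  shows "u = v"
proof -
  obtain k where k: "lnv \<zeta> u = k *s lnv \<zeta> v" using assms by (auto simp: proportional_def)
  let ?a = "\<sigma> (fst u)" and ?b = "\<sigma> (snd u)" and ?c = "\<sigma> (fst v)" and ?d = "\<sigma> (snd v)"
  have e: "?a\<^sup>2 = k * ?c\<^sup>2" "?b\<^sup>2 = k * ?d\<^sup>2" "1 + ?a * ?b = k * (1 + ?c * ?d)"
    using k by (simp_all add: lnv_def vec3_eq_iff hom_power hom_add hom_mult)
  have "(?a * ?b + k * (?c * ?d))\<^sup>2 = ?a\<^sup>2 * ?b\<^sup>2 + k\<^sup>2 * (?c\<^sup>2 * ?d\<^sup>2)"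
    by (simp add: square_add power_mult_distrib)
  also have "\<dots> = 0"
    unfolding e by (simp add: power2_eq_square ac_simps)
  finally have ab: "?a * ?b = k * (?c * ?d)"
    by (simp add: add_eq_0_iff)
  then have "k = 1" using e(3) by (simp add: distrib_left)
  then have "(?a + ?c)\<^sup>2 = 0" "(?b + ?d)\<^sup>2 = 0" using e by (simp_all add: square_add)
  then have "?a = ?c" "?b = ?d" by (simp_all add: add_eq_0_iff)
  then show ?thesis by (simp add: hom_eq_iff prod_eq_iff)
qed

end

text \<open>The equation in (s, t) is solved explicitly. For e = 0 it says a s^2 = c t^2; otherwise
  one sets one coordinate to 0 and takes a square root, or, if a or c is 0, prescribes one
  coordinate and solves a linear equation for the other.\<close>

lemma two_blocks_orthogonal:
  fixes a c e :: gf8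
  assumes "(a, c, e) \<noteq> (0, 0, 0)"
  obtains u v where "u \<noteq> (0, 0)" "v \<noteq> (0, 0)" "u \<noteq> v"
    "a * (fst u)\<^sup>2 + c * (snd u)\<^sup>2 + e * (1 + fst u * snd u) = 0"
    "a * (fst v)\<^sup>2 + c * (snd v)\<^sup>2 + e * (1 + fst v * snd v) = 0"
proof -
  \<comment> \<open>The square root: squaring three times is the identity on GF(8).\<close>
  define r :: "gf8 \<Rightarrow> gf8" where "r x = (x\<^sup>2)\<^sup>2" for x
  have r: "(r x)\<^sup>2 = x" for x by (simp only: r_def gf8_power8)
  have r0: "r x = 0 \<longleftrightarrow> x = 0" for x by (simp add: r_def)
  define g where "g = el 2"
  have g: "g \<noteq> 0" "g \<noteq> 1" by (simp_all add: g_def zero_gf8_def one_gf8_def)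
  consider "e = 0" | "e \<noteq> 0" "a \<noteq> 0" "c \<noteq> 0" | "e \<noteq> 0" "a = 0" | "e \<noteq> 0" "c = 0" by blast
  then show thesis
  proof cases
    case 1
    show thesis
      using assms 1 g
      by (intro that[of "(r c, r a)" "(g * r c, g * r a)"])
         (auto simp: r0 r power_mult_distrib ac_simps)
  next
    case 2
    show thesis
      using 2
      by (intro that[of "(r (e / a), 0)" "(0, r (e / c))"]) (auto simp: r0 r)
  next
    case 3
    have "c * t\<^sup>2 + e * (1 + (c * t\<^sup>2 + e) / (e * t) * t) = 0" if "t \<noteq> 0" for t
    proof -
      have "e * ((c * t\<^sup>2 + e) / (e * t) * t) = c * t\<^sup>2 + e" using that 3 by simp
      then have "c * t\<^sup>2 + e * (1 + (c * t\<^sup>2 + e) / (e * t) * t) = c * t\<^sup>2 + (e + (c * t\<^sup>2 + e))"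
        by (simp only: distrib_left mult_1_right)
      also have "\<dots> = (c * t\<^sup>2 + c * t\<^sup>2) + (e + e)" by (simp only: ac_simps)
      finally show ?thesis by simp
    qed
    from this[of 1] this[of g] show thesis
      using 3 g
      by (intro that[of "((c * 1\<^sup>2 + e) / (e * 1), 1)" "((c * g\<^sup>2 + e) / (e * g), g)"]) auto
  next
    case 4
    have "a * t\<^sup>2 + e * (1 + t * ((a * t\<^sup>2 + e) / (e * t))) = 0" if "t \<noteq> 0" for t
    proof -
      have "e * (t * ((a * t\<^sup>2 + e) / (e * t))) = a * t\<^sup>2 + e" using that 4 by simp
      then have "a * t\<^sup>2 + e * (1 + t * ((a * t\<^sup>2 + e) / (e * t))) = a * t\<^sup>2 + (e + (a * t\<^sup>2 + e))"
        by (simp only: distrib_left mult_1_right)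
      also have "\<dots> = (a * t\<^sup>2 + a * t\<^sup>2) + (e + e)" by (simp only: ac_simps)
      finally show ?thesis by simp
    qed
    from this[of 1] this[of g] show thesis
      using 4 g
      by (intro that[of "(1, (a * 1\<^sup>2 + e) / (e * 1))" "(g, (a * g\<^sup>2 + e) / (e * g))"]) auto
  qed
qed

text \<open>Two different embedded blocks meet in a point of E, and in \<open>PG2\<close> their
  intersection is unique, so it is the given point.\<close>

lemma (in gf8_root) plane_points_generated:
  assumes A: "invertible A" and E: "subplane E PG2"
    and lines: "\<And>v. v \<noteq> (0, 0) \<Longrightarrow> (*v) A ` lperp (lnv \<zeta> v) \<in> blks E"
  shows "pts (plane (range \<sigma>) A) \<subseteq> pts E"
proof
  fix P assume "P \<in> pts (plane (range \<sigma>) A)"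
  then obtain x where x: "P = (*v) A ` vec.span {x}" "x \<in> vecs (range \<sigma>)" by auto
  have "\<exists>b. x $ i = \<sigma> b" for i using x(2) by (auto simp: vecs_def)
  then obtain a c e where ace: "x $ 1 = \<sigma> a" "x $ 2 = \<sigma> c" "x $ 3 = \<sigma> e" by meson
  have "(a, c, e) \<noteq> (0, 0, 0)"
    using x(2) ace by (auto simp: vecs_def vec3_eq_iff)
  then obtain u v where uv: "u \<noteq> (0, 0)" "v \<noteq> (0, 0)" "u \<noteq> v"
    "a * (fst u)\<^sup>2 + c * (snd u)\<^sup>2 + e * (1 + fst u * snd u) = 0"
    "a * (fst v)\<^sup>2 + c * (snd v)\<^sup>2 + e * (1 + fst v * snd v) = 0"
    by (rule two_blocks_orthogonal)
  have d: "dot3 (lnv \<zeta> y) x = \<sigma> (a * (fst y)\<^sup>2 + c * (snd y)\<^sup>2 + e * (1 + fst y * snd y))" for y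
    by (simp add: dot3_def lnv_def ace hom_add hom_mult ac_simps)
  let ?L = "\<lambda>y. (*v) A ` lperp (lnv \<zeta> y)"
  have Pin: "P \<subseteq> ?L u" "P \<subseteq> ?L v"
    unfolding x(1) point_inc_line[OF is_subfield_UNIV A] by (simp_all add: d uv)
  have ne: "?L u \<noteq> ?L v"
    using line_eq_iff[OF is_subfield_UNIV A lnv_nonzero[OF uv(1)] lnv_nonzero[OF uv(2)]]
      proportional_lnv[of u v] uv(3) by blast
  have pp: "projective_plane E" and sub: "pts E \<subseteq> pts PG2" "blks E \<subseteq> blks PG2"
    and incE: "\<forall>P\<in>pts E. \<forall>l\<in>blks E. inc E P l \<longleftrightarrow> P \<subseteq> l"
    using E unfolding subplane_def inc_PG2 by simp_all
  obtain Q where Q: "Q \<in> pts E" "inc E Q (?L u)" "inc E Q (?L v)"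
    using ex1_implies_ex[OF pp[unfolded projective_plane_def, THEN conjunct2, THEN conjunct1,
        rule_format, OF lines[OF uv(1)] lines[OF uv(2)] ne]] by blast
  have Qin: "Q \<subseteq> ?L u" "Q \<subseteq> ?L v" using incE Q lines uv by blast+
  have PG: "P \<in> pts PG2" using x vecs_mono unfolding plane_UNIV[OF A, symmetric] by auto
  have "\<exists>!P. P \<in> pts PG2 \<and> P \<subseteq> ?L u \<and> P \<subseteq> ?L v"
    using plane_meet[OF is_subfield_UNIV A, unfolded plane_UNIV[OF A], OF _ _ ne]
      sub(2) lines[OF uv(1)] lines[OF uv(2)] by blast
  then have "P = Q" using PG Pin Qin sub(1) Q(1) by (elim ex1E) (metis subsetD)
  then show "P \<in> pts E" using Q by simp
qed

section \<open>Field automorphisms acting on the roots and on the unital\<close>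

lemma gf8_square_bij: "bij (\<lambda>x::gf8. x\<^sup>2)"
proof -
  have "inj (\<lambda>x::gf8. x\<^sup>2)"
    by (rule inj_on_inverseI[of _ "\<lambda>x. (x\<^sup>2)\<^sup>2"]) (rule gf8_power8)
  then show ?thesis by (simp only: bij_def finite_UNIV_inj_surj[OF finite] simp_thms)
qed

text \<open>Replacing the root by its square amounts to squaring in \<open>gf8\<close> before
  applying \<sigma>, and all roots arise by repeated squaring.\<close>

lemma (in gf8_root) root_change:
  assumes "gf8_root \<xi>"
  obtains f where "field_automorphism f" "\<And>x. phom \<xi> x = \<sigma> (f x)"
proof -
  have sq: "field_automorphism (\<lambda>x::gf8. x\<^sup>2)"
    using gf8_square_bij by (simp add: field_automorphism_def gf8_square_add power_mult_distrib)
  have id: "field_automorphism (\<lambda>x::gf8. x)"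
    by (simp add: field_automorphism_def flip: id_def)
  have sq2: "field_automorphism (\<lambda>x::gf8. (x\<^sup>2)\<^sup>2)"
    using bij_comp[OF gf8_square_bij gf8_square_bij] unfolding field_automorphism_def comp_def
    by (simp only: gf8_square_add power_mult_distrib simp_thms)
  have "phom ((\<zeta>\<^sup>2)\<^sup>2) x = \<sigma> ((x\<^sup>2)\<^sup>2)" for x
    by (simp only: gf8_root.hom_root_square[OF gf8_root_square] hom_root_square)
  then show thesis
    using roots[OF assms] that[OF sq] that[OF id] that[OF sq2] hom_root_square by metis
qed

context
  fixes f :: "gf8 \<Rightarrow> gf8"
  assumes f: "field_automorphism f"
begin

lemmas aut_simps = field_automorphism_simps[OF f]

lemma gf8_aut_eq_1: "f x = 1 \<longleftrightarrow> x = 1"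
  using aut_simps(4,8) by (metis bij_pointE)

lemma trace1_aut: "trace1 (f x) \<longleftrightarrow> trace1 x"
proof -
  have "f x + (f x)\<^sup>2 + ((f x)\<^sup>2)\<^sup>2 = f (x + x\<^sup>2 + (x\<^sup>2)\<^sup>2)"
    by (simp only: aut_simps(1,2,7))
  then show ?thesis by (simp only: trace1_def gf8_aut_eq_1)
qed

lemma incd_aut: "incd (map_prod f f P) (map_prod f f v) \<longleftrightarrow> incd P v"
proof -
  have "f (fst P) * (f (fst v))\<^sup>2 + f (fst v) * f (snd v) + f (snd P) * (f (snd v))\<^sup>2
    = f (fst P * (fst v)\<^sup>2 + fst v * snd v + snd P * (snd v)\<^sup>2)"
    by (simp only: aut_simps(1,2,7))
  then show ?thesis by (simp only: incd_def fst_map_prod snd_map_prod gf8_aut_eq_1)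
qed

lemma map_prod_bij: "bij (map_prod f f)"
  using aut_simps(8) unfolding bij_def by (simp add: prod.inj_map map_prod_surj)

lemma Om_aut_iff: "map_prod f f P \<in> Om \<longleftrightarrow> P \<in> Om"
  unfolding Om_def by (simp flip: aut_simps(2) add: trace1_aut)

lemma image_aut:
  assumes "\<And>P. Q (map_prod f f P) \<longleftrightarrow> R P"
  shows "map_prod f f ` {P. R P} = {P. Q P}"
proof
  show "map_prod f f ` {P. R P} \<subseteq> {P. Q P}" using assms by auto
  show "{P. Q P} \<subseteq> map_prod f f ` {P. R P}"
  proof
    fix P assume "P \<in> {P. Q P}"
    moreover obtain P' where "P = map_prod f f P'" using map_prod_bij by (metis bij_pointE)
    ultimately show "P \<in> map_prod f f ` {P. R P}" using assms by auto
  qed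
qed

lemma Om_aut: "map_prod f f ` Om = Om"
  using image_aut[of "\<lambda>P. P \<in> Om" "\<lambda>P. P \<in> Om"] Om_aut_iff by simp

lemma blk_aut: "map_prod f f ` blk v = blk (map_prod f f v)"
  unfolding blk_def by (rule image_aut) (simp only: Om_aut_iff incd_aut)

lemma nonzero_aut: "map_prod f f v \<noteq> (0, 0) \<longleftrightarrow> v \<noteq> (0, 0)"
  by (cases v) (simp add: aut_simps(9))

text \<open>The trace and the block equation have coefficients in the prime field, so applying f to
  both coordinates preserves points and incidence; p transports this action to D.\<close>

lemma coordinates_automorphism:
  assumes co: "coordinates p D"
  obtains a b where "automorphism D a b"
    "\<And>P. P \<in> Om \<Longrightarrow> a (p P) = p (map_prod f f P)"
    "\<And>v. v \<noteq> (0, 0) \<Longrightarrow> b (p ` blk v) = p ` blk (map_prod f f v)"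
proof -
  have p: "bij_betw p Om (pts D)" and blks: "blks D = {p ` blk v | v. v \<noteq> (0, 0)}" and inc: "inc D = (\<in>)"
    using co by (simp_all add: coordinates_def)
  have pinj: "inj_on p Om" using p by (rule bij_betw_imp_inj_on)
  have F: "bij_betw (map_prod f f) Om Om"
    using Om_aut map_prod_bij by (intro bij_betw_imageI) (auto intro: inj_on_subset simp: bij_def)
  define a where "a = p \<circ> map_prod f f \<circ> inv_into Om p"
  have a: "a (p P) = p (map_prod f f P)" if "P \<in> Om" for P
    using that by (simp add: a_def inv_into_f_f[OF pinj])
  have a_bij: "bij_betw a (pts D) (pts D)"
    unfolding a_def by (intro bij_betw_trans[OF bij_betw_inv_into[OF p]] bij_betw_trans[OF F] p)
  define b where "b = (`) a"
  have b: "b (p ` blk v) = p ` blk (map_prod f f v)" for v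
  proof -
    have "b (p ` blk v) = (\<lambda>P. a (p P)) ` blk v" by (simp add: b_def image_image)
    also have "\<dots> = (\<lambda>P. p (map_prod f f P)) ` blk v"
      by (rule image_cong) (auto simp: a blk_def)
    also have "\<dots> = p ` blk (map_prod f f v)" by (simp only: blk_aut[symmetric] image_image)
    finally show ?thesis .
  qed
  have sub: "B \<subseteq> pts D" if "B \<in> blks D" for B
    using that p unfolding blks bij_betw_def blk_def by blast
  have ainj: "inj_on a (pts D)" using a_bij by (rule bij_betw_imp_inj_on)
  have "bij_betw b (blks D) (blks D)"
  proof (rule bij_betw_imageI)
    show "inj_on b (blks D)"
      unfolding b_def using inj_on_image_eq_iff[OF ainj] sub by (intro inj_onI) blast
    show "b ` blks D = blks D"
    proof
      show "b ` blks D \<subseteq> blks D" unfolding blks using b nonzero_aut by blast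
      show "blks D \<subseteq> b ` blks D"
      proof
        fix B assume "B \<in> blks D"
        then obtain v where v: "B = p ` blk v" "v \<noteq> (0, 0)" unfolding blks by blast
        obtain u where u: "v = map_prod f f u" using map_prod_bij by (metis bij_pointE)
        then have "u \<noteq> (0, 0)" using v(2) nonzero_aut by blast
        moreover have "B = b (p ` blk u)" by (simp only: v(1) u b)
        ultimately show "B \<in> b ` blks D" unfolding blks by blast
      qed
    qed
  qed
  moreover have "P \<in> B \<longleftrightarrow> a P \<in> b B" if "P \<in> pts D" "B \<in> blks D" for P B
    unfolding b_def using inj_on_image_mem_iff[OF ainj that(1) sub[OF that(2)]] by simp
  ultimately have "automorphism D a b"
    using a_bij unfolding automorphism_def inc by blast
  then show thesis using that a b by blast
qed

end

lemma embedding_automorphism: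
  assumes emb: "embedding D E \<phi> \<psi>" and aut: "automorphism D a b"
  shows "embedding D E (\<phi> \<circ> a) (\<psi> \<circ> b)"
proof -
  have a: "bij_betw a (pts D) (pts D)" and b: "bij_betw b (blks D) (blks D)"
    and i: "\<forall>P\<in>pts D. \<forall>B\<in>blks D. inc D P B \<longleftrightarrow> inc D (a P) (b B)"
    using aut by (simp_all add: automorphism_def)
  have e: "\<phi> ` pts D \<subseteq> pts E" "\<psi> ` blks D \<subseteq> blks E" "inj_on \<phi> (pts D)" "inj_on \<psi> (blks D)"
    "\<forall>P\<in>pts D. \<forall>B\<in>blks D. inc D P B \<longleftrightarrow> inc E (\<phi> P) (\<psi> B)"
    using emb by (simp_all add: embedding_def)
  have im: "a ` pts D = pts D" "b ` blks D = blks D" "inj_on a (pts D)" "inj_on b (blks D)"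
    using a b by (simp_all add: bij_betw_def)
  show ?thesis
    unfolding embedding_def
  proof (intro conjI ballI)
    show "(\<phi> \<circ> a) ` pts D \<subseteq> pts E" "(\<psi> \<circ> b) ` blks D \<subseteq> blks E"
      using e(1,2) by (simp_all only: image_comp[symmetric] im)
    show "inj_on (\<phi> \<circ> a) (pts D)" "inj_on (\<psi> \<circ> b) (blks D)"
      using e(3,4) im by (intro comp_inj_on, simp_all)+
    fix P B assume PB: "P \<in> pts D" "B \<in> blks D"
    then have "a P \<in> pts D" "b B \<in> blks D" using im by blast+
    then show "inc D P B \<longleftrightarrow> inc E ((\<phi> \<circ> a) P) ((\<psi> \<circ> b) B)"
      using i e(5) PB by simp
  qed
qed

lemma (in gf8_root) ptv_change:
  assumes "\<And>x. phom \<xi> x = \<sigma> (f x)"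
  shows "ptv \<xi> P = ptv \<zeta> (map_prod f f P)"
  by (simp add: ptv_def assms)

lemma (in gf8_root) lnv_change:
  assumes "\<And>x. phom \<xi> x = \<sigma> (f x)" "field_automorphism f"
  shows "lnv \<xi> v = lnv \<zeta> (map_prod f f v)"
  by (simp add: lnv_def assms(1) field_automorphism_simps[OF assms(2)])

text \<open>Apart from 0 and 1 such an element is a seventh root of unity, so it or its inverse is
  one of the three roots. This makes \<open>x ^ 8 = x\<close> an intrinsic way to say that x lies in
  the copy of GF(8).\<close>

lemma (in gf8_root) power8_eq_self_imp_range:
  assumes "y ^ 8 = y" shows "y \<in> range \<sigma>"
proof (cases "y = 0 \<or> y = 1")
  case True
  then show ?thesis using hom_0 hom_1 by (metis rangeI)
next
  case False
  have "y * y ^ 7 = y * 1" using assms by (simp add: eval_nat_numeral)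
  then have "y ^ 7 = 1" using False by simp
  then have "gf8_root y \<or> gf8_root (inverse y)" using False by (intro char2_seventh_root char2) simp_all
  moreover have "z \<in> range \<sigma>" if "gf8_root z" for z
  proof -
    have "\<sigma> (el 2) = \<zeta>" by (simp add: phom_def)
    then have "\<zeta> = \<sigma> (el 2)" "\<zeta>\<^sup>2 = \<sigma> ((el 2)\<^sup>2)" "(\<zeta>\<^sup>2)\<^sup>2 = \<sigma> (((el 2)\<^sup>2)\<^sup>2)"
      by (simp_all only: hom_power)
    then show ?thesis using roots[OF that] by (metis rangeI)
  qed
  ultimately have "y \<in> range \<sigma> \<or> inverse y \<in> range \<sigma>" by blast
  then show ?thesis using is_subfield_range unfolding is_subfield_def by (metis inverse_inverse_eq)
qed

lemma (in gf8_root) automorphism_hom: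
  assumes s: "field_automorphism s"
  shows "s (\<sigma> x) = phom (s \<zeta>) x" "gf8_root (s \<zeta>)"
proof -
  note a = field_automorphism_simps[OF s]
  have "s (of_bool c) = of_bool c" for c by (cases c) (simp_all add: a)
  then show "s (\<sigma> x) = phom (s \<zeta>) x"
    by (cases x) (simp add: phom_def a)
  have "s \<zeta> ^ 3 + s \<zeta> + 1 = s (\<zeta> ^ 3 + \<zeta> + 1)" by (simp only: a(1,4,7))
  then show "gf8_root (s \<zeta>)" using char2 by unfold_locales (simp_all add: root a)
qed

text \<open>Since s moves an element of GF(8), it moves \<zeta>, and its restriction generates the
  automorphism group of GF(8), which has order 3. So one of the identity, s and its square sends
  \<zeta> to the given root.\<close>

lemma (in gf8_root) automorphism_changing_root:
  fixes s :: "'f \<Rightarrow> 'f"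
  assumes s: "field_automorphism s" and x: "x ^ 8 = x" "s x \<noteq> x" and \<xi>: "gf8_root \<xi>"
  obtains s' where "field_automorphism s'" "s' \<zeta> = \<xi>"
proof -
  obtain a where a: "x = \<sigma> a" using power8_eq_self_imp_range[OF x(1)] by blast
  have ne: "s \<zeta> \<noteq> \<zeta>" using automorphism_hom(1)[OF s, of a] x(2) a by auto
  have mult: "s (u * v) = s u * s v" for u v using s by (simp add: field_automorphism_def)
  have sq: "s (u\<^sup>2) = (s u)\<^sup>2" for u by (simp add: power2_eq_square mult)
  have id: "field_automorphism (\<lambda>x::'f. x)"
    by (simp add: field_automorphism_def flip: id_def)
  have ss: "field_automorphism (s \<circ> s)"
    using s bij_comp[of s s] by (simp add: field_automorphism_def)
  have p8: "((\<zeta>\<^sup>2)\<^sup>2)\<^sup>2 = \<zeta>"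
  proof -
    have e: "\<sigma> (el 2) = \<zeta>" by (simp add: phom_def)
    have "\<sigma> ((((el 2)\<^sup>2)\<^sup>2)\<^sup>2) = \<sigma> (el 2)" by (simp only: gf8_power8)
    then show ?thesis unfolding hom_power e .
  qed
  have "s \<zeta> = \<zeta>\<^sup>2 \<or> s \<zeta> = (\<zeta>\<^sup>2)\<^sup>2"
    using roots[OF automorphism_hom(2)[OF s]] ne by blast
  then have "(s \<zeta> = \<zeta>\<^sup>2 \<and> s (s \<zeta>) = (\<zeta>\<^sup>2)\<^sup>2) \<or> (s \<zeta> = (\<zeta>\<^sup>2)\<^sup>2 \<and> s (s \<zeta>) = \<zeta>\<^sup>2)"
  proof
    assume h: "s \<zeta> = \<zeta>\<^sup>2"
    then show ?thesis by (simp only: sq h simp_thms)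
  next
    assume h: "s \<zeta> = (\<zeta>\<^sup>2)\<^sup>2"
    then show ?thesis by (simp only: sq h p8 simp_thms)
  qed
  then show thesis
    using roots[OF \<xi>] that[OF id] that[OF s] that[OF ss] unfolding comp_def by metis
qed


section \<open>Consequences of the normal form: subplane, uniqueness and admissibility\<close>

locale standard_embedding = gf8_root \<zeta> for \<zeta> :: "'f::field" +
  fixes p :: "gf8 \<times> gf8 \<Rightarrow> 'p" and D :: "('p, 'p set) incidence_structure"
    and \<phi> :: "'p \<Rightarrow> ('f ^ 3) set" and \<psi> :: "'p set \<Rightarrow> ('f ^ 3) set" and A :: "'f ^ 3 ^ 3"
  assumes co: "coordinates p D" and A: "invertible A"
    and \<phi>: "\<And>P. P \<in> Om \<Longrightarrow> \<phi> (p P) = (*v) A ` vec.span {ptv \<zeta> P}"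
    and \<psi>: "\<And>v. v \<noteq> (0, 0) \<Longrightarrow> \<psi> (p ` blk v) = (*v) A ` lperp (lnv \<zeta> v)"
begin

lemma pts_D: "pts D = p ` Om" and blks_D: "blks D = {p ` blk v | v. v \<noteq> (0, 0)}"
  using co by (simp_all add: coordinates_def bij_betw_def)

lemma image_points: "\<phi> ` pts D \<subseteq> pts (plane (range \<sigma>) A)"
  unfolding pts_D plane_simps using \<phi> ptv_vecs by auto

lemma image_lines: "\<psi> ` blks D \<subseteq> blks (plane (range \<sigma>) A)"
  unfolding blks_D plane_simps using \<psi> lnv_vecs by auto

lemma finite_range: "finite (range \<sigma>)"
  by simp

lemma image_in_subplane:
  "\<exists>E. subplane E PG2 \<and> has_order E 8 \<and> \<phi> ` pts D \<subseteq> pts E \<and> \<psi> ` blks D \<subseteq> blks E"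
  using subplane_plane[OF is_subfield_range A] has_order_plane[OF is_subfield_range A finite_range]
    image_points image_lines unfolding card_range by blast

text \<open>The assertion on admissibility quantifies over every suitable E, so E has to be
  identified. The embedded blocks generate all points over the subfield, and the order of E leaves
  room for no others.\<close>

lemma subplane_eq:
  assumes E: "subplane E PG2" "has_order E 8" "\<psi> ` blks D \<subseteq> blks E"
  shows "pts E = pts (plane (range \<sigma>) A)" "blks E = blks (plane (range \<sigma>) A)"
proof -
  have "(*v) A ` lperp (lnv \<zeta> v) \<in> blks E" if v: "v \<noteq> (0, 0)" for v
  proof -
    have "p ` blk v \<in> blks D" using v unfolding blks_D by blast
    then have "\<psi> (p ` blk v) \<in> blks E" using E(3) by (simp only: image_subset_iff)
    then show ?thesis by (simp only: \<psi>[OF v])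
  qed
  then have sub: "pts (plane (range \<sigma>) A) \<subseteq> pts E"
    by (rule plane_points_generated[OF A E(1)])
  show "pts E = pts (plane (range \<sigma>) A)" "blks E = blks (plane (range \<sigma>) A)"
    using subplane_unique[OF is_subfield_range A finite_range E(1) _ sub] E(2) unfolding card_range by blast+
qed

end

lemma embedding_imp_standard:
  fixes \<phi> :: "'p \<Rightarrow> ('f::field ^ 3) set"
  assumes "coordinates p D" "embedding D PG2 \<phi> \<psi>"
  obtains A \<zeta> where "standard_embedding \<zeta> p D \<phi> \<psi> A"
proof -
  obtain A \<zeta> where A: "invertible A" "gf8_root \<zeta>"
    "\<And>P. P \<in> Om \<Longrightarrow> \<phi> (p P) = (*v) A ` vec.span {ptv \<zeta> P}"
    "\<And>v. v \<noteq> (0, 0) \<Longrightarrow> \<psi> (p ` blk v) = (*v) A ` lperp (lnv \<zeta> v)"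
    by (rule embedding_standard_form[OF assms]) (rule that)
  have "standard_embedding \<zeta> p D \<phi> \<psi> A"
    unfolding standard_embedding_def standard_embedding_axioms_def using A assms(1) by simp
  then show thesis by (rule that)
qed

context standard_embedding
begin

lemma embedding_unique:
  assumes "embedding D PG2 \<phi>' \<psi>'"
  shows "\<exists>a b. \<exists>M :: 'f ^ 3 ^ 3. automorphism D a b \<and> invertible M \<and>
    (\<forall>P\<in>pts D. \<phi>' P = (*v) M ` \<phi> (a P)) \<and> (\<forall>B\<in>blks D. \<psi>' B = (*v) M ` \<psi> (b B))"
proof -
  obtain A' \<zeta>' where "standard_embedding \<zeta>' p D \<phi>' \<psi>' A'"
    by (rule embedding_imp_standard[OF co assms])
  then interpret s': standard_embedding \<zeta>' p D \<phi>' \<psi>' A' .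
  obtain f where f: "field_automorphism f" "\<And>x. phom \<zeta>' x = \<sigma> (f x)"
    by (rule root_change[OF s'.gf8_root_axioms]) (rule that)
  obtain a b where ab: "automorphism D a b" "\<And>P. P \<in> Om \<Longrightarrow> a (p P) = p (map_prod f f P)"
    "\<And>v. v \<noteq> (0, 0) \<Longrightarrow> b (p ` blk v) = p ` blk (map_prod f f v)"
    by (rule coordinates_automorphism[OF f(1) co]) (rule that)
  \<comment> \<open>M carries the frame A to the frame A'. The change of root has already been
    absorbed by the automorphism a of the unital.\<close>
  define M where "M = A' ** matrix_inv A"
  have M: "invertible M"
    unfolding M_def by (rule invertible_mult[OF s'.A invertible_matrix_inv[OF A]])
  have MA: "(*v) M ` (*v) A ` X = (*v) A' ` X" for X
  proof -
    have "M *v (A *v x) = A' *v x" for x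
      unfolding M_def by (simp only: matrix_vector_mul_assoc[symmetric] matrix_inv_cancel[OF A])
    then show ?thesis by (simp add: image_image)
  qed
  have "\<phi>' P = (*v) M ` \<phi> (a P)" if h: "P \<in> pts D" for P
  proof -
    obtain Q where Q: "P = p Q" "Q \<in> Om" using h unfolding pts_D by blast
    then have Q': "map_prod f f Q \<in> Om" by (simp only: Om_aut_iff[OF f(1)])
    show ?thesis
      unfolding Q(1) ab(2)[OF Q(2)] \<phi>[OF Q'] s'.\<phi>[OF Q(2)] MA ptv_change[OF f(2)] ..
  qed
  moreover have "\<psi>' B = (*v) M ` \<psi> (b B)" if h: "B \<in> blks D" for B
  proof -
    obtain v where v: "B = p ` blk v" "v \<noteq> (0, 0)" using h unfolding blks_D by blast
    then have v': "map_prod f f v \<noteq> (0, 0)" using nonzero_aut[OF f(1)] by blast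
    show ?thesis
      unfolding v(1) ab(3)[OF v(2)] \<psi>[OF v'] s'.\<psi>[OF v(2)] MA lnv_change[OF f(2) f(1)] ..
  qed
  ultimately show ?thesis using ab(1) M by blast
qed

text \<open>Apply the normal form to \<phi> after a as well. Its root lies in the same subfield, and
  both coordinate planes contain all embedded blocks, so they coincide. The passage from one normal
  form to the other is then a semilinear collineation of this plane.\<close>

lemma admissible_subplane:
  assumes emb: "embedding D PG2 \<phi> \<psi>"
    and E: "subplane E PG2" "has_order E 8" "\<psi> ` blks D \<subseteq> blks E"
  shows "admissible D E \<phi>"
  unfolding admissible_def
proof (intro allI impI)
  fix a b assume ab: "automorphism D a b"
  let ?K = "range \<sigma>"
  obtain A' \<zeta>' where "standard_embedding \<zeta>' p D (\<phi> \<circ> a) (\<psi> \<circ> b) A'"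
    by (rule embedding_imp_standard[OF co embedding_automorphism[OF emb ab]])
  then interpret s': standard_embedding \<zeta>' p D "\<phi> \<circ> a" "\<psi> \<circ> b" A' .
  obtain f where f: "field_automorphism f" "\<And>x. phom \<zeta>' x = \<sigma> (f x)"
    by (rule root_change[OF s'.gf8_root_axioms]) (rule that)
  have fb: "bij f" using f(1) by (simp add: field_automorphism_def)
  have K': "range s'.\<sigma> = ?K"
  proof -
    have "s'.\<sigma> = (\<lambda>x. \<sigma> (f x))" using f(2) by (rule ext)
    then have "range s'.\<sigma> = \<sigma> ` range f" by (simp only: image_image)
    then show ?thesis using fb by (simp add: bij_def)
  qed
  have im: "\<psi> ` blks D \<subseteq> blks (plane ?K A')"
  proof -
    have "b ` blks D = blks D" using ab by (simp add: automorphism_def bij_betw_def)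
    then have "\<psi> ` blks D = (\<psi> \<circ> b) ` blks D" by (metis image_comp)
    then show ?thesis using s'.image_lines unfolding K' by simp
  qed
  have "subplane (plane ?K A') PG2" "has_order (plane ?K A') 8"
    using subplane_plane[OF is_subfield_range s'.A] has_order_plane[OF is_subfield_range s'.A finite_range]
    unfolding card_range by blast+
  from subplane_eq[OF this im] have eq: "plane ?K A' = plane ?K A"
    by (simp add: plane_def)
  \<comment> \<open>The automorphism of the subfield that takes the first root to the second. Its
    values outside the subfield are irrelevant.\<close>
  define s where "s y = s'.\<sigma> (inv_into UNIV \<sigma> y)" for y
  have s: "s (\<sigma> x) = s'.\<sigma> x" for x by (simp add: s_def inv_into_f_f[OF hom_inj])
  have sb: "bij_betw s ?K ?K"
  proof (rule bij_betw_imageI)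
    show "inj_on s ?K"
      by (rule inj_onI) (auto simp: s s'.hom_eq_iff)
    have "s ` ?K = range s'.\<sigma>" by (simp only: image_image s)
    then show "s ` ?K = ?K" by (simp only: K')
  qed
  have sa: "s (x + y) = s x + s y" and sm: "s (x * y) = s x * s y" if xy: "x \<in> ?K" "y \<in> ?K" for x y
  proof -
    obtain x' y' where "x = \<sigma> x'" "y = \<sigma> y'" using xy by blast
    then show "s (x + y) = s x + s y" "s (x * y) = s x * s y"
      by (simp_all only: s hom_add[symmetric] hom_mult[symmetric] s'.hom_add s'.hom_mult)
  qed
  obtain c d where cd: "automorphism (plane ?K A) c d"
    "\<forall>v\<in>vecs ?K. c ((*v) A ` vec.span {v}) = (*v) A' ` vec.span {vmap s v}"
    using plane_semilinear_map[OF is_subfield_range sb sa sm A s'.A eq] by blast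
  have "automorphism E c d"
  proof (rule automorphism_cong[THEN iffD2, OF _ _ _ cd(1)])
    show "pts E = pts (plane ?K A)" "blks E = blks (plane ?K A)" by (rule subplane_eq[OF E])+
    show "inc E P l \<longleftrightarrow> inc (plane ?K A) P l" if "P \<in> pts E" "l \<in> blks E" for P l
      using E(1) that by (simp add: subplane_def)
  qed
  moreover have "\<phi> (a P) = c (\<phi> P)" if h: "P \<in> pts D" for P
  proof -
    obtain Q where Q: "P = p Q" "Q \<in> Om" using h unfolding pts_D by blast
    have "vmap s (ptv \<zeta> Q) = ptv \<zeta>' Q"
      using s[of 1] by (simp add: vec3_eq_iff ptv_def s)
    then show ?thesis
      using bspec[OF cd(2) ptv_vecs[of Q]] s'.\<phi>[OF Q(2)] \<phi>[OF Q(2)] Q(1) by simp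
  qed
  ultimately show "\<exists>c d. automorphism E c d \<and> (\<forall>P\<in>pts D. \<phi> (a P) = c (\<phi> P))" by blast
qed

text \<open>The argument for the subplane with F in place of the subfield. The change of root now
  has to be made by an automorphism of F, which the hypothesis on s supplies.\<close>

lemma admissible_PG2:
  fixes s :: "'f \<Rightarrow> 'f"
  assumes emb: "embedding D PG2 \<phi> \<psi>"
    and s: "field_automorphism s" "x ^ 8 = x" "s x \<noteq> x"
  shows "admissible D PG2 \<phi>"
  unfolding admissible_def
proof (intro allI impI)
  fix a b assume ab: "automorphism D a b"
  obtain A' \<zeta>' where "standard_embedding \<zeta>' p D (\<phi> \<circ> a) (\<psi> \<circ> b) A'"
    by (rule embedding_imp_standard[OF co embedding_automorphism[OF emb ab]])
  then interpret s': standard_embedding \<zeta>' p D "\<phi> \<circ> a" "\<psi> \<circ> b" A' .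
  obtain s' where s': "field_automorphism s'" "s' \<zeta> = \<zeta>'"
    by (rule automorphism_changing_root[OF s s'.gf8_root_axioms])
  have b: "bij_betw s' UNIV UNIV" and add: "s' (x + y) = s' x + s' y" and mult: "s' (x * y) = s' x * s' y" for x y
    using s'(1) by (simp_all add: field_automorphism_def)
  have eq: "plane UNIV A' = plane UNIV A" by (simp only: plane_UNIV[OF A] plane_UNIV[OF s'.A])
  obtain c d where cd: "automorphism (plane UNIV A) c d"
    "\<forall>v\<in>vecs UNIV. c ((*v) A ` vec.span {v}) = (*v) A' ` vec.span {vmap s' v}"
    using plane_semilinear_map[OF is_subfield_UNIV b add mult A s'.A eq] by blast
  have "\<phi> (a P) = c (\<phi> P)" if h: "P \<in> pts D" for P
  proof -
    obtain Q where Q: "P = p Q" "Q \<in> Om" using h unfolding pts_D by blast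
    have h: "s' (\<sigma> x) = phom \<zeta>' x" for x using automorphism_hom(1)[OF s'(1)] s'(2) by simp
    have "vmap s' (ptv \<zeta> Q) = ptv \<zeta>' Q"
      using h[of 1] by (simp add: vec3_eq_iff ptv_def h)
    moreover have "ptv \<zeta> Q \<in> vecs UNIV" using ptv_nonzero by (simp add: vecs_def)
    ultimately show ?thesis
      using bspec[OF cd(2)] s'.\<phi>[OF Q(2)] \<phi>[OF Q(2)] Q(1) by simp
  qed
  then show "\<exists>c d. automorphism PG2 c d \<and> (\<forall>P\<in>pts D. \<phi> (a P) = c (\<phi> P))"
    using cd(1) unfolding plane_UNIV[OF A] by blast
qed

end

subsection \<open>Sylow 3-subgroups of a group acting on 28 points\<close>

locale set_action = group G for G (structure) +
  fixes X :: "'x set" and act :: "'a \<Rightarrow> 'x \<Rightarrow> 'x"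
  assumes act_closed: "g \<in> carrier G \<Longrightarrow> x \<in> X \<Longrightarrow> act g x \<in> X"
    and act_mult: "g \<in> carrier G \<Longrightarrow> h \<in> carrier G \<Longrightarrow> x \<in> X \<Longrightarrow> act (g \<otimes> h) x = act g (act h x)"
    and act_one: "x \<in> X \<Longrightarrow> act \<one> x = x"
begin

lemma act_inv: "g \<in> carrier G \<Longrightarrow> x \<in> X \<Longrightarrow> act (inv g) (act g x) = x"
  "g \<in> carrier G \<Longrightarrow> x \<in> X \<Longrightarrow> act g (act (inv g) x) = x"
  using act_mult[of "inv g" g x] act_mult[of g "inv g" x] act_one by simp_all

text \<open>The library's actions are homomorphisms into \<open>BijGroup X\<close>, whose elements
  are extensional, hence \<open>restrict\<close>. Stating it for a subgroup makes the orbit theorems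
  available for Sylow subgroups and for the whole group.\<close>

lemma restrict_action:
  assumes "subgroup H G"
  shows "group_action (G\<lparr>carrier := H\<rparr>) X (\<lambda>g. restrict (act g) X)"
proof -
  have H: "H \<subseteq> carrier G" using assms by (rule subgroup.subset)
  have bij: "bij_betw (act g) X X" if "g \<in> carrier G" for g
    using that act_closed act_inv
    by (intro bij_betw_byWitness[of X "act (inv g)"]) auto
  have Bij: "restrict (act g) X \<in> Bij X" if "g \<in> carrier G" for g
    using bij[OF that] by (simp add: Bij_def)
  have "(\<lambda>g. restrict (act g) X) \<in> hom (G\<lparr>carrier := H\<rparr>) (BijGroup X)"
  proof (rule homI)
    fix g h assume "g \<in> carrier (G\<lparr>carrier := H\<rparr>)" "h \<in> carrier (G\<lparr>carrier := H\<rparr>)"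
    then have gh: "g \<in> carrier G" "h \<in> carrier G" using H by auto
    have "restrict (act (g \<otimes> h)) X = compose X (restrict (act g) X) (restrict (act h) X)"
      by (rule ext) (simp add: compose_def restrict_def act_mult act_closed gh)
    then show "restrict (act (g \<otimes>\<^bsub>G\<lparr>carrier := H\<rparr>\<^esub> h)) X
        = restrict (act g) X \<otimes>\<^bsub>BijGroup X\<^esub> restrict (act h) X"
      using Bij gh by (simp add: BijGroup_def)
  qed (use Bij H in \<open>auto simp: BijGroup_def\<close>)
  then show ?thesis
    using subgroup.subgroup_is_group[OF assms group_axioms] group_BijGroup
    unfolding group_action_def group_hom_def group_hom_axioms_def by blast
qed

definition stab :: "'x \<Rightarrow> 'a set" where "stab x = {g \<in> carrier G. act g x = x}"

lemma stab_subgroup: "x \<in> X \<Longrightarrow> subgroup (stab x) G"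
proof (rule subgroupI)
  assume x: "x \<in> X"
  show "stab x \<subseteq> carrier G" by (auto simp: stab_def)
  show "stab x \<noteq> {}" using act_one[OF x] by (auto simp: stab_def)
  show "inv a \<in> stab x" if "a \<in> stab x" for a
    using that act_inv(1)[of a x] x by (auto simp: stab_def)
  show "a \<otimes> b \<in> stab x" if "a \<in> stab x" "b \<in> stab x" for a b
    using that act_mult[of a b x] x by (auto simp: stab_def)
qed

text \<open>The orbits of a group of order 27 have size 1 or a multiple of 3.\<close>

lemma order_27_fixes_point:
  assumes P: "subgroup P G" "card P = 27" and X: "finite X" "card X = 28"
  obtains x where "x \<in> X" "P \<subseteq> stab x"
proof -
  let ?P = "G\<lparr>carrier := P\<rparr>" and ?\<phi> = "\<lambda>g. restrict (act g) X"
  interpret P: group_action ?P X ?\<phi> by (rule restrict_action[OF P(1)])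
  have "\<exists>x\<in>X. orbit ?P ?\<phi> x = {x}"
  proof (rule ccontr)
    assume no: "\<not> (\<exists>x\<in>X. orbit ?P ?\<phi> x = {x})"
    have dvd3: "3 dvd card U" if U: "U \<in> orbits ?P X ?\<phi>" for U
    proof -
      obtain x where x: "x \<in> X" "U = orbit ?P ?\<phi> x" using U by (auto simp: orbits_def)
      have "card U * card (stabilizer ?P ?\<phi> x) = 27"
        using P.orbit_stabilizer_theorem[OF x(1)] P(2) x(2) by (simp add: order_def)
      then have "card U dvd 27" by (metis dvd_triv_left)
      then have "card U dvd 3 ^ 3" by simp
      then obtain i where i: "i \<le> 3" "card U = 3 ^ i"
        using divides_primepow_nat[of 3 "card U" 3] by auto
      have "i \<noteq> 0"
      proof
        assume "i = 0"
        then have "card U = 1" using i by simp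
        moreover have "x \<in> U" using P.orbit_refl[OF x(1)] x(2) by simp
        ultimately have "U = {x}" by (metis card_1_singletonE singletonD)
        then show False using no x by blast
      qed
      then show ?thesis using i by (simp add: dvd_power)
    qed
    have "3 dvd (\<Sum>U\<in>orbits ?P X ?\<phi>. \<Sum>x\<in>U. 1::nat)"
      by (rule dvd_sum) (simp add: dvd3)
    then have "3 dvd (28::nat)"
      unfolding P.disjoint_sum[OF X(1)] using X(2) by simp
    then show False by simp
  qed
  then obtain x where x: "x \<in> X" "orbit ?P ?\<phi> x = {x}" by blast
  have "act g x = x" if "g \<in> P" for g
    using x that by (auto simp: orbit_def)
  then have "P \<subseteq> stab x" using subgroup.subset[OF P(1)] by (auto simp: stab_def)
  then show thesis using that x(1) by blast
qed

end

lemma (in group) subgroup_pow_card: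
  assumes "subgroup H G" "g \<in> H"
  shows "g [^] card H = \<one>"
proof -
  interpret H: group "G\<lparr>carrier := H\<rparr>" by (rule subgroup.subgroup_is_group[OF assms(1) group_axioms])
  have "g [^]\<^bsub>G\<lparr>carrier := H\<rparr>\<^esub> card H = \<one>"
    using H.pow_order_eq_1[of g] assms(2) by (simp add: order_def)
  then show ?thesis by (simp add: nat_pow_def)
qed

text \<open>The cosets H and gH exhaust S, and a square of g in gH would put g into H.\<close>

lemma (in group) square_in_index_2:
  assumes H: "subgroup H G" "H \<subseteq> S" and S: "subgroup S G" "finite S" "card S = 2 * card H"
    and g: "g \<in> S"
  shows "g \<otimes> g \<in> H"
proof (cases "g \<in> H")
  case True then show ?thesis using subgroup.m_closed[OF H(1)] by blast
next
  case False
  have gc: "g \<in> carrier G" and Hc: "H \<subseteq> carrier G"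
    using g subgroup.subset[OF S(1)] subgroup.subset[OF H(1)] by auto
  let ?gH = "(\<lambda>h. g \<otimes> h) ` H"
  have fH: "finite H" using H(2) S(2) by (rule finite_subset)
  have gH_S: "?gH \<subseteq> S" using g H(2) subgroup.m_closed[OF S(1)] by auto
  have mem: "x \<in> H" if "h \<in> H" "x \<in> carrier G" "x \<otimes> h \<in> H" for x h
  proof -
    have "x = (x \<otimes> h) \<otimes> inv h" using that Hc by (simp add: subset_iff m_assoc)
    then show ?thesis using that H(1) by (metis subgroup.m_closed subgroup.m_inv_closed)
  qed
  have "H \<inter> ?gH = {}" using mem gc False by auto
  moreover have "card ?gH = card H"
    using gc Hc by (intro card_image inj_onI) (auto simp: subset_iff)
  ultimately have "card (H \<union> ?gH) = card S"
    using fH S(3) by (simp add: card_Un_disjoint)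
  then have "H \<union> ?gH = S"
    using gH_S H(2) by (intro card_subset_eq S(2)) auto
  moreover have "g \<otimes> g \<in> S" using g subgroup.m_closed[OF S(1)] by blast
  moreover have "g \<otimes> g \<notin> ?gH"
  proof
    assume "g \<otimes> g \<in> ?gH"
    then obtain h where "h \<in> H" "g \<otimes> g = g \<otimes> h" by blast
    then show False using False gc Hc by (auto simp: subset_iff)
  qed
  ultimately show ?thesis by blast
qed

lemma (in group) conj_pow:
  assumes "k \<in> carrier G" "g \<in> carrier G"
  shows "(k \<otimes> g \<otimes> inv k) [^] (n::nat) = k \<otimes> g [^] n \<otimes> inv k"
proof (induction n)
  case 0 then show ?case using assms by simp
next
  case (Suc n)
  have "(k \<otimes> g [^] n \<otimes> inv k) \<otimes> (k \<otimes> g \<otimes> inv k) = k \<otimes> g [^] n \<otimes> (inv k \<otimes> k) \<otimes> g \<otimes> inv k"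
    using assms by (simp add: m_assoc del: l_inv r_inv Units_l_inv)
  also have "\<dots> = k \<otimes> g [^] Suc n \<otimes> inv k" using assms by (simp add: m_assoc)
  finally show ?case using Suc by simp
qed

text \<open>Here 1512 = 28 * 54 and 54 = 2 * 27. The element h separates the points: it is a
  3-element with a single fixed point, so each conjugate of it recognises the point it
  fixes.\<close>

locale sylow_action = set_action +
  fixes h x0
  assumes order_G: "order G = 1512" and card_X: "card X = 28"
    and transitive: "x \<in> X \<Longrightarrow> y \<in> X \<Longrightarrow> \<exists>g\<in>carrier G. act g x = y"
    and h: "h \<in> carrier G" "h [^] (3::nat) = \<one>" "x0 \<in> X" "act h x0 = x0"
    and h_fix: "x \<in> X \<Longrightarrow> act h x = x \<Longrightarrow> x = x0"
begin

lemma finite_G: "finite (carrier G)" and finite_X: "finite X"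
  using order_G card_X by (auto simp: order_def intro: card_ge_0_finite)

lemma card_stab: 
  assumes x: "x \<in> X" shows "card (stab x) = 54"
proof -
  let ?\<phi> = "\<lambda>g. restrict (act g) X"
  have "G\<lparr>carrier := carrier G\<rparr> = G" by simp
  then interpret A: group_action G X ?\<phi> using restrict_action[OF subgroup_self] by simp
  have "orbit G ?\<phi> x = X"
    using x transitive act_closed by (auto simp: orbit_def)
  moreover have "stabilizer G ?\<phi> x = stab x"
    using x by (auto simp: stabilizer_def stab_def)
  ultimately have "28 * card (stab x) = 1512"
    using A.orbit_stabilizer_theorem[OF x] order_G card_X by simp
  then show ?thesis by simp
qed

text \<open>The Sylow 3-subgroup of the stabilizer, which is unique because its index there is 2.
  Described by an equation, it is compatible with conjugation at once.\<close>

definition pt :: "'c \<Rightarrow> 'a set" where "pt x = {g \<in> stab x. g [^] (27::nat) = \<one>}"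

lemma pt_sylow:
  assumes x: "x \<in> X" shows "subgroup (pt x) G" "card (pt x) = 27"
proof -
  let ?S = "stab x"
  have S: "subgroup ?S G" by (rule stab_subgroup[OF x])
  have fS: "finite ?S" using finite_G by (rule finite_subset[OF subgroup.subset[OF S]])
  \<comment> \<open>The arguments 3, 3, 2 express the order of the stabilizer as 3^3 * 2.\<close>
  have "\<exists>H. subgroup H (G\<lparr>carrier := ?S\<rparr>) \<and> card H = 3 ^ 3"
    using card_stab[OF x] fS
    by (intro sylow_thm[of 3 _ 3 2] subgroup.subgroup_is_group[OF S group_axioms]) (simp_all add: order_def)
  then obtain H where H: "subgroup H (G\<lparr>carrier := ?S\<rparr>)" "card H = 27" by auto
  have HG: "subgroup H G" by (rule incl_subgroup[OF S H(1)])
  have HS: "H \<subseteq> ?S" using subgroup.subset[OF H(1)] by simp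
  have "pt x = H"
  proof
    show "H \<subseteq> pt x"
    proof
      fix g assume "g \<in> H"
      then show "g \<in> pt x" using subgroup_pow_card[OF HG] H(2) HS by (auto simp: pt_def)
    qed
    show "pt x \<subseteq> H"
    proof
      fix g assume "g \<in> pt x"
      then have g: "g \<in> ?S" "g [^] (27::nat) = \<one>" by (auto simp: pt_def)
      then have gc: "g \<in> carrier G" using subgroup.subset[OF S] by blast
      \<comment> \<open>H has index 2, so it contains g^2 and hence g^26, which is the inverse of g
        because g^27 = 1.\<close>
      have "g \<otimes> g \<in> H"
        by (rule square_in_index_2[OF HG HS S fS _ g(1)]) (simp add: card_stab[OF x] H(2))
      then have "(g \<otimes> g) [^] n \<in> H" for n :: nat
        by (induction n) (simp_all add: subgroup.one_closed[OF HG] subgroup.m_closed[OF HG])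
      then have "(g \<otimes> g) [^] (13::nat) \<in> H" .
      moreover have "(g \<otimes> g) [^] (13::nat) = g [^] (26::nat)"
      proof -
        have "g \<otimes> g = g [^] (2::nat)" using gc by (simp add: numeral_2_eq_2)
        then show ?thesis using gc by (simp add: nat_pow_pow)
      qed
      ultimately have g26: "g [^] (26::nat) \<in> H" by simp
      have "g [^] (26::nat) \<otimes> g = g [^] (27::nat)"
        using gc by (metis nat_pow_Suc eval_nat_numeral(3))
      then have "g = inv (g [^] (26::nat))"
        using g(2) gc by (metis inv_equality inv_inv nat_pow_closed)
      then show "g \<in> H" using g26 HG by (metis subgroup.m_inv_closed)
    qed
  qed
  then show "subgroup (pt x) G" "card (pt x) = 27" using HG H(2) by simp_all
qed

lemma pt_conj:
  assumes k: "k \<in> carrier G" and x: "x \<in> X" and g: "g \<in> pt x"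
  shows "k \<otimes> g \<otimes> inv k \<in> pt (act k x)"
proof -
  have gc: "g \<in> carrier G" "act g x = x" "g [^] (27::nat) = \<one>" using g by (auto simp: pt_def stab_def)
  have "act (k \<otimes> g \<otimes> inv k) (act k x) = act k x"
    using k gc x by (simp add: act_mult act_inv act_closed)
  moreover have "(k \<otimes> g \<otimes> inv k) [^] (27::nat) = \<one>"
    using conj_pow[OF k gc(1)] gc(3) k by simp
  ultimately show ?thesis using k gc by (simp add: pt_def stab_def)
qed

text \<open>\<open>pt x\<close> contains a conjugate of h whose only fixed point is x, while all
  elements of \<open>pt y\<close> fix y.\<close>

lemma pt_inj: "inj_on pt X"
proof (rule inj_onI)
  fix x y assume xy: "x \<in> X" "y \<in> X" "pt x = pt y"
  obtain k where k: "k \<in> carrier G" "act k x0 = x" using transitive h(3) xy(1) by blast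
  have "h [^] (27::nat) = (h [^] (3::nat)) [^] (9::nat)" using h(1) by (simp add: nat_pow_pow)
  then have "h \<in> pt x0" using h by (simp add: pt_def stab_def)
  then have "k \<otimes> h \<otimes> inv k \<in> pt y" using pt_conj[OF k(1) h(3)] k(2) xy(3) by simp
  then have "act (k \<otimes> h \<otimes> inv k) y = y" by (simp add: pt_def stab_def)
  then have "act k (act h (act (inv k) y)) = y"
    using k h xy(2) by (simp add: act_mult act_closed)
  then have "act h (act (inv k) y) = act (inv k) y"
    using act_inv(1)[of k "act h (act (inv k) y)"] k h xy(2) by (simp add: act_closed)
  then have "act (inv k) y = x0" using h_fix k xy(2) act_closed by simp
  then have "y = act k x0" using act_inv(2)[OF k(1) xy(2)] by simp
  then show "x = y" using k by simp
qed

lemma sylow_eq: "sylow_subgroups 3 G = {H. subgroup H G \<and> card H = 27}"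
proof -
  have "multiplicity 3 (1512::nat) = 3" by (rule multiplicity_eqI) simp_all
  then show ?thesis by (simp add: sylow_subgroups_def order_G)
qed

lemma pt_bij: "bij_betw pt X (sylow_subgroups 3 G)"
proof (rule bij_betw_imageI[OF pt_inj])
  show "pt ` X = sylow_subgroups 3 G"
  proof
    show "pt ` X \<subseteq> sylow_subgroups 3 G" using pt_sylow by (auto simp: sylow_eq)
    show "sylow_subgroups 3 G \<subseteq> pt ` X"
    proof
      fix P assume "P \<in> sylow_subgroups 3 G"
      then have P: "subgroup P G" "card P = 27" by (auto simp: sylow_eq)
      obtain x where x: "x \<in> X" "P \<subseteq> stab x"
        by (rule order_27_fixes_point[OF P finite_X card_X])
      have "P \<subseteq> pt x" using subgroup_pow_card[OF P(1)] P(2) x(2) by (auto simp: pt_def)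
      moreover have "finite (pt x)" using pt_sylow(2)[OF x(1)] by (auto intro: card_ge_0_finite)
      ultimately have "P = pt x" using P(2) pt_sylow(2)[OF x(1)] by (intro card_subset_eq) simp_all
      then show "P \<in> pt ` X" using x(1) by blast
    qed
  qed
qed

lemma pt_conj_eq:
  assumes t: "t \<in> carrier G" and x: "x \<in> X"
  shows "t <# pt x #> inv t = pt (act t x)"
proof -
  have sub: "pt y \<subseteq> carrier G" for y by (auto simp: pt_def stab_def)
  have "t <# pt x #> inv t = (\<lambda>g. t \<otimes> g \<otimes> inv t) ` pt x"
    by (auto simp: l_coset_def r_coset_def)
  also have "\<dots> = pt (act t x)"
  proof
    show "(\<lambda>g. t \<otimes> g \<otimes> inv t) ` pt x \<subseteq> pt (act t x)" using pt_conj[OF t x] by auto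
    show "pt (act t x) \<subseteq> (\<lambda>g. t \<otimes> g \<otimes> inv t) ` pt x"
    proof
      fix g assume g: "g \<in> pt (act t x)"
      then have gc: "g \<in> carrier G" using sub by blast
      have "inv t \<otimes> g \<otimes> inv (inv t) \<in> pt (act (inv t) (act t x))"
        using t x by (intro pt_conj g inv_closed act_closed)
      then have "inv t \<otimes> g \<otimes> t \<in> pt x" using t x by (simp add: act_inv)
      moreover have "t \<otimes> (inv t \<otimes> g \<otimes> t) \<otimes> inv t = (t \<otimes> inv t) \<otimes> g \<otimes> (t \<otimes> inv t)"
        using t gc by (simp add: m_assoc del: r_inv l_inv Units_r_inv Units_l_inv)
      then have "g = t \<otimes> (inv t \<otimes> g \<otimes> t) \<otimes> inv t"
        using t gc by simp
      ultimately show "g \<in> (\<lambda>g. t \<otimes> g \<otimes> inv t) ` pt x" by blast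
    qed
  qed
  finally show ?thesis .
qed

lemma fixed_sylows_eq:
  assumes t: "t \<in> carrier G"
  shows "fixed_sylows 3 G t = pt ` {x \<in> X. act t x = x}"
proof -
  have "sylow_subgroups 3 G = pt ` X" using pt_bij by (simp add: bij_betw_def)
  moreover have "t <# pt x #> inv t = pt x \<longleftrightarrow> act t x = x" if "x \<in> X" for x
    using that pt_conj_eq[OF t that] act_closed[OF t that] pt_inj by (auto dest: inj_onD)
  ultimately show ?thesis by (auto simp: fixed_sylows_def)
qed

end

subsection \<open>Semilinear maps of the plane\<close>

text \<open>Multiplication by x permutes the nonzero elements; compare their products.\<close>

lemma finite_field_power_card_minus_1:
  fixes x :: "'k::{field,finite}"
  assumes "x \<noteq> 0" shows "x ^ (CARD('k) - 1) = 1"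
proof -
  let ?S = "UNIV - {0 :: 'k}"
  have "bij_betw ((*) x) ?S ?S"
    using assms by (intro bij_betw_byWitness[of _ "\<lambda>y. y / x"]) auto
  then have "(\<Prod>y\<in>?S. x * y) = (\<Prod>y\<in>?S. y)" by (rule prod.reindex_bij_betw)
  then have "x ^ card ?S * (\<Prod>y\<in>?S. y) = (\<Prod>y\<in>?S. y)" by (simp add: prod.distrib)
  moreover have "(\<Prod>y\<in>?S. y) \<noteq> 0" by simp
  ultimately have "x ^ card ?S = 1" by simp
  then show ?thesis by (simp add: card_Diff_subset)
qed

text \<open>Translation by 1 permutes the field, and comparing sums gives 8 = 0, hence 2 = 0. Any
  element other than 0 and 1 is then a seventh root of unity.\<close>

lemma card_8_imp_gf8_root:
  assumes "CARD('k::{field,finite}) = 8"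
  obtains z :: "'k::{field,finite}" where "gf8_root z"
proof -
  have "bij_betw (\<lambda>x::'k. x + 1) UNIV UNIV"
    by (intro bij_betw_byWitness[of _ "\<lambda>x. x - 1"]) auto
  then have "(\<Sum>x\<in>UNIV. x + 1 :: 'k) = (\<Sum>x\<in>UNIV. x)" by (rule sum.reindex_bij_betw)
  then have "of_nat CARD('k) = (0::'k)" by (simp add: sum.distrib)
  then have "(2::'k) ^ 3 = 0" using assms by simp
  then have two: "(2::'k) = 0" by (simp only: power_eq_0_iff)
  have "card {0, 1 :: 'k} < CARD('k)" using assms by simp
  then have "{0, 1 :: 'k} \<noteq> UNIV" by (metis less_irrefl)
  then obtain y :: 'k where y: "y \<noteq> 0" "y \<noteq> 1" by auto
  have "y ^ 7 = 1" using finite_field_power_card_minus_1[OF y(1)] assms by simp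
  then show thesis using that char2_seventh_root[OF two _ y(2)] by blast
qed

definition om2 :: "'k::field ^ 2 \<Rightarrow> 'k ^ 2 \<Rightarrow> 'k" where
  "om2 u v = u $ 1 * v $ 2 - u $ 2 * v $ 1"

lemma vec2_eq_iff: "(u :: 'k ^ 2) = v \<longleftrightarrow> u $ 1 = v $ 1 \<and> u $ 2 = v $ 2"
  by (simp add: vec_eq_iff forall_2)

lemma vec2_expand:
  fixes u :: "'k::field ^ 2"
  shows "u = u $ 1 *s vector [1, 0] + u $ 2 *s vector [0, 1]"
  by (simp add: vec2_eq_iff)

definition semilinear :: "('k::field ^ 2 \<Rightarrow> 'k ^ 2) \<Rightarrow> ('k \<Rightarrow> 'k) \<Rightarrow> bool" where
  "semilinear f s \<longleftrightarrow> bij f \<and> (\<forall>u v. f (u + v) = f u + f v) \<and>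
     field_automorphism s \<and> (\<forall>c v. f (c *s v) = s c *s f v)"

definition sf :: "('k::field ^ 2 \<Rightarrow> 'k ^ 2) \<Rightarrow> 'k \<Rightarrow> 'k" where
  "sf f = (SOME s. semilinear f s)"

text \<open>The determinant of f with respect to the unit vectors. For semilinear maps it is
  multiplicative only up to the companion automorphism \<open>sf f\<close>, see
  \<open>semilinear_comp\<close>.\<close>

definition Df :: "('k::field ^ 2 \<Rightarrow> 'k ^ 2) \<Rightarrow> 'k" where
  "Df f = om2 (f (vector [1, 0])) (f (vector [0, 1]))"

lemma in_GammaL: "f \<in> carrier GammaL \<longleftrightarrow> (\<exists>s. semilinear f s)"
  by (auto simp: GammaL_def semilinear_def)

lemma GammaL_simps [simp]: "mult GammaL = (\<circ>)" "one GammaL = id"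
  by (simp_all add: GammaL_def)

lemma semilinear_unique:
  assumes "semilinear f s" "semilinear f s'" shows "s = s'"
proof
  fix c
  have b: "bij f" and a: "f (0 + 0) = f 0 + f 0" and f: "\<And>c v. f (c *s v) = s c *s f v" "\<And>c v. f (c *s v) = s' c *s f v"
    using assms unfolding semilinear_def by blast+
  have "f 0 = 0" using a by simp
  moreover have "vector [1, 0] \<noteq> (0 :: 'a ^ 2)" by (simp add: vec2_eq_iff)
  ultimately have "f (vector [1, 0]) \<noteq> 0" using b by (metis bij_pointE)
  moreover have "s c *s f (vector [1, 0]) = s' c *s f (vector [1, 0])" using f by metis
  ultimately show "s c = s' c" by (auto simp: vec_eq_iff)
qed

lemma sf_semilinear: "f \<in> carrier GammaL \<Longrightarrow> semilinear f (sf f)"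
  unfolding in_GammaL sf_def by (erule someI_ex)

lemma sf_eq: "semilinear f s \<Longrightarrow> sf f = s"
  using semilinear_unique sf_semilinear in_GammaL by blast

lemma semilinear_simps:
  assumes "semilinear f s"
  shows "bij f" "f (u + v) = f u + f v" "field_automorphism s" "f (c *s v) = s c *s f v" "f 0 = 0"
proof -
  show a: "f (u + v) = f u + f v" for u v using assms by (simp add: semilinear_def)
  then show "f 0 = 0" using a[of 0 0] by simp
qed (use assms in \<open>simp_all add: semilinear_def\<close>)

lemma semilinear_expand:
  assumes "semilinear f s"
  shows "f u = s (u $ 1) *s f (vector [1, 0]) + s (u $ 2) *s f (vector [0, 1])"
  by (subst vec2_expand[of u]) (simp only: semilinear_simps(2,4)[OF assms])

lemma om2_semilinear:
  assumes "semilinear f s"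
  shows "om2 (f u) (f v) = Df f * s (om2 u v)"
proof -
  note s = field_automorphism_simps[OF semilinear_simps(3)[OF assms]]
  have c: "f w $ i = s (w $ 1) * f (vector [1, 0]) $ i + s (w $ 2) * f (vector [0, 1]) $ i" for w i
    using arg_cong[OF semilinear_expand[OF assms, of w], of "\<lambda>x. x $ i"] by simp
  show ?thesis
    unfolding om2_def Df_def s(6) s(2) c[of u] c[of v] by (simp add: algebra_simps)
qed

lemma Df_nonzero:
  assumes "semilinear f s" shows "Df f \<noteq> 0"
proof
  assume z: "Df f = 0"
  obtain u v where "f u = vector [1, 0]" "f v = vector [0, 1]"
    using semilinear_simps(1)[OF assms] by (metis bij_pointE)
  then have "om2 (vector [1, 0]) (vector [0, 1]) = (0 :: 'a)"
    using om2_semilinear[OF assms, of u v] z by simp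
  then show False by (simp add: om2_def)
qed

lemma semilinear_comp:
  assumes f: "semilinear f s" and g: "semilinear g t"
  shows "semilinear (f \<circ> g) (s \<circ> t)" "Df (f \<circ> g) = Df f * s (Df g)"
proof -
  note f' = semilinear_simps[OF f] and g' = semilinear_simps[OF g]
  note af = field_automorphism_simps[OF f'(3)] and ag = field_automorphism_simps[OF g'(3)]
  have "field_automorphism (s \<circ> t)"
    unfolding field_automorphism_def using bij_comp[OF ag(8) af(8)]
    by (simp only: comp_apply af(1,2) ag(1,2) simp_thms)
  then show "semilinear (f \<circ> g) (s \<circ> t)"
    unfolding semilinear_def using bij_comp[OF g'(1) f'(1)]
    by (simp only: comp_apply f'(2,4) g'(2,4) simp_thms)
  show "Df (f \<circ> g) = Df f * s (Df g)"
    unfolding Df_def comp_apply by (rule om2_semilinear[OF f, unfolded Df_def])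
qed

lemma semilinear_inv:
  assumes f: "semilinear f s"
  shows "semilinear (inv_into UNIV f) (inv_into UNIV s)"
proof -
  note sf = semilinear_simps[OF f]
  note af = field_automorphism_simps[OF sf(3)]
  let ?g = "inv_into UNIV f" and ?t = "inv_into UNIV s"
  have fg: "f (?g v) = v" for v using sf(1) by (simp add: bij_is_surj surj_f_inv_f)
  have gf: "?g (f v) = v" for v using sf(1) by (simp add: bij_is_inj inv_into_f_f)
  have st: "s (?t c) = c" for c using af(8) by (simp add: bij_is_surj surj_f_inv_f)
  have ts: "?t (s c) = c" for c using af(8) by (simp add: bij_is_inj inv_into_f_f)
  have "field_automorphism ?t"
    unfolding field_automorphism_def
  proof (intro conjI allI)
    show "bij ?t" using af(8) by (rule bij_imp_bij_inv)
    show "?t (x + y) = ?t x + ?t y" for x y by (metis af(1) st ts)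
    show "?t (x * y) = ?t x * ?t y" for x y by (metis af(2) st ts)
  qed
  moreover have "bij ?g" using sf(1) by (rule bij_imp_bij_inv)
  moreover have "?g (u + v) = ?g u + ?g v" for u v by (metis sf(2) fg gf)
  moreover have "?g (c *s v) = ?t c *s ?g v" for c v by (metis sf(4) fg gf st)
  ultimately show ?thesis by (simp add: semilinear_def)
qed

lemma semilinear_id: "semilinear id id"
  by (simp add: semilinear_def field_automorphism_id)

lemma group_GammaL: "group (GammaL :: ('k::field ^ 2 \<Rightarrow> 'k ^ 2) monoid)"
proof (rule groupI)
  fix f g h :: "'k ^ 2 \<Rightarrow> 'k ^ 2"
  show "f \<otimes>\<^bsub>GammaL\<^esub> g \<in> carrier GammaL" if "f \<in> carrier GammaL" "g \<in> carrier GammaL"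
    using that semilinear_comp(1)[of f _ g] unfolding in_GammaL GammaL_simps by blast
  show "\<one>\<^bsub>GammaL\<^esub> \<in> carrier (GammaL :: ('k ^ 2 \<Rightarrow> 'k ^ 2) monoid)"
    unfolding in_GammaL GammaL_simps using semilinear_id by blast
  show "\<exists>y\<in>carrier GammaL. y \<otimes>\<^bsub>GammaL\<^esub> f = \<one>\<^bsub>GammaL\<^esub>" if f: "f \<in> carrier GammaL"
  proof -
    obtain s where s: "semilinear f s" using f by (auto simp: in_GammaL)
    have "inv_into UNIV f \<circ> f = id" using semilinear_simps(1)[OF s] by (simp add: bij_is_inj)
    moreover have "inv_into UNIV f \<in> carrier GammaL"
      unfolding in_GammaL using semilinear_inv[OF s] by blast
    ultimately show ?thesis unfolding GammaL_simps by blast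
  qed
qed (simp_all add: comp_assoc)

lemma semilinear_scalar:
  assumes "c \<noteq> 0" shows "semilinear (\<lambda>v :: 'k::field ^ 2. c *s v) id"
proof -
  have "bij (\<lambda>v :: 'k ^ 2. c *s v)"
    using assms by (intro bij_betw_byWitness[of _ "\<lambda>v. inverse c *s v"]) (auto simp: vector_smult_assoc)
  then show ?thesis
    by (simp add: semilinear_def field_automorphism_id vector_add_ldistrib vector_smult_assoc mult.commute)
qed

lemma Df_scalar: "Df (\<lambda>v :: 'k::field ^ 2. c *s v) = c\<^sup>2"
  by (simp add: Df_def om2_def power2_eq_square)

text \<open>Moving a scalar c past a semilinear map turns it into s c, and s permutes the nonzero
  scalars.\<close>

lemma scalar_maps_normal: "normal scalar_maps (GammaL :: ('k::field ^ 2 \<Rightarrow> 'k ^ 2) monoid)"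
proof -
  interpret group "GammaL :: ('k ^ 2 \<Rightarrow> 'k ^ 2) monoid" by (rule group_GammaL)
  let ?N = "scalar_maps :: ('k ^ 2 \<Rightarrow> 'k ^ 2) set"
  have N: "n \<in> ?N \<longleftrightarrow> (\<exists>c. c \<noteq> 0 \<and> n = (\<lambda>v. c *s v))" for n by (auto simp: scalar_maps_def)
  have sub: "subgroup ?N GammaL"
  proof (rule subgroupI)
    show "?N \<subseteq> carrier GammaL" unfolding subset_iff N in_GammaL using semilinear_scalar by blast
    have "(\<lambda>v. 1 *s v) \<in> ?N" unfolding N by (intro exI[of _ 1]) simp
    then show "?N \<noteq> {}" by blast
  next
    fix a assume "a \<in> ?N"
    then obtain c where c: "c \<noteq> 0" "a = (\<lambda>v. c *s v)" by (auto simp: N)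
    have "inv\<^bsub>GammaL\<^esub> a = (\<lambda>v :: 'k ^ 2. inverse c *s v)"
    proof (rule inv_equality)
      show "(\<lambda>v :: 'k ^ 2. inverse c *s v) \<otimes>\<^bsub>GammaL\<^esub> a = \<one>\<^bsub>GammaL\<^esub>"
        using c by (auto simp: fun_eq_iff vector_smult_assoc)
      show "a \<in> carrier GammaL"
        unfolding in_GammaL c(2) using semilinear_scalar[OF c(1)] by blast
      show "(\<lambda>v :: 'k ^ 2. inverse c *s v) \<in> carrier GammaL"
        unfolding in_GammaL using semilinear_scalar[OF nonzero_imp_inverse_nonzero[OF c(1)]] by blast
    qed
    then show "inv\<^bsub>GammaL\<^esub> a \<in> ?N"
      unfolding N using c(1) nonzero_imp_inverse_nonzero by blast
  next
    fix a b assume "a \<in> ?N" "b \<in> ?N"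
    then obtain c d where "c \<noteq> 0" "a = (\<lambda>v. c *s v)" "d \<noteq> 0" "b = (\<lambda>v. d *s v)" by (auto simp: N)
    then show "a \<otimes>\<^bsub>GammaL\<^esub> b \<in> ?N"
      unfolding N by (intro exI[of _ "c * d"]) (auto simp: fun_eq_iff vector_smult_assoc)
  qed
  have "?N #>\<^bsub>GammaL\<^esub> f = f <#\<^bsub>GammaL\<^esub> ?N" if f: "f \<in> carrier GammaL" for f
  proof -
    obtain s where s: "semilinear f s" using f by (auto simp: in_GammaL)
    note a = field_automorphism_simps[OF semilinear_simps(3)[OF s]]
    have 1: "(\<lambda>v. s c *s v) \<circ> f = f \<circ> (\<lambda>v. c *s v)" for c
      using semilinear_simps(4)[OF s] by (auto simp: fun_eq_iff)
    have 2: "\<exists>c. s c = d" for d using a(8) by (metis bij_pointE)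
    show ?thesis
    proof
      show "?N #>\<^bsub>GammaL\<^esub> f \<subseteq> f <#\<^bsub>GammaL\<^esub> ?N"
      proof
        fix x assume "x \<in> ?N #>\<^bsub>GammaL\<^esub> f"
        then obtain d where d: "d \<noteq> 0" "x = (\<lambda>v. d *s v) \<circ> f" by (auto simp: r_coset_def N)
        obtain c where c: "s c = d" using 2 by blast
        then have "c \<noteq> 0" using d a(9) by auto
        then have "(\<lambda>v. c *s v) \<in> ?N" by (auto simp: N)
        moreover have "x = f \<circ> (\<lambda>v. c *s v)" using d c 1 by metis
        ultimately show "x \<in> f <#\<^bsub>GammaL\<^esub> ?N" by (auto simp: l_coset_def)
      qed
      show "f <#\<^bsub>GammaL\<^esub> ?N \<subseteq> ?N #>\<^bsub>GammaL\<^esub> f"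
      proof
        fix x assume "x \<in> f <#\<^bsub>GammaL\<^esub> ?N"
        then obtain c where c: "c \<noteq> 0" "x = f \<circ> (\<lambda>v. c *s v)" by (auto simp: l_coset_def N)
        then have "(\<lambda>v. s c *s v) \<in> ?N" using a(9) by (auto simp: N)
        moreover have "x = (\<lambda>v. s c *s v) \<circ> f" using c 1 by metis
        ultimately show "x \<in> ?N #>\<^bsub>GammaL\<^esub> f" by (auto simp: r_coset_def)
      qed
    qed
  qed
  then show ?thesis using sub by (intro normalI) auto
qed

subsection \<open>Action on quadratic forms\<close>

text \<open>Anisotropic quadratic forms with polar form \<open>om2\<close>, the intended case being
  characteristic 2, where an alternating form is symmetric. Prescribing the polar form selects one
  form from each class of proportional ones.\<close>

definition Qf :: "('k::field ^ 2 \<Rightarrow> 'k) set" where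
  "Qf = {q. (\<forall>c v. q (c *s v) = c\<^sup>2 * q v) \<and> (\<forall>u v. q (u + v) = q u + q v + om2 u v) \<and>
            (\<forall>v. v \<noteq> 0 \<longrightarrow> q v \<noteq> 0)}"

text \<open>The factor \<open>Df f\<close> keeps the polar form of the quadratic form equal to \<open>om2\<close>.\<close>

definition qact :: "('k::field ^ 2 \<Rightarrow> 'k ^ 2) \<Rightarrow> ('k ^ 2 \<Rightarrow> 'k) \<Rightarrow> 'k ^ 2 \<Rightarrow> 'k" where
  "qact f q w = Df f * sf f (q (inv_into UNIV f w))"

lemma qact_apply:
  assumes "semilinear f s" shows "qact f q (f v) = Df f * s (q v)"
  using semilinear_simps(1)[OF assms] by (simp add: qact_def sf_eq[OF assms] bij_is_inj inv_into_f_f)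

lemma qact_eqI:
  assumes f: "semilinear f s" and "\<And>v. Df f * s (q v) = q' (f v)"
  shows "qact f q = q'"
proof
  fix w
  obtain v where "w = f v" using semilinear_simps(1)[OF f] by (metis bij_pointE)
  then show "qact f q w = q' w" using qact_apply[OF f] assms(2) by simp
qed

lemma qact_closed:
  assumes f: "semilinear f s" and q: "q \<in> Qf" shows "qact f q \<in> Qf"
proof -
  note f' = semilinear_simps[OF f]
  note s = field_automorphism_simps[OF f'(3)]
  have q1: "q (c *s v) = c\<^sup>2 * q v" and q2: "q (u + v) = q u + q v + om2 u v"
    and q3: "v \<noteq> 0 \<Longrightarrow> q v \<noteq> 0" for c u v
    using q by (simp_all add: Qf_def)
  have surj: "\<exists>v. w = f v" for w using f'(1) by (metis bij_pointE)
  have "qact f q (c *s w) = c\<^sup>2 * qact f q w" for c w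
  proof -
    obtain v where v: "w = f v" using surj by blast
    obtain d where d: "c = s d" using s(8) by (metis bij_pointE)
    have "c *s w = f (d *s v)" by (simp only: v d f'(4))
    then show ?thesis
      unfolding v d by (simp only: qact_apply[OF f] q1 s(2,7) ac_simps)
  qed
  moreover have "qact f q (x + y) = qact f q x + qact f q y + om2 x y" for x y
  proof -
    obtain u v where uv: "x = f u" "y = f v" using surj by meson
    have "x + y = f (u + v)" by (simp only: uv f'(2))
    then show ?thesis
      unfolding uv by (simp only: qact_apply[OF f] q2 s(1) om2_semilinear[OF f] distrib_left)
  qed
  moreover have "qact f q w \<noteq> 0" if "w \<noteq> 0" for w
  proof -
    obtain v where v: "w = f v" using surj by blast
    then have "v \<noteq> 0" using that f'(5) by auto
    then show ?thesis
      unfolding v qact_apply[OF f] using Df_nonzero[OF f] q3 s(9) by simp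
  qed
  ultimately show ?thesis by (simp add: Qf_def)
qed

lemma qact_comp:
  assumes f: "semilinear f s" and g: "semilinear g t"
  shows "qact (f \<circ> g) q = qact f (qact g q)"
proof (rule qact_eqI[OF semilinear_comp(1)[OF f g]])
  note s = field_automorphism_simps[OF semilinear_simps(3)[OF f]]
  fix v
  show "Df (f \<circ> g) * (s \<circ> t) (q v) = qact f (qact g q) ((f \<circ> g) v)"
    by (simp only: comp_apply qact_apply[OF f] qact_apply[OF g] semilinear_comp(2)[OF f g] s(2) mult.assoc)
qed

text \<open>The determinant c^2 cancels the factor c^-2 that comes from homogeneity, so the action
  factors through the quotient by the scalars.\<close>

lemma qact_scalar:
  assumes "c \<noteq> 0" "q \<in> Qf" shows "qact (\<lambda>v. c *s v) q = q"
  using assms by (intro qact_eqI[OF semilinear_scalar]) (simp_all add: Df_scalar Qf_def)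

lemma qact_coset:
  assumes "f \<in> scalar_maps #>\<^bsub>GammaL\<^esub> g" "g \<in> carrier GammaL" "q \<in> Qf"
  shows "qact f q = qact g q"
proof -
  obtain c where c: "c \<noteq> 0" "f = (\<lambda>v. c *s v) \<circ> g" using assms(1) by (auto simp: r_coset_def scalar_maps_def)
  obtain s where s: "semilinear g s" using assms(2) by (auto simp: in_GammaL)
  show ?thesis
    unfolding c(2) qact_comp[OF semilinear_scalar[OF c(1)] s]
    by (rule qact_scalar[OF c(1) qact_closed[OF s assms(3)]])
qed

text \<open>The value does not depend on the representative of the coset as long as q is in
  \<open>Qf\<close>, by \<open>qact_coset\<close>.\<close>

definition cact :: "('k::field ^ 2 \<Rightarrow> 'k ^ 2) set \<Rightarrow> ('k ^ 2 \<Rightarrow> 'k) \<Rightarrow> 'k ^ 2 \<Rightarrow> 'k" where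
  "cact C q = qact (SOME f. f \<in> C) q"

lemma cact_eq:
  assumes C: "C \<in> carrier PGammaL" and f: "f \<in> C" and q: "q \<in> Qf"
  shows "cact C q = qact f q" "f \<in> carrier GammaL"
proof -
  interpret N: normal scalar_maps "GammaL :: ('a ^ 2 \<Rightarrow> 'a ^ 2) monoid" by (rule scalar_maps_normal)
  obtain g where g: "g \<in> carrier GammaL" "C = scalar_maps #>\<^bsub>GammaL\<^esub> g"
    using C by (auto simp: PGammaL_def FactGroup_def RCOSETS_def)
  show "f \<in> carrier GammaL"
    using f g N.rcosets_carrier[of C] C by (auto simp: PGammaL_def FactGroup_def)
  have "(SOME f. f \<in> C) \<in> C" by (rule someI[of "\<lambda>f. f \<in> C", OF f])
  then show "cact C q = qact f q"
    unfolding cact_def using qact_coset[OF _ g(1) q] f unfolding g(2) by metis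
qed

lemma PGammaL_nonempty: "C \<in> carrier (PGammaL :: ('k::field ^ 2 \<Rightarrow> 'k ^ 2) set monoid) \<Longrightarrow> \<exists>f. f \<in> C"
proof -
  interpret N: normal scalar_maps "GammaL :: ('k ^ 2 \<Rightarrow> 'k ^ 2) monoid" by (rule scalar_maps_normal)
  assume "C \<in> carrier PGammaL"
  then show ?thesis
    using N.rcos_self[OF _ N.subgroup_axioms] by (auto simp: PGammaL_def FactGroup_def RCOSETS_def)
qed

lemma PGammaL_mult_mem:
  assumes "f \<in> C" "g \<in> D" shows "f \<circ> g \<in> C \<otimes>\<^bsub>PGammaL\<^esub> D"
  using assms by (auto simp: PGammaL_def FactGroup_def set_mult_def)

lemma one_PGammaL: "\<one>\<^bsub>PGammaL\<^esub> = scalar_maps"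
  by (simp add: PGammaL_def FactGroup_def)

lemma cact_mult:
  assumes "C \<in> carrier PGammaL" "D \<in> carrier PGammaL" "C \<otimes>\<^bsub>PGammaL\<^esub> D \<in> carrier PGammaL" "q \<in> Qf"
  shows "cact (C \<otimes>\<^bsub>PGammaL\<^esub> D) q = cact C (cact D q)" "cact D q \<in> Qf"
proof -
  obtain f g where fg: "f \<in> C" "g \<in> D" using PGammaL_nonempty assms(1,2) by meson
  obtain s t where st: "semilinear f s" "semilinear g t"
    using cact_eq(2)[OF assms(1) fg(1) assms(4)] cact_eq(2)[OF assms(2) fg(2) assms(4)] by (auto simp: in_GammaL)
  have D: "cact D q = qact g q" by (rule cact_eq(1)[OF assms(2) fg(2) assms(4)])
  show c: "cact D q \<in> Qf" unfolding D by (rule qact_closed[OF st(2) assms(4)])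
  show "cact (C \<otimes>\<^bsub>PGammaL\<^esub> D) q = cact C (cact D q)"
    unfolding cact_eq(1)[OF assms(3) PGammaL_mult_mem[OF fg] assms(4)] cact_eq(1)[OF assms(1) fg(1) c]
    unfolding D by (rule qact_comp[OF st])
qed

section \<open>Forms, transvections and involutions over a field with eight elements\<close>

definition transvection :: "'k::field ^ 2 \<Rightarrow> 'k ^ 2 \<Rightarrow> 'k ^ 2" where
  "transvection v w = w + om2 v w *s v"

locale field8 = gf8_root \<zeta> for \<zeta> :: "'k::{field,finite}" +
  assumes surj: "range (phom \<zeta>) = UNIV"
begin

lemma obtain_preimage: obtains a where "x = \<sigma> a"
  using surj by (metis rangeE UNIV_I)

lemma power8: "((x\<^sup>2)\<^sup>2)\<^sup>2 = (x :: 'k)"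
proof -
  obtain a where a: "x = \<sigma> a" by (rule obtain_preimage)
  have "((x\<^sup>2)\<^sup>2)\<^sup>2 = \<sigma> (((a\<^sup>2)\<^sup>2)\<^sup>2)" unfolding a by (simp only: hom_power)
  then show ?thesis by (simp only: gf8_power8 a)
qed

lemma obtain_sqrt: obtains y where "y\<^sup>2 = (x :: 'k)"
  by (rule that[of "(x\<^sup>2)\<^sup>2"]) (rule power8)

lemma square_eq_iff: "x\<^sup>2 = y\<^sup>2 \<longleftrightarrow> x = (y :: 'k)"
proof
  assume "x\<^sup>2 = y\<^sup>2"
  then have "(x + y)\<^sup>2 = 0" by (simp add: square_add)
  then have "x + y = 0" by simp
  then show "x = y" by (simp add: add_eq_0_iff)
qed simp

lemma root_ne: "\<zeta>\<^sup>2 \<noteq> \<zeta>" "(\<zeta>\<^sup>2)\<^sup>2 \<noteq> \<zeta>" "(\<zeta>\<^sup>2)\<^sup>2 \<noteq> \<zeta>\<^sup>2"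
proof -
  have e: "\<sigma> (el 2) = \<zeta>" by (simp add: phom_def)
  have "\<sigma> ((el 2)\<^sup>2) \<noteq> \<sigma> (el 2)" "\<sigma> (((el 2)\<^sup>2)\<^sup>2) \<noteq> \<sigma> (el 2)" "\<sigma> (((el 2)\<^sup>2)\<^sup>2) \<noteq> \<sigma> ((el 2)\<^sup>2)"
    unfolding hom_eq_iff by (simp_all add: power2_eq_square)
  then show "\<zeta>\<^sup>2 \<noteq> \<zeta>" "(\<zeta>\<^sup>2)\<^sup>2 \<noteq> \<zeta>" "(\<zeta>\<^sup>2)\<^sup>2 \<noteq> \<zeta>\<^sup>2"
    unfolding hom_power e .
qed

lemma field_automorphism_frob: "field_automorphism (\<lambda>x::'k. x\<^sup>2)"
proof -
  have "inj (\<lambda>x::'k. x\<^sup>2)" by (rule injI) (simp only: square_eq_iff)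
  then have "bij (\<lambda>x::'k. x\<^sup>2)" by (simp only: bij_def finite_UNIV_inj_surj[OF finite] simp_thms)
  then show ?thesis by (simp add: field_automorphism_def square_add power_mult_distrib)
qed

lemma field_automorphism_frob2: "field_automorphism (\<lambda>x::'k. (x\<^sup>2)\<^sup>2)"
proof -
  note f = field_automorphism_simps[OF field_automorphism_frob]
  show ?thesis
    using bij_comp[OF f(8) f(8)] unfolding field_automorphism_def comp_def
    by (simp only: square_add power_mult_distrib simp_thms)
qed

lemma automorphism_determined:
  assumes "field_automorphism s" "field_automorphism s'" "s \<zeta> = s' \<zeta>"
  shows "s = (s' :: 'k \<Rightarrow> 'k)"
proof
  fix x
  obtain a where "x = \<sigma> a" by (rule obtain_preimage)
  then show "s x = s' x" using automorphism_hom(1)[OF assms(1)] automorphism_hom(1)[OF assms(2)] assms(3) by simp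
qed

lemma automorphism_cases:
  assumes "field_automorphism (s :: 'k \<Rightarrow> 'k)"
  shows "s = id \<or> s = (\<lambda>x. x\<^sup>2) \<or> s = (\<lambda>x. (x\<^sup>2)\<^sup>2)"
  using roots[OF automorphism_hom(2)[OF assms]] automorphism_determined[OF assms field_automorphism_id]
    automorphism_determined[OF assms field_automorphism_frob]
    automorphism_determined[OF assms field_automorphism_frob2] by auto

lemma card_k: "CARD('k) = 8"
  using card_range surj by simp

definition qf :: "gf8 \<times> gf8 \<Rightarrow> 'k ^ 2 \<Rightarrow> 'k" where
  "qf P v = \<sigma> (fst P) * (v $ 1)\<^sup>2 + v $ 1 * v $ 2 + \<sigma> (snd P) * (v $ 2)\<^sup>2"

lemma qf_quadratic: "qf P (c *s v) = c\<^sup>2 * qf P v" "qf P (u + v) = qf P u + qf P v + om2 u v"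
  by (simp_all add: qf_def om2_def square_add power2_eq_square algebra_simps)

text \<open>Multiplying the form by a / y^2 and setting u = a x / y gives u^2 + u + a c, so a
  nontrivial zero corresponds to a solution of u^2 + u = a c.\<close>

lemma trace1_anisotropic:
  "trace1 (a * c) \<longleftrightarrow> (\<forall>x y. (x, y) \<noteq> (0, 0) \<longrightarrow> a * x\<^sup>2 + x * y + c * y\<^sup>2 \<noteq> 0)"
proof
  assume t: "trace1 (a * c)"
  then have a: "a \<noteq> 0" using trace1_GF8[of False False False] by (auto simp: zero_gf8_def[symmetric])
  show "\<forall>x y. (x, y) \<noteq> (0, 0) \<longrightarrow> a * x\<^sup>2 + x * y + c * y\<^sup>2 \<noteq> 0"
  proof (intro allI impI notI)
    fix x y assume xy: "(x, y) \<noteq> (0, 0)" and z: "a * x\<^sup>2 + x * y + c * y\<^sup>2 = 0"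
    show False
    proof (cases "y = 0")
      case True
      then show False using xy z a by simp
    next
      case False
      define u where "u = a * x / y"
      have "u\<^sup>2 + u + a * c = a / y\<^sup>2 * (a * x\<^sup>2 + x * y + c * y\<^sup>2)"
        using False by (simp add: u_def field_simps power2_eq_square)
      then have "u\<^sup>2 + u = a * c" using z by (simp add: gf8_add_eq_0_iff)
      then show False using t trace1_iff by blast
    qed
  qed
next
  assume an: "\<forall>x y. (x, y) \<noteq> (0, 0) \<longrightarrow> a * x\<^sup>2 + x * y + c * y\<^sup>2 \<noteq> 0"
  from an[rule_format, of 1 0] have a: "a \<noteq> 0" by simp
  have "u\<^sup>2 + u \<noteq> a * c" for u
  proof
    assume u: "u\<^sup>2 + u = a * c"
    have "a * (u / a)\<^sup>2 + u / a * 1 + c * 1\<^sup>2 = (u\<^sup>2 + u + a * c) / a"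
      using a by (simp add: field_simps power2_eq_square)
    then show False using an[rule_format, of "u / a" 1] u by simp
  qed
  then show "trace1 (a * c)" using trace1_iff by blast
qed

lemma qf_hom: "qf P (vector [\<sigma> x, \<sigma> y]) = \<sigma> (fst P * x\<^sup>2 + x * y + snd P * y\<^sup>2)"
  by (simp add: qf_def hom_add hom_mult hom_power)

lemma obtain_preimage2:
  fixes v :: "'k ^ 2"
  obtains x y where "v = vector [\<sigma> x, \<sigma> y]"
proof -
  obtain x where "v $ 1 = \<sigma> x" by (rule obtain_preimage)
  moreover obtain y where "v $ 2 = \<sigma> y" by (rule obtain_preimage)
  ultimately show thesis using that by (simp add: vec2_eq_iff)
qed

lemma hom_vector_eq_0: "vector [\<sigma> x, \<sigma> y] = (0 :: 'k ^ 2) \<longleftrightarrow> (x, y) = (0, 0)"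
  by (simp add: vec2_eq_iff hom_eq_0_iff)

lemma qf_in_Qf: "qf P \<in> Qf \<longleftrightarrow> P \<in> Om"
proof -
  have "(\<forall>v. v \<noteq> 0 \<longrightarrow> qf P v \<noteq> 0) \<longleftrightarrow> (\<forall>x y. vector [\<sigma> x, \<sigma> y] \<noteq> (0 :: 'k ^ 2) \<longrightarrow> qf P (vector [\<sigma> x, \<sigma> y]) \<noteq> 0)"
    by (metis obtain_preimage2)
  also have "\<dots> \<longleftrightarrow> trace1 (fst P * snd P)"
    unfolding qf_hom hom_vector_eq_0 hom_eq_0_iff trace1_anisotropic ..
  finally show ?thesis using qf_quadratic by (simp add: Qf_def Om_def)
qed

lemma qf_bij: "bij_betw qf Om Qf"
proof (rule bij_betw_imageI)
  show "inj_on qf Om"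
  proof (rule inj_onI)
    fix P Q assume "qf P = qf Q"
    then have "qf P (vector [1, 0]) = qf Q (vector [1, 0])" "qf P (vector [0, 1]) = qf Q (vector [0, 1])"
      by simp_all
    then show "P = Q" by (simp add: qf_def hom_eq_iff prod_eq_iff)
  qed
  show "qf ` Om = Qf"
  proof
    show "qf ` Om \<subseteq> Qf" using qf_in_Qf by blast
    show "Qf \<subseteq> qf ` Om"
    proof
      fix q :: "'k ^ 2 \<Rightarrow> 'k" assume q: "q \<in> Qf"
      obtain a where a: "q (vector [1, 0]) = \<sigma> a" by (rule obtain_preimage)
      obtain c where c: "q (vector [0, 1]) = \<sigma> c" by (rule obtain_preimage)
      have q1: "q (c *s v) = c\<^sup>2 * q v" and q2: "q (u + v) = q u + q v + om2 u v" for c u v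
        using q by (simp_all add: Qf_def)
      have "q v = qf (a, c) v" for v
      proof -
        have "q v = q (v $ 1 *s vector [1, 0] + v $ 2 *s vector [0, 1])" by (rule arg_cong[OF vec2_expand])
        also have "\<dots> = (v $ 1)\<^sup>2 * \<sigma> a + (v $ 2)\<^sup>2 * \<sigma> c + om2 (v $ 1 *s vector [1, 0]) (v $ 2 *s vector [0, 1])"
          by (simp only: q1 q2 a c)
        also have "\<dots> = qf (a, c) v" by (simp add: qf_def om2_def ac_simps)
        finally show ?thesis .
      qed
      then have "q = qf (a, c)" by (rule ext)
      then show "q \<in> qf ` Om" using q qf_in_Qf by blast
    qed
  qed
qed

lemma frobenius_semilinear: "semilinear (\<lambda>v :: 'k ^ 2. vector [(v $ 1)\<^sup>2, (v $ 2)\<^sup>2]) (\<lambda>x. x\<^sup>2)" (is "semilinear ?F _")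
proof -
  have "inj ?F" by (rule injI) (simp add: vec2_eq_iff square_eq_iff)
  then have "bij ?F" by (simp only: bij_def finite_UNIV_inj_surj[OF finite] simp_thms)
  then show ?thesis
    by (simp add: semilinear_def field_automorphism_frob vec2_eq_iff square_add power_mult_distrib)
qed

text \<open>A fixed form has both outer coefficients in the prime field, and anisotropy excludes 0.
  This provides the 3-element with exactly one fixed point that the Sylow argument needs.\<close>

lemma frobenius_fix:
  fixes q :: "'k ^ 2 \<Rightarrow> 'k"
  assumes "q \<in> Qf"
  shows "qact (\<lambda>v :: 'k ^ 2. vector [(v $ 1)\<^sup>2, (v $ 2)\<^sup>2]) q = q \<longleftrightarrow> q = qf (1, 1)" (is "qact ?F q = q \<longleftrightarrow> _")
proof -
  have "q \<in> qf ` Om" using assms bij_betw_imp_surj_on[OF qf_bij] by simp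
  then obtain P where P: "q = qf P" "P \<in> Om" by blast
  have D: "Df ?F = 1" by (simp add: Df_def om2_def)
  have val: "qact ?F q (vector [1, 0]) = (\<sigma> (fst P))\<^sup>2" "qact ?F q (vector [0, 1]) = (\<sigma> (snd P))\<^sup>2"
    using qact_apply[OF frobenius_semilinear, of q "vector [1, 0]"]
      qact_apply[OF frobenius_semilinear, of q "vector [0, 1]"] by (simp_all add: D P qf_def)
  show ?thesis
  proof
    assume "qact ?F q = q"
    then have "\<sigma> (fst P) = (\<sigma> (fst P))\<^sup>2" "\<sigma> (snd P) = (\<sigma> (snd P))\<^sup>2"
      using val by (simp_all add: P qf_def)
    then have "fst P = (fst P)\<^sup>2" "snd P = (snd P)\<^sup>2"
      by (simp_all only: hom_power[symmetric] hom_eq_iff)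
    then have "fst P * (fst P - 1) = 0" "snd P * (snd P - 1) = 0"
      by (simp_all only: right_diff_distrib mult_1_right power2_eq_square[symmetric] diff_self)
    moreover have "fst P \<noteq> 0" "snd P \<noteq> 0"
      using P(2) trace1_GF8[of False False False] by (auto simp: Om_def zero_gf8_def[symmetric])
    ultimately have "P = (1, 1)"
      by (simp add: prod_eq_iff gf8_add_eq_0_iff del: mult_eq_0_iff add: mult_eq_0_iff)
    then show "q = qf (1, 1)" by (simp add: P)
  next
    assume q: "q = qf (1, 1)"
    show "qact ?F q = q"
      by (rule qact_eqI[OF frobenius_semilinear]) (simp add: D q qf_def square_add power_mult_distrib)
  qed
qed

lemma transitive_qact:
  assumes "q \<in> Qf"
  obtains f s where "semilinear f s" "qact f q = qf (1, 1)"
proof -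
  have "q \<in> qf ` Om" using assms bij_betw_imp_surj_on[OF qf_bij] by simp
  then obtain P where P: "q = qf P" "P \<in> Om" by blast
  let ?a = "fst P" and ?c = "snd P"
  have t: "trace1 (?a * ?c)" using P(2) by (simp add: Om_def)
  then have a: "?a \<noteq> 0" using trace1_GF8[of False False False] by (auto simp: zero_gf8_def[symmetric])
  \<comment> \<open>Both \<open>?a * ?c\<close> and 1 have trace 1. The solution u is exactly what
    makes the form x^2 + x y + y^2 at (a x + u y, y) equal to a times the given form.\<close>
  have "\<not> trace1 (?a * ?c + 1)" using t by (cases "?a * ?c") (simp add: trace1_GF8 one_gf8_def)
  then obtain u where u: "u\<^sup>2 + u = ?a * ?c + 1" using trace1_iff by blast
  define f :: "'k ^ 2 \<Rightarrow> 'k ^ 2" where "f v = vector [\<sigma> ?a * v $ 1 + \<sigma> u * v $ 2, v $ 2]" for v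
  have "inj f" using a by (intro injI) (auto simp: f_def vec2_eq_iff hom_eq_0_iff)
  then have "bij f" by (simp only: bij_def finite_UNIV_inj_surj[OF finite] simp_thms)
  then have f: "semilinear f id"
    by (simp add: semilinear_def field_automorphism_id f_def vec2_eq_iff algebra_simps)
  have D: "Df f = \<sigma> ?a" by (simp add: Df_def om2_def f_def)
  have "qact f q = qf (1, 1)"
  proof (rule qact_eqI[OF f])
    fix v
    have "\<sigma> (u\<^sup>2 + u) = \<sigma> (?a * ?c + 1)" by (simp only: u)
    then have u': "(\<sigma> u)\<^sup>2 + \<sigma> u = \<sigma> ?a * \<sigma> ?c + 1" by (simp add: hom_add hom_mult hom_power)
    have "qf (1, 1) (f v) = (\<sigma> ?a)\<^sup>2 * (v $ 1)\<^sup>2 + \<sigma> ?a * (v $ 1 * v $ 2) + (((\<sigma> u)\<^sup>2 + \<sigma> u) + 1) * (v $ 2)\<^sup>2"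
      by (simp add: qf_def f_def square_add power_mult_distrib distrib_left distrib_right power2_eq_square ac_simps)
    also have "\<dots> = \<sigma> ?a * qf P v"
      unfolding u' by (simp add: qf_def distrib_left distrib_right power2_eq_square ac_simps)
    finally show "Df f * id (q v) = qf (1, 1) (f v)" by (simp add: D P)
  qed
  then show thesis using that f by blast
qed

lemma transvection_square: "transvection v (transvection v w) = (w :: 'k ^ 2)"
  by (simp add: transvection_def om2_def vec2_eq_iff algebra_simps char2)

lemma transvection_semilinear: "semilinear (transvection v :: 'k ^ 2 \<Rightarrow> _) id"
proof -
  have "bij (transvection v :: 'k ^ 2 \<Rightarrow> _)"
    by (rule bij_betw_byWitness[of _ "transvection v"]) (auto simp: transvection_square)
  then show ?thesis
    by (simp add: semilinear_def field_automorphism_id transvection_def om2_def vec2_eq_iff algebra_simps)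
qed

lemma transvection_fix:
  fixes q :: "'k ^ 2 \<Rightarrow> 'k"
  assumes q: "q \<in> Qf" and v: "v \<noteq> 0"
  shows "qact (transvection v) q = q \<longleftrightarrow> q v = 1"
proof -
  have q1: "q (c *s v) = c\<^sup>2 * q v" and q2: "q (u + v) = q u + q v + om2 u v" for c u v
    using q by (simp_all add: Qf_def)
  have D: "Df (transvection v) = 1"
    by (simp add: Df_def om2_def transvection_def algebra_simps)
  have o: "om2 w (c *s v) = c * om2 v w" for w c by (simp add: om2_def algebra_simps)
  \<comment> \<open>The polar term equals the square of \<open>om2 v w\<close>, since
    \<open>om2\<close> is symmetric in characteristic 2; this is the origin of the 1 next to
    \<open>q v\<close>.\<close>
  have T: "q (transvection v w) = q w + (om2 v w)\<^sup>2 * (q v + 1)" for w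
    unfolding transvection_def q2 q1 o by (simp add: power2_eq_square algebra_simps)
  show ?thesis
  proof
    assume h: "qact (transvection v) q = q"
    have "\<exists>w. om2 v w \<noteq> 0"
    proof -
      have "om2 v (vector [0, 1]) \<noteq> 0 \<or> om2 v (vector [1, 0]) \<noteq> 0"
        using v by (auto simp: om2_def vec2_eq_iff)
      then show ?thesis by blast
    qed
    then obtain w where w: "om2 v w \<noteq> 0" by blast
    have "q (transvection v w) = q w"
      using qact_apply[OF transvection_semilinear, of v q w] h D by simp
    then have "(om2 v w)\<^sup>2 * (q v + 1) = 0" unfolding T by simp
    then show "q v = 1" using w by (simp add: add_eq_0_iff)
  next
    assume "q v = 1"
    then show "qact (transvection v) q = q"
      by (intro qact_eqI[OF transvection_semilinear]) (simp add: D T)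
  qed
qed

lemma transvection_not_scalar:
  assumes v: "v \<noteq> (0 :: 'k ^ 2)" shows "transvection v \<notin> scalar_maps"
proof
  assume "transvection v \<in> scalar_maps"
  then obtain c where c: "\<And>w. transvection v w = c *s w" by (auto simp: scalar_maps_def fun_eq_iff)
  have "v $ 1 * v $ 1 = 0" "v $ 2 * v $ 2 = 0"
    using c[of "vector [0, 1]"] c[of "vector [1, 0]"]
    by (simp_all add: transvection_def om2_def vec2_eq_iff)
  then show False using v by (simp add: vec2_eq_iff)
qed

text \<open>A semilinear map whose square is scalar is linear because its companion automorphism has odd
  order, and in characteristic 2 it is then a scalar multiple of a transvection.\<close>

lemma involution_transvection:
  assumes f: "semilinear f s" and ff: "f \<circ> f \<in> scalar_maps" and nf: "f \<notin> scalar_maps"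
  obtains c v where "c \<noteq> 0" "v \<noteq> (0 :: 'k ^ 2)" "f = (\<lambda>w. c *s w) \<circ> transvection v"
proof -
  obtain l where l: "l \<noteq> 0" "f \<circ> f = (\<lambda>w. l *s w)" using ff by (auto simp: scalar_maps_def)
  have "s \<circ> s = id"
    using semilinear_unique[OF semilinear_comp(1)[OF f f]] semilinear_scalar[OF l(1)] l(2) by metis
  then have ss: "s (s \<zeta>) = \<zeta>" by (metis comp_apply id_apply)
  have "s = id"
    using automorphism_cases[OF semilinear_simps(3)[OF f]]
  proof (elim disjE)
    assume h: "s = (\<lambda>x. x\<^sup>2)"
    show ?thesis using ss root_ne(2) unfolding h by contradiction
  next
    assume h: "s = (\<lambda>x. (x\<^sup>2)\<^sup>2)"
    show ?thesis using ss root_ne(1) unfolding h power8 by contradiction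
  qed
  with f have f: "semilinear f id" by simp
  define p r q t where "p = f (vector [1, 0]) $ 1" "r = f (vector [1, 0]) $ 2"
    "q = f (vector [0, 1]) $ 1" "t = f (vector [0, 1]) $ 2"
  note pqrt = this
  have fw: "f w = vector [p * w $ 1 + q * w $ 2, r * w $ 1 + t * w $ 2]" for w
    by (subst semilinear_expand[OF f]) (simp add: vec2_eq_iff pqrt ac_simps)
  have "f (f w) = l *s w" for w using l(2) by (metis comp_apply)
  from this[of "vector [1, 0]"] this[of "vector [0, 1]"]
  have e: "p * p + q * r = l" "r * q + t * t = l"
    by (simp_all add: fw vec2_eq_iff)
  have "p * p = t * t"
  proof -
    have "p * p + q * r = t * t + q * r" using e by (simp add: ac_simps)
    then show ?thesis by (simp only: add_right_cancel)
  qed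
  then have pt: "p = t" using square_eq_iff[of p t] by (simp add: power2_eq_square)
  \<comment> \<open>The matrix of m times the transvection along (v1, v2) has diagonal entries m (1
    + v1 v2) and off-diagonal entries m v1^2, m v2^2. This dictates v1 and v2, and l = m^2 because
    transvections are involutions.\<close>
  obtain m where m: "m\<^sup>2 = l" by (rule obtain_sqrt)
  then have m0: "m \<noteq> 0" using l(1) by auto
  obtain v1 where v1: "v1\<^sup>2 = q / m" by (rule obtain_sqrt)
  obtain v2 where v2: "v2\<^sup>2 = r / m" by (rule obtain_sqrt)
  define v :: "'k ^ 2" where "v = vector [v1, v2]"
  have q: "q = m * v1\<^sup>2" and r: "r = m * v2\<^sup>2" using v1 v2 m0 by simp_all
  have "p\<^sup>2 = (m * (1 + v1 * v2))\<^sup>2"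
  proof -
    have "p\<^sup>2 = l + q * r" using e(1) by (metis add_self_left add.commute power2_eq_square)
    also have "\<dots> = (m * (1 + v1 * v2))\<^sup>2"
      unfolding q r m[symmetric] by (simp add: square_add power_mult_distrib power2_eq_square algebra_simps)
    finally show ?thesis .
  qed
  then have p: "p = m * (1 + v1 * v2)" by (simp only: square_eq_iff)
  have fT: "f = (\<lambda>w. m *s w) \<circ> transvection v"
    by (rule ext) (simp add: fw transvection_def om2_def v_def vec2_eq_iff pt[symmetric] p q r power2_eq_square algebra_simps)
  have "v \<noteq> 0"
  proof
    assume "v = 0"
    then have "f = (\<lambda>w. m *s w)" unfolding fT by (auto simp: transvection_def om2_def)
    then show False using nf m0 by (auto simp: scalar_maps_def)
  qed
  then show thesis using that m0 fT by blast
qed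

end

subsection \<open>The Ree unital as a set of quadratic forms\<close>

text \<open>A point is given by a nonzero a and the product a c, which has trace 1: 7 * 4
  choices.\<close>

lemma card_Om: "card Om = 28"
proof -
  have nz: "x \<noteq> 0" if "trace1 x" for x
    using that trace1_GF8[of False False False] by (auto simp: zero_gf8_def)
  have "bij_betw (\<lambda>(a, c). (a, a * c)) Om ((UNIV - {0}) \<times> {x. trace1 x})"
    by (rule bij_betw_byWitness[of _ "\<lambda>(a, x). (a, x / a)"]) (auto simp: Om_def dest: nz split: if_splits)
  then have "card Om = card ((UNIV - {0 :: gf8}) \<times> {x. trace1 x})" by (rule bij_betw_same_card)
  moreover have "card {x. trace1 x} = 4"
  proof -
    have "{x. trace1 x} = (\<lambda>(b, c). GF8 True b c) ` UNIV"
    proof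
      show "{x. trace1 x} \<subseteq> (\<lambda>(b, c). GF8 True b c) ` UNIV"
      proof
        fix x assume "x \<in> {x. trace1 x}"
        then show "x \<in> (\<lambda>(b, c). GF8 True b c) ` UNIV" by (cases x) (auto simp: trace1_GF8 image_iff)
      qed
    qed (auto simp: trace1_GF8)
    moreover have "inj (\<lambda>(b, c). GF8 True b c)" by (auto simp: inj_def)
    ultimately show ?thesis by (simp add: card_image card_UNIV_bool)
  qed
  ultimately show ?thesis by (simp add: card_cartesian_product card_Diff_subset card_gf8)
qed

lemma subgroup_scalar_maps: "subgroup scalar_maps (GammaL :: ('k::field ^ 2 \<Rightarrow> 'k ^ 2) monoid)"
  by (rule normal_imp_subgroup[OF scalar_maps_normal])

lemma group_PGammaL: "group (PGammaL :: ('k::field ^ 2 \<Rightarrow> 'k ^ 2) set monoid)"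
  unfolding PGammaL_def by (rule normal.factorgroup_is_group[OF scalar_maps_normal])

lemma coset_in_PGammaL:
  assumes "semilinear f s"
  shows "scalar_maps #>\<^bsub>GammaL\<^esub> f \<in> carrier PGammaL" "f \<in> scalar_maps #>\<^bsub>GammaL\<^esub> f"
proof -
  have f: "f \<in> carrier GammaL" unfolding in_GammaL using assms by blast
  then show "scalar_maps #>\<^bsub>GammaL\<^esub> f \<in> carrier PGammaL"
    by (auto simp: PGammaL_def FactGroup_def RCOSETS_def)
  show "f \<in> scalar_maps #>\<^bsub>GammaL\<^esub> f"
    by (rule group.rcos_self[OF group_GammaL f subgroup_scalar_maps])
qed

lemma coset_eq_scalar_maps:
  fixes f :: "'k::field ^ 2 \<Rightarrow> 'k ^ 2"
  assumes "C \<in> carrier PGammaL" "f \<in> C" "f \<in> scalar_maps"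
  shows "C = scalar_maps"
proof -
  obtain g where g: "g \<in> carrier GammaL" "C = scalar_maps #>\<^bsub>GammaL\<^esub> g"
    using assms(1) by (auto simp: PGammaL_def FactGroup_def RCOSETS_def)
  have "C = scalar_maps #>\<^bsub>GammaL\<^esub> f"
    unfolding g(2) by (rule group.repr_independence[OF group_GammaL assms(2)[unfolded g(2)] g(1) subgroup_scalar_maps])
  also have "\<dots> = scalar_maps"
    by (rule group.coset_join2[OF group_GammaL subsetD[OF subgroup.subset[OF subgroup_scalar_maps] assms(3)]
          subgroup_scalar_maps assms(3)])
  finally show ?thesis .
qed

lemma id_scalar: "id \<in> (scalar_maps :: ('k::field ^ 2 \<Rightarrow> 'k ^ 2) set)"
  unfolding scalar_maps_def by (intro CollectI exI[of _ 1]) (simp add: fun_eq_iff)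

lemma card_scalar_maps: "card (scalar_maps :: ('k::{field,finite} ^ 2 \<Rightarrow> 'k ^ 2) set) = CARD('k) - 1"
proof -
  have eq: "(scalar_maps :: ('k ^ 2 \<Rightarrow> 'k ^ 2) set) = (\<lambda>c v. c *s v) ` (UNIV - {0})"
    by (auto simp: scalar_maps_def)
  have "inj_on (\<lambda>c (v :: 'k ^ 2). c *s v) (UNIV - {0})"
  proof (rule inj_onI)
    fix c d :: 'k assume "(\<lambda>v :: 'k ^ 2. c *s v) = (\<lambda>v. d *s v)"
    then have "c *s (vector [1, 0] :: 'k ^ 2) = d *s vector [1, 0]" by (rule fun_cong)
    then show "c = d" by (simp add: vec2_eq_iff)
  qed
  then show ?thesis unfolding eq by (simp add: card_image card_Diff_subset)
qed

section \<open>Orders of the semilinear groups and the affine model of the Ree unital\<close>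

context field8
begin

text \<open>Pairs of independent vectors: 63 choices for u, and all vectors but its 8 multiples for
  v.\<close>

lemma card_om2_nonzero: "card {(u, v :: 'k ^ 2). om2 u v \<noteq> 0} = 3528"
proof -
  have "card {v. om2 u v \<noteq> 0} = 56" if u: "u \<noteq> 0" for u :: "'k ^ 2"
  proof -
    have "{v. om2 u v = 0} = range (\<lambda>c. c *s u)"
    proof
      show "range (\<lambda>c. c *s u) \<subseteq> {v. om2 u v = 0}" by (auto simp: om2_def ac_simps)
      show "{v. om2 u v = 0} \<subseteq> range (\<lambda>c. c *s u)"
      proof
        fix v assume "v \<in> {v. om2 u v = 0}"
        then have e: "u $ 1 * v $ 2 = u $ 2 * v $ 1" by (simp add: om2_def add_eq_0_iff)
        have "u $ 1 \<noteq> 0 \<or> u $ 2 \<noteq> 0" using u by (auto simp: vec2_eq_iff)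
        then have "v = (v $ 1 / u $ 1) *s u \<or> v = (v $ 2 / u $ 2) *s u"
          using e by (auto simp: vec2_eq_iff field_simps)
        then show "v \<in> range (\<lambda>c. c *s u)" by blast
      qed
    qed
    moreover have "inj (\<lambda>c. c *s u)" using u by (auto intro!: injI simp: vec_eq_iff)
    ultimately have "card {v. om2 u v = 0} = 8" by (simp add: card_image card_k)
    moreover have "{v. om2 u v \<noteq> 0} = UNIV - {v. om2 u v = 0}" by blast
    ultimately show ?thesis by (simp add: card_Diff_subset card_k)
  qed
  then have "(\<Sum>u\<in>UNIV - {0 :: 'k ^ 2}. card {v. om2 u v \<noteq> 0}) = (\<Sum>u\<in>UNIV - {0 :: 'k ^ 2}. 56)"
    by (intro sum.cong) auto
  also have "\<dots> = 3528" by (simp add: card_Diff_subset card_k)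
  finally have "card (SIGMA u:UNIV - {0 :: 'k ^ 2}. {v. om2 u v \<noteq> 0}) = 3528"
    by (simp add: card_SigmaI)
  moreover have "{(u, v :: 'k ^ 2). om2 u v \<noteq> 0} = (SIGMA u:UNIV - {0}. {v. om2 u v \<noteq> 0})"
    by (auto simp: om2_def)
  ultimately show ?thesis by simp
qed

lemma obtain_automorphism:
  assumes "\<xi> \<in> {\<zeta>, \<zeta>\<^sup>2, (\<zeta>\<^sup>2)\<^sup>2}"
  obtains s :: "'k \<Rightarrow> 'k" where "field_automorphism s" "s \<zeta> = \<xi>"
proof -
  have "\<xi> = \<zeta> \<or> \<xi> = \<zeta>\<^sup>2 \<or> \<xi> = (\<zeta>\<^sup>2)\<^sup>2" using assms by blast
  then show thesis
    using that[OF field_automorphism_id] that[OF field_automorphism_frob] that[OF field_automorphism_frob2]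
    by (elim disjE) simp_all
qed

text \<open>A semilinear map is determined by the image of \<zeta> under its companion automorphism
  and by the images of the unit vectors. Any of the three roots may be combined with any independent
  pair, giving 3 * 3528 maps.\<close>

lemma order_GammaL: "order (GammaL :: ('k ^ 2 \<Rightarrow> 'k ^ 2) monoid) = 10584"
proof -
  let ?e1 = "vector [1, 0] :: 'k ^ 2" and ?e2 = "vector [0, 1] :: 'k ^ 2"
  let ?R = "{\<zeta>, \<zeta>\<^sup>2, (\<zeta>\<^sup>2)\<^sup>2}" and ?B = "{(u, v :: 'k ^ 2). om2 u v \<noteq> 0}"
  define F where "F f = (sf f \<zeta>, f ?e1, f ?e2)" for f :: "'k ^ 2 \<Rightarrow> 'k ^ 2"
  have "bij_betw F (carrier GammaL) (?R \<times> ?B)"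
  proof (rule bij_betw_imageI)
    show "inj_on F (carrier GammaL)"
    proof (rule inj_onI)
      fix f g :: "'k ^ 2 \<Rightarrow> 'k ^ 2"
      assume fg: "f \<in> carrier GammaL" "g \<in> carrier GammaL" "F f = F g"
      have f: "semilinear f (sf f)" and g: "semilinear g (sf g)" using fg sf_semilinear by blast+
      have e: "sf f \<zeta> = sf g \<zeta>" "f ?e1 = g ?e1" "f ?e2 = g ?e2" using fg(3) by (simp_all add: F_def)
      have s: "sf f = sf g"
        by (rule automorphism_determined[OF semilinear_simps(3)[OF f] semilinear_simps(3)[OF g] e(1)])
      show "f = g"
        by (rule ext, subst semilinear_expand[OF f], subst semilinear_expand[OF g]) (simp only: s e)
    qed
    show "F ` carrier GammaL = ?R \<times> ?B"
    proof
      show "F ` carrier GammaL \<subseteq> ?R \<times> ?B"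
      proof
        fix x assume "x \<in> F ` carrier GammaL"
        then obtain f where f: "x = F f" "f \<in> carrier GammaL" by blast
        note sl = sf_semilinear[OF f(2)]
        have "om2 (f ?e1) (f ?e2) \<noteq> 0" using Df_nonzero[OF sl] by (simp add: Df_def)
        moreover have "sf f \<zeta> \<in> ?R"
          using roots[OF automorphism_hom(2)[OF semilinear_simps(3)[OF sl]]] by blast
        ultimately show "x \<in> ?R \<times> ?B" unfolding f(1) F_def by blast
      qed
      show "?R \<times> ?B \<subseteq> F ` carrier GammaL"
      proof
        fix x assume "x \<in> ?R \<times> ?B"
        then obtain \<xi> u v where x: "x = (\<xi>, u, v)" "\<xi> \<in> ?R" "om2 u v \<noteq> 0" by blast
        obtain s :: "'k \<Rightarrow> 'k" where s: "field_automorphism s" "s \<zeta> = \<xi>" by (rule obtain_automorphism[OF x(2)])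
        note a = field_automorphism_simps[OF s(1)]
        define f where "f w = s (w $ 1) *s u + s (w $ 2) *s v" for w :: "'k ^ 2"
        have o: "om2 (f w) v = s (w $ 1) * om2 u v" "om2 u (f w) = s (w $ 2) * om2 u v" for w
          by (simp_all add: f_def om2_def algebra_simps)
        have "inj f"
        proof (rule injI)
          fix w w' assume "f w = f w'"
          then have "s (w $ 1) * om2 u v = s (w' $ 1) * om2 u v" "s (w $ 2) * om2 u v = s (w' $ 2) * om2 u v"
            by (metis o)+
          then have "s (w $ 1) = s (w' $ 1)" "s (w $ 2) = s (w' $ 2)" using x(3) by simp_all
          then show "w = w'" using a(8) by (simp add: vec2_eq_iff bij_is_inj inj_eq)
        qed
        then have "bij f" by (simp only: bij_def finite_UNIV_inj_surj[OF finite] simp_thms)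
        then have f: "semilinear f s"
          using s(1) by (simp add: semilinear_def f_def a vec2_eq_iff algebra_simps)
        have "F f = x"
          unfolding F_def sf_eq[OF f] x(1) s(2) by (simp add: f_def a)
        moreover have "f \<in> carrier GammaL" unfolding in_GammaL using f by blast
        ultimately show "x \<in> F ` carrier GammaL" by blast
      qed
    qed
  qed
  then have "card (carrier (GammaL :: ('k ^ 2 \<Rightarrow> 'k ^ 2) monoid)) = card (?R \<times> ?B)"
    by (rule bij_betw_same_card)
  moreover have "card ?R = 3" using root_ne by (simp add: card_insert_if not_sym)
  ultimately show ?thesis
    unfolding order_def card_cartesian_product card_om2_nonzero by simp
qed

lemma order_PGammaL: "order (PGammaL :: ('k ^ 2 \<Rightarrow> 'k ^ 2) set monoid) = 1512"
proof -
  have "card (rcosets\<^bsub>GammaL\<^esub> (scalar_maps :: ('k ^ 2 \<Rightarrow> 'k ^ 2) set)) * card (scalar_maps :: ('k ^ 2 \<Rightarrow> 'k ^ 2) set)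
      = order (GammaL :: ('k ^ 2 \<Rightarrow> 'k ^ 2) monoid)"
    by (rule group.lagrange[OF group_GammaL subgroup_scalar_maps])
  then have "card (rcosets\<^bsub>GammaL\<^esub> (scalar_maps :: ('k ^ 2 \<Rightarrow> 'k ^ 2) set)) * 7 = 10584"
    by (simp only: order_GammaL card_scalar_maps card_k) simp
  then show ?thesis by (simp add: order_def PGammaL_def FactGroup_def)
qed

lemma frobenius_cube:
  fixes F :: "'k ^ 2 \<Rightarrow> 'k ^ 2"
  defines "F \<equiv> \<lambda>v. vector [(v $ 1)\<^sup>2, (v $ 2)\<^sup>2]"
  shows "F \<circ> F \<circ> F = id"
proof
  fix v show "(F \<circ> F \<circ> F) v = id v"
    unfolding F_def comp_apply id_apply vec2_eq_iff vector_2 by (simp only: power8 simp_thms)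
qed

text \<open>The group is only isomorphic to \<open>PGammaL\<close>, so its action on forms is pulled
  back along i. The form at (a, c) names the Sylow subgroup in its stabilizer. An involution is
  represented by a nonscalar map with scalar square, hence by a multiple of a transvection, and the
  vector of this transvection names the block.\<close>

lemma ree_unital_coordinates:
  fixes G :: "('g, 'm) monoid_scheme" (structure)
  assumes "group G" and "i \<in> iso G (PGammaL :: ('k ^ 2 \<Rightarrow> 'k ^ 2) set monoid)"
  shows "\<exists>p. coordinates p (ree_unital G)"
proof -
  let ?PG = "PGammaL :: ('k ^ 2 \<Rightarrow> 'k ^ 2) set monoid"
  let ?act = "\<lambda>g. cact (i g)"
  interpret G: group G by fact
  interpret PG: group ?PG by (rule group_PGammaL)
  have i_bij: "bij_betw i (carrier G) (carrier ?PG)" and i_hom: "i \<in> hom G ?PG"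
    using assms(2) by (simp_all add: iso_def)
  interpret i: group_hom G ?PG i using i_hom by unfold_locales
  have i_one: "i \<one> = scalar_maps" using i.hom_one by (simp add: one_PGammaL)
  have i_inj: "g = g'" if "g \<in> carrier G" "g' \<in> carrier G" "i g = i g'" for g g'
    using that i_bij by (auto simp: bij_betw_def dest: inj_onD)
  have set_action: "set_action G Qf ?act"
  proof
    fix g h and q :: "'k ^ 2 \<Rightarrow> 'k"
    assume q: "q \<in> Qf"
    show "?act \<one> q = q"
    proof -
      have "?act \<one> q = qact id q"
        using cact_eq(1)[OF PG.one_closed _ q, of id] id_scalar by (simp add: one_PGammaL i_one)
      also have "\<dots> = q" by (rule qact_eqI[OF semilinear_id]) (simp add: Df_def om2_def)
      finally show ?thesis .
    qed
    assume g: "g \<in> carrier G"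
    show "?act g q \<in> Qf"
      by (rule cact_mult(2)[OF i.hom_closed[OF g] i.hom_closed[OF g] _ q]) (simp add: g)
    assume h: "h \<in> carrier G"
    show "?act (g \<otimes> h) q = ?act g (?act h q)"
      unfolding i.hom_mult[OF g h]
      by (rule cact_mult(1)[OF i.hom_closed[OF g] i.hom_closed[OF h] _ q]) (simp add: g h)
  qed
  then interpret act: set_action G Qf ?act .
  have lift: "\<exists>g\<in>carrier G. i g = scalar_maps #>\<^bsub>GammaL\<^esub> f \<and> (\<forall>q\<in>Qf. ?act g q = qact f q)"
    if f: "semilinear f s" for f s
  proof -
    have "scalar_maps #>\<^bsub>GammaL\<^esub> f \<in> i ` carrier G"
      using coset_in_PGammaL(1)[OF f] i_bij by (simp add: bij_betw_def)
    then obtain g where g: "g \<in> carrier G" "i g = scalar_maps #>\<^bsub>GammaL\<^esub> f" by auto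
    have "?act g q = qact f q" if q: "q \<in> Qf" for q
      unfolding g(2) by (rule cact_eq(1)[OF coset_in_PGammaL[OF f] q])
    then show ?thesis using g by blast
  qed
  \<comment> \<open>The class of the Frobenius map serves as the element h of
    \<open>sylow_action\<close>.\<close>
  let ?F = "\<lambda>v :: 'k ^ 2. vector [(v $ 1)\<^sup>2, (v $ 2)\<^sup>2] :: 'k ^ 2"
  obtain h where h: "h \<in> carrier G" "i h = scalar_maps #>\<^bsub>GammaL\<^esub> ?F" "\<forall>q\<in>Qf. ?act h q = qact ?F q"
    using lift[OF frobenius_semilinear] by blast
  have one1: "(1, 1) \<in> Om" using trace1_GF8[of True False False] by (simp add: Om_def one_gf8_def[symmetric])
  have q0: "qf (1, 1) \<in> Qf" using one1 qf_in_Qf by blast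
  have h3: "h [^] (3::nat) = \<one>"
  proof -
    have hhh: "h \<otimes> h \<otimes> h \<in> carrier G" using h(1) by simp
    have Fi: "?F \<in> i h" unfolding h(2) by (rule coset_in_PGammaL(2)[OF frobenius_semilinear])
    have "i (h \<otimes> h \<otimes> h) = i h \<otimes>\<^bsub>?PG\<^esub> i h \<otimes>\<^bsub>?PG\<^esub> i h" using h(1) by simp
    moreover have "?F \<circ> ?F \<circ> ?F \<in> i h \<otimes>\<^bsub>?PG\<^esub> i h \<otimes>\<^bsub>?PG\<^esub> i h"
      by (rule PGammaL_mult_mem[OF PGammaL_mult_mem[OF Fi Fi] Fi])
    ultimately have "id \<in> i (h \<otimes> h \<otimes> h)" by (simp only: frobenius_cube)
    then have "i (h \<otimes> h \<otimes> h) = scalar_maps"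
      by (rule coset_eq_scalar_maps[OF i.hom_closed[OF hhh] _ id_scalar])
    then have "h \<otimes> h \<otimes> h = \<one>" using i_inj[OF hhh G.one_closed] i_one by simp
    then show ?thesis using h(1) by (simp add: numeral_3_eq_3)
  qed
  have act_to_q0: "\<exists>g\<in>carrier G. ?act g q = qf (1, 1)" if q: "q \<in> Qf" for q
  proof -
    obtain f s where f: "semilinear f s" "qact f q = qf (1, 1)" by (rule transitive_qact[OF q])
    obtain g where "g \<in> carrier G" "\<forall>q\<in>Qf. ?act g q = qact f q" using lift[OF f(1)] by blast
    then show ?thesis using q f(2) by (intro bexI[of _ g]) simp_all
  qed
  interpret S: sylow_action G Qf ?act h "qf (1, 1)"
  proof (unfold_locales)
    show "order G = 1512"
      using bij_betw_same_card[OF i_bij] order_PGammaL by (simp add: order_def)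
    show "card (Qf :: ('k ^ 2 \<Rightarrow> 'k) set) = 28"
      using bij_betw_same_card[OF qf_bij] card_Om by simp
    show "h \<in> carrier G" "h [^] (3::nat) = \<one>" "qf (1, 1) \<in> Qf" by (fact h h3 q0)+
    show "?act h (qf (1, 1)) = qf (1, 1)" using h(3) q0 frobenius_fix[OF q0] by simp
    fix q :: "'k ^ 2 \<Rightarrow> 'k" assume q: "q \<in> Qf"
    show "q = qf (1, 1)" if "?act h q = q" using that h(3) q frobenius_fix[OF q] by simp
    fix q' :: "'k ^ 2 \<Rightarrow> 'k" assume q': "q' \<in> Qf"
    obtain g where g: "g \<in> carrier G" "?act g q = qf (1, 1)" using act_to_q0[OF q] by blast
    obtain g' where g': "g' \<in> carrier G" "?act g' q' = qf (1, 1)" using act_to_q0[OF q'] by blast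
    have "?act (inv g' \<otimes> g) q = ?act (inv g') (?act g q)"
      by (rule act.act_mult[OF G.inv_closed[OF g'(1)] g(1) q])
    also have "\<dots> = q'" unfolding g(2) g'(2)[symmetric] by (rule act.act_inv(1)[OF g'(1) q'])
    finally show "\<exists>g\<in>carrier G. ?act g q = q'" using G.m_closed[OF G.inv_closed[OF g'(1)] g(1)] by blast
  qed
  define p where "p = S.pt \<circ> qf"
  have p_bij: "bij_betw p Om (sylow_subgroups 3 G)"
    unfolding p_def by (rule bij_betw_trans[OF qf_bij S.pt_bij])
  have block: "fixed_sylows 3 G t = p ` blk (x, y)"
    if t: "t \<in> carrier G" and a: "\<forall>q\<in>Qf. ?act t q = q \<longleftrightarrow> q (vector [\<sigma> x, \<sigma> y]) = 1" for t x y
  proof -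
    have "{q \<in> Qf. ?act t q = q} = {q \<in> Qf. q (vector [\<sigma> x, \<sigma> y]) = 1}"
      using bspec[OF a] by (intro Collect_cong conj_cong refl)
    also have "\<dots> = qf ` {P \<in> Om. qf P (vector [\<sigma> x, \<sigma> y]) = 1}"
      unfolding bij_betw_imp_surj_on[OF qf_bij, symmetric] by auto
    also have "{P \<in> Om. qf P (vector [\<sigma> x, \<sigma> y]) = 1} = blk (x, y)"
    proof -
      have "qf P (vector [\<sigma> x, \<sigma> y]) = 1 \<longleftrightarrow> incd P (x, y)" for P
        unfolding qf_hom incd_def fst_conv snd_conv using hom_eq_iff[of _ 1] by simp
      then show ?thesis by (simp add: blk_def)
    qed
    finally show ?thesis unfolding S.fixed_sylows_eq[OF t] p_def by (simp add: image_comp)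
  qed
  have "fixed_sylows 3 G ` involutions G = {p ` blk v | v. v \<noteq> (0, 0)}"
  proof
    show "fixed_sylows 3 G ` involutions G \<subseteq> {p ` blk v | v. v \<noteq> (0, 0)}"
    proof
      fix B assume "B \<in> fixed_sylows 3 G ` involutions G"
      then obtain t where t: "t \<in> carrier G" "G.ord t = 2" "B = fixed_sylows 3 G t"
        by (auto simp: involutions_def)
      obtain f where f: "f \<in> i t" using PGammaL_nonempty[OF i.hom_closed[OF t(1)]] by blast
      obtain s where s: "semilinear f s"
        using cact_eq(2)[OF i.hom_closed[OF t(1)] f q0] by (auto simp: in_GammaL)
      have "t \<otimes> t = \<one>"
        using G.pow_ord_eq_1[OF t(1)] t(1,2) by (simp add: numeral_2_eq_2)
      then have "i t \<otimes>\<^bsub>?PG\<^esub> i t = scalar_maps" using i.hom_mult[OF t(1) t(1)] i_one by simp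
      then have ff: "f \<circ> f \<in> scalar_maps" using PGammaL_mult_mem[OF f f] by simp
      have nf: "f \<notin> scalar_maps"
      proof
        assume "f \<in> scalar_maps"
        then have "i t = scalar_maps" by (rule coset_eq_scalar_maps[OF i.hom_closed[OF t(1)] f])
        then have "t = \<one>" using i_inj[OF t(1) G.one_closed] i_one by simp
        then have "t [^] (1::nat) = \<one>" by simp
        then show False using G.pow_eq_id[OF t(1), of 1] t(2) by simp
      qed
      obtain c v where cv: "c \<noteq> 0" "v \<noteq> (0 :: 'k ^ 2)" "f = (\<lambda>w. c *s w) \<circ> transvection v"
        by (rule involution_transvection[OF s ff nf])
      obtain x y where v: "v = vector [\<sigma> x, \<sigma> y]" by (rule obtain_preimage2)
      have "?act t q = q \<longleftrightarrow> q v = 1" if q: "q \<in> Qf" for q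
      proof -
        have "?act t q = qact f q" by (rule cact_eq(1)[OF i.hom_closed[OF t(1)] f q])
        also have "\<dots> = qact (transvection v) q"
          unfolding cv(3) qact_comp[OF semilinear_scalar[OF cv(1)] transvection_semilinear]
          by (rule qact_scalar[OF cv(1) qact_closed[OF transvection_semilinear q]])
        finally show ?thesis using transvection_fix[OF q cv(2)] by simp
      qed
      then have "B = p ` blk (x, y)" unfolding t(3) by (intro block[OF t(1)]) (simp add: v)
      moreover have "(x, y) \<noteq> (0, 0)" using cv(2) hom_vector_eq_0[of x y] v by blast
      ultimately show "B \<in> {p ` blk v | v. v \<noteq> (0, 0)}" by blast
    qed
    show "{p ` blk v | v. v \<noteq> (0, 0)} \<subseteq> fixed_sylows 3 G ` involutions G"
    proof
      fix B assume "B \<in> {p ` blk v | v. v \<noteq> (0, 0)}"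
      then obtain x y where xy: "B = p ` blk (x, y)" "(x, y) \<noteq> (0, 0)" by auto
      define v where "v = (vector [\<sigma> x, \<sigma> y] :: 'k ^ 2)"
      have v: "v \<noteq> 0" unfolding v_def using hom_vector_eq_0 xy(2) by blast
      obtain t where t: "t \<in> carrier G" "i t = scalar_maps #>\<^bsub>GammaL\<^esub> transvection v"
          "\<forall>q\<in>Qf. ?act t q = qact (transvection v) q"
        using lift[OF transvection_semilinear] by blast
      have T: "transvection v \<in> i t" unfolding t(2) by (rule coset_in_PGammaL(2)[OF transvection_semilinear])
      have tt: "t \<otimes> t \<in> carrier G" using t(1) by simp
      have "transvection v \<circ> transvection v = id" by (rule ext) (simp add: transvection_square)
      then have "id \<in> i (t \<otimes> t)" using PGammaL_mult_mem[OF T T] i.hom_mult[OF t(1) t(1)] by simp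
      then have "i (t \<otimes> t) = scalar_maps"
        by (rule coset_eq_scalar_maps[OF i.hom_closed[OF tt] _ id_scalar])
      then have "t \<otimes> t = \<one>" using i_inj[OF tt G.one_closed] i_one by simp
      then have "t [^] (2::nat) = \<one>" using t(1) by (simp add: numeral_2_eq_2)
      then have "G.ord t dvd 2" using G.pow_eq_id[OF t(1)] by blast
      moreover have "G.ord t \<noteq> 1"
      proof
        assume "G.ord t = 1"
        then have "t = \<one>" using G.pow_ord_eq_1[OF t(1)] t(1) by simp
        then have "transvection v \<in> scalar_maps" using T i_one by simp
        then show False using transvection_not_scalar[OF v] by blast
      qed
      ultimately have "G.ord t = 2" using prime_nat_iff two_is_prime_nat by blast
      then have "t \<in> involutions G" using t(1) by (simp add: involutions_def)
      moreover have "B = fixed_sylows 3 G t"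
        unfolding xy(1) using t(3) transvection_fix[OF _ v]
        by (intro block[symmetric, OF t(1)]) (simp add: v_def)
      ultimately show "B \<in> fixed_sylows 3 G ` involutions G" by blast
    qed
  qed
  then have "coordinates p (ree_unital G)"
    unfolding coordinates_def ree_unital_def using p_bij by simp
  then show ?thesis by blast
qed

end

theorem theorem1p1:
  fixes G :: "('g, 'm) monoid_scheme"
    and \<phi> :: "'g set \<Rightarrow> ('f::field ^ 3) set"
    and \<psi> :: "'g set set \<Rightarrow> ('f ^ 3) set"
  assumes "CARD('k::{field,finite}) = 8"
    and "group G"
    and "G \<cong> (PGammaL :: ('k ^ 2 \<Rightarrow> 'k ^ 2) set monoid)"
    and "embedding (ree_unital G) PG2 \<phi> \<psi>"
  shows
    "((\<exists>K :: 'f set. is_subfield K \<and> card K = 8) \<and>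
      (\<exists>E. subplane E PG2 \<and> has_order E 8 \<and>
           \<phi> ` pts (ree_unital G) \<subseteq> pts E \<and> \<psi> ` blks (ree_unital G) \<subseteq> blks E)) \<and>
     (\<forall>\<phi>' \<psi>'. embedding (ree_unital G) PG2 \<phi>' \<psi>' \<longrightarrow>
        (\<exists>a b. \<exists>A :: 'f ^ 3 ^ 3. automorphism (ree_unital G) a b \<and> invertible A \<and>
           (\<forall>P\<in>pts (ree_unital G). \<phi>' P = (*v) A ` \<phi> (a P)) \<and>
           (\<forall>B\<in>blks (ree_unital G). \<psi>' B = (*v) A ` \<psi> (b B)))) \<and>
     ((\<forall>E. subplane E PG2 \<and> has_order E 8 \<and>
           \<phi> ` pts (ree_unital G) \<subseteq> pts E \<and> \<psi> ` blks (ree_unital G) \<subseteq> blks E \<longrightarrow>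
           admissible (ree_unital G) E \<phi>) \<and>
      ((\<exists>s :: 'f \<Rightarrow> 'f. field_automorphism s \<and> (\<exists>x. x ^ 8 = x \<and> s x \<noteq> x)) \<longrightarrow>
         admissible (ree_unital G) PG2 \<phi>))"
proof -
  obtain z :: 'k where "gf8_root z" by (rule card_8_imp_gf8_root[OF assms(1)])
  then interpret k: gf8_root z .
  have "range (phom z) = UNIV"
    using k.card_range assms(1) by (intro card_subset_eq) simp_all
  then interpret k: field8 z by unfold_locales
  obtain i where "i \<in> iso G (PGammaL :: ('k ^ 2 \<Rightarrow> 'k ^ 2) set monoid)"
    using assms(3) by (auto simp: is_iso_def)
  then obtain p where p: "coordinates p (ree_unital G)"
    using k.ree_unital_coordinates[OF assms(2)] by blast
  obtain A \<zeta> where "standard_embedding \<zeta> p (ree_unital G) \<phi> \<psi> A"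
    by (rule embedding_imp_standard[OF p assms(4)])
  then interpret standard_embedding \<zeta> p "ree_unital G" \<phi> \<psi> A .
  show ?thesis
  proof (intro conjI allI impI)
    show "\<exists>K :: 'f set. is_subfield K \<and> card K = 8"
      using is_subfield_range card_range by blast
    show "\<exists>E. subplane E PG2 \<and> has_order E 8 \<and>
        \<phi> ` pts (ree_unital G) \<subseteq> pts E \<and> \<psi> ` blks (ree_unital G) \<subseteq> blks E"
      by (rule image_in_subplane)
    show "\<exists>a b. \<exists>A :: 'f ^ 3 ^ 3. automorphism (ree_unital G) a b \<and> invertible A \<and>
        (\<forall>P\<in>pts (ree_unital G). \<phi>' P = (*v) A ` \<phi> (a P)) \<and>
        (\<forall>B\<in>blks (ree_unital G). \<psi>' B = (*v) A ` \<psi> (b B))"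
      if "embedding (ree_unital G) PG2 \<phi>' \<psi>'" for \<phi>' \<psi>'
      by (rule embedding_unique[OF that])
    show "admissible (ree_unital G) E \<phi>"
      if "subplane E PG2 \<and> has_order E 8 \<and>
        \<phi> ` pts (ree_unital G) \<subseteq> pts E \<and> \<psi> ` blks (ree_unital G) \<subseteq> blks E" for E
      using that by (intro admissible_subplane[OF assms(4)]) simp_all
    show "admissible (ree_unital G) PG2 \<phi>"
      if "\<exists>s :: 'f \<Rightarrow> 'f. field_automorphism s \<and> (\<exists>x. x ^ 8 = x \<and> s x \<noteq> x)"
      using that by (elim exE conjE) (rule admissible_PG2[OF assms(4)])
  qed
qed

end
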